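(* Let $\Lambda\in P^+$ and let $\beta=\alpha_{j_1}+\dots+\alpha_{j_n}\in Q_n^+$ where $j_1,\dots,j_n\in I$ are pairwise distinct. (1) Let $\mu,\nu\in I^\beta$ with $e(\nu)R^\Lambda(\beta)e(\mu)\neq0$, and let $d_{\mu,\nu}$ be the unique element of $\mathfrak{S}_n$ with $d_{\mu,\nu}\mu=\nu$. Then the elements $$\tau_{d_{\mu,\nu}}\prod_{k=1}^nx_k^{r_k}e(\mu),\qquad 0\le r_k<N^\Lambda(d_{\mu,\nu},\mu,k)\ (1\le k\le n),$$ form a $\mathbf{k}$-basis of $e(\nu)R^\Lambda(\beta)e(\mu)$. (2) $R^\Lambda(\beta)$ is indecomposable.
   Context: Fix a field $\mathbf{k}$ of characteristic $\neq 2$. A Cartan superdatum consists of an index set $I$; a symmetrizable generalized Cartan matrix $A=(a_{ij})_{i,j\in I}$ ($a_{ii}=2$, $a_{ij}\le 0$ for $i\ne j$, $a_{ij}=0\iff a_{ji}=0$, positive integers $d_i$ with $d_ia_{ij}=d_ja_{ji}$); a free abelian group $P$; $\mathbb{Z}$-linearly independent $\alpha_i\in P$; $h_i\in\mathrm{Hom}_{\mathbb{Z}}(P,\mathbb{Z})$ with $\langle h_i,\alpha_j\rangle=a_{ij}$; and $I=I_{\mathrm{even}}\sqcup I_{\mathrm{odd}}$ with $a_{ij}\in2\mathbb{Z}$ whenever $i\in I_{\mathrm{odd}}$. A symmetric bilinear form $(\cdot|\cdot)$ on $P$ satisfies $(\alpha_i|\lambda)=d_i\langle h_i,\lambda\rangle$.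 Parity $\mathrm{p}(i)=1$ if $i\in I_{\mathrm{odd}}$, $0$ otherwise. $Q_n^+$ is the set of $\sum_ik_i\alpha_i$ with $k_i\in\mathbb{Z}_{\ge0}$, $\sum k_i=n$; $P^+=\{\Lambda:\langle h_i,\Lambda\rangle\ge0\ \forall i\}$; $I^\beta=\{\nu\in I^n:\sum_s\alpha_{\nu_s}=\beta\}$. For $\nu\in I^n$, $\mathcal{P}_\nu=\mathbf{k}\langle\mathrm{x}_1,\dots,\mathrm{x}_n\rangle/(\mathrm{x}_a\mathrm{x}_b-(-1)^{\mathrm{p}(\nu_a)\mathrm{p}(\nu_b)}\mathrm{x}_b\mathrm{x}_a)$. Fix $Q_{ij}(\mathrm{x}_1,\mathrm{x}_2)=\sum_{r,s}t_{i,j;(r,s)}\mathrm{x}_1^r\mathrm{x}_2^s\in\mathcal{P}_{(i,j)}$ with: $t_{i,j;(r,s)}\ne0$ only if $-2(\alpha_i|\alpha_j)-r(\alpha_i|\alpha_i)-s(\alpha_j|\alpha_j)=0$; $t_{i,j;(r,s)}=t_{j,i;(s,r)}$; $t_{i,j;(-a_{ij},0)}\in\mathbf{k}^\times$; $t_{i,j;(r,s)}=0$ if $i=j$ or ($i\in I_{\mathrm{odd}}$ and $r$ odd). $R(\beta)$ is the $\mathbf{k}$-algebra with generators $e(\nu)$ ($\nu\in I^\beta$), $x_1,\dots,x_n$, $\tau_1,\dots,\tau_{n-1}$ and relations: $e(\mu)e(\nu)=\delta_{\mu\nu}e(\nu)$, $\sum_\nu e(\nu)=1$; $x_px_qe(\nu)=(-1)^{\mathrm{p}(\nu_p)\mathrm{p}(\nu_q)}x_qx_pe(\nu)$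 ($p\ne q$); $x_pe(\nu)=e(\nu)x_p$; $\tau_ae(\nu)=e(s_a\nu)\tau_a$; $\tau_ax_pe(\nu)=(-1)^{\mathrm{p}(\nu_p)\mathrm{p}(\nu_a)\mathrm{p}(\nu_{a+1})}x_p\tau_ae(\nu)$ ($p\ne a,a+1$); $(\tau_ax_{a+1}-(-1)^{\mathrm{p}(\nu_a)\mathrm{p}(\nu_{a+1})}x_a\tau_a)e(\nu)=(x_{a+1}\tau_a-(-1)^{\mathrm{p}(\nu_a)\mathrm{p}(\nu_{a+1})}\tau_ax_a)e(\nu)=\delta_{\nu_a,\nu_{a+1}}e(\nu)$; $\tau_a^2e(\nu)=Q_{\nu_a,\nu_{a+1}}(x_a,x_{a+1})e(\nu)$; $\tau_a\tau_be(\nu)=(-1)^{\mathrm{p}(\nu_a)\mathrm{p}(\nu_{a+1})\mathrm{p}(\nu_b)\mathrm{p}(\nu_{b+1})}\tau_b\tau_ae(\nu)$ ($|a-b|>1$); $(\tau_{a+1}\tau_a\tau_{a+1}-\tau_a\tau_{a+1}\tau_a)e(\nu)$ equals $\frac{Q_{\nu_a,\nu_{a+1}}(x_{a+2},x_{a+1})-Q_{\nu_a,\nu_{a+1}}(x_a,x_{a+1})}{x_{a+2}-x_a}e(\nu)$ if $\nu_a=\nu_{a+2}\in I_{\mathrm{even}}$, $(-1)^{\mathrm{p}(\nu_{a+1})}(x_{a+2}-x_a)\frac{Q_{\nu_a,\nu_{a+1}}(x_{a+2},x_{a+1})-Q_{\nu_a,\nu_{a+1}}(x_a,x_{a+1})}{x_{a+2}^2-x_a^2}e(\nu)$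 if $\nu_a=\nu_{a+2}\in I_{\mathrm{odd}}$, $0$ otherwise; $s_a=(a,a+1)$, and $\mathfrak{S}_n$ acts on $I^n$ by $(w\nu)_j=\nu_{w^{-1}(j)}$. For $\Lambda\in P^+$, $R^\Lambda(\beta)=R(\beta)/\langle\sum_{\nu}x_1^{\langle h_{\nu_1},\Lambda\rangle}e(\nu)\rangle$. For $w\in\mathfrak{S}_n$ with reduced expression $s_{i_1}\cdots s_{i_l}$, $\tau_w=\tau_{i_1}\cdots\tau_{i_l}$. For $w\in\mathfrak{S}_n$, $\nu\in I^n$, $1\le t\le n$: $J_w^{<t}=\{1\le j<t:w(j)<w(t)\}$ and $N^\Lambda(w,\nu,t)=\langle h_{\nu_t},\Lambda-\sum_{j\in J_w^{<t}}\alpha_{\nu_j}\rangle$. *)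

theory Defs
  imports Complex_Main "HOL-Library.Poly_Mapping" "HOL-Combinatorics.Permutations"
begin

(* The weight lattice P is the free abelian group 'b =>0 int on a basis type 'b.
   Positions are 0-based: x_0..x_{n-1}, tau_0..tau_{n-2}. *)

definition zscale :: "int \<Rightarrow> ('b \<Rightarrow>\<^sub>0 int) \<Rightarrow> ('b \<Rightarrow>\<^sub>0 int)" where
  "zscale c x = Poly_Mapping.map (\<lambda>v. c * v) x"

definition zlin_indep :: "'i set \<Rightarrow> ('i \<Rightarrow> ('b \<Rightarrow>\<^sub>0 int)) \<Rightarrow> bool" where
  "zlin_indep I alpha \<longleftrightarrow>
     (\<forall>F c. finite F \<longrightarrow> F \<subseteq> I \<longrightarrow> (\<Sum>i\<in>F. zscale (c i) (alpha i)) = 0 \<longrightarrow> (\<forall>i\<in>F. c i = 0))"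

definition cartan_superdatum ::
  "'i set \<Rightarrow> ('i \<Rightarrow> 'i \<Rightarrow> int) \<Rightarrow> ('i \<Rightarrow> int) \<Rightarrow> ('i \<Rightarrow> ('b \<Rightarrow>\<^sub>0 int))
   \<Rightarrow> ('i \<Rightarrow> ('b \<Rightarrow>\<^sub>0 int) \<Rightarrow> int) \<Rightarrow> 'i set \<Rightarrow> bool" where
  "cartan_superdatum I A d alpha h Iodd \<longleftrightarrow>
     (\<forall>i\<in>I. A i i = 2) \<and>
     (\<forall>i\<in>I. \<forall>j\<in>I. i \<noteq> j \<longrightarrow> A i j \<le> 0) \<and>
     (\<forall>i\<in>I. \<forall>j\<in>I. A i j = 0 \<longleftrightarrow> A j i = 0) \<and>
     (\<forall>i\<in>I. d i > 0) \<and>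
     (\<forall>i\<in>I. \<forall>j\<in>I. d i * A i j = d j * A j i) \<and>
     zlin_indep I alpha \<and>
     (\<forall>i\<in>I. \<forall>x y. h i (x + y) = h i x + h i y) \<and>
     (\<forall>i\<in>I. \<forall>j\<in>I. h i (alpha j) = A i j) \<and>
     Iodd \<subseteq> I \<and>
     (\<forall>i\<in>Iodd. \<forall>j\<in>I. even (A i j))"

definition sym_bilinear_form ::
  "'i set \<Rightarrow> ('i \<Rightarrow> int) \<Rightarrow> ('i \<Rightarrow> ('b \<Rightarrow>\<^sub>0 int)) \<Rightarrow> ('i \<Rightarrow> ('b \<Rightarrow>\<^sub>0 int) \<Rightarrow> int)
   \<Rightarrow> (('b \<Rightarrow>\<^sub>0 int) \<Rightarrow> ('b \<Rightarrow>\<^sub>0 int) \<Rightarrow> rat) \<Rightarrow> bool" where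
  "sym_bilinear_form I d alpha h bf \<longleftrightarrow>
     (\<forall>x y. bf x y = bf y x) \<and>
     (\<forall>x y z. bf (x + y) z = bf x z + bf y z) \<and>
     (\<forall>i\<in>I. \<forall>lam. bf (alpha i) lam = of_int (d i * h i lam))"

text \<open>Conditions on the coefficients t_{i,j;(r,s)} of the polynomials Q_{ij}.\<close>
definition Q_ok ::
  "'i set \<Rightarrow> ('i \<Rightarrow> 'i \<Rightarrow> int) \<Rightarrow> 'i set \<Rightarrow> (('b \<Rightarrow>\<^sub>0 int) \<Rightarrow> ('b \<Rightarrow>\<^sub>0 int) \<Rightarrow> rat)
   \<Rightarrow> ('i \<Rightarrow> ('b \<Rightarrow>\<^sub>0 int)) \<Rightarrow> ('i \<Rightarrow> 'i \<Rightarrow> nat \<times> nat \<Rightarrow> 'k::field) \<Rightarrow> bool" where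
  "Q_ok I A Iodd bf alpha t \<longleftrightarrow>
     (\<forall>i\<in>I. \<forall>j\<in>I.
        (\<forall>r s. t i j (r, s) \<noteq> 0 \<longrightarrow>
           - 2 * bf (alpha i) (alpha j) - of_nat r * bf (alpha i) (alpha i)
             - of_nat s * bf (alpha j) (alpha j) = 0) \<and>
        (\<forall>r s. t i j (r, s) = t j i (s, r)) \<and>
        (i \<noteq> j \<longrightarrow> t i j (nat (- A i j), 0) \<noteq> 0) \<and>
        (\<forall>r s. (i = j \<or> (i \<in> Iodd \<and> odd r)) \<longrightarrow> t i j (r, s) = 0))"

definition dominant :: "'i set \<Rightarrow> ('i \<Rightarrow> ('b \<Rightarrow>\<^sub>0 int) \<Rightarrow> int) \<Rightarrow> ('b \<Rightarrow>\<^sub>0 int) \<Rightarrow> bool" where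
  "dominant I h Lam \<longleftrightarrow> (\<forall>i\<in>I. h i Lam \<ge> 0)"

definition Ibeta :: "'i set \<Rightarrow> ('i \<Rightarrow> ('b \<Rightarrow>\<^sub>0 int)) \<Rightarrow> nat \<Rightarrow> ('b \<Rightarrow>\<^sub>0 int) \<Rightarrow> 'i list set" where
  "Ibeta I alpha n beta = {nu. length nu = n \<and> set nu \<subseteq> I \<and> (\<Sum>s<n. alpha (nu ! s)) = beta}"

definition perm_act :: "(nat \<Rightarrow> nat) \<Rightarrow> 'i list \<Rightarrow> 'i list" where
  "perm_act w nu = map (\<lambda>j. nu ! inv w j) [0..<length nu]"

definition sref :: "nat \<Rightarrow> nat \<Rightarrow> nat" where
  "sref a = transpose a (Suc a)"

definition word_perm :: "nat list \<Rightarrow> nat \<Rightarrow> nat" where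
  "word_perm as = foldr (\<lambda>a w. sref a \<circ> w) as id"

definition reduced_expr :: "nat \<Rightarrow> (nat \<Rightarrow> nat) \<Rightarrow> nat list \<Rightarrow> bool" where
  "reduced_expr n w as \<longleftrightarrow>
     (\<forall>a\<in>set as. Suc a < n) \<and> word_perm as = w \<and>
     (\<forall>bs. (\<forall>b\<in>set bs. Suc b < n) \<longrightarrow> word_perm bs = w \<longrightarrow> length as \<le> length bs)"

datatype 'i gen = E "'i list" | X nat | T nat

text \<open>Elements of the free algebra: coefficient functions on words (finitely supported ones
  are the actual elements, see fa_elems).\<close>
type_synonym ('i, 'k) fa = "'i gen list \<Rightarrow> 'k"

definition fa_zero :: "('i, 'k::field) fa" where "fa_zero = (\<lambda>_. 0)"
definition fa_add :: "('i, 'k::field) fa \<Rightarrow> ('i, 'k) fa \<Rightarrow> ('i, 'k) fa" where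
  "fa_add f g = (\<lambda>w. f w + g w)"
definition fa_diff :: "('i, 'k::field) fa \<Rightarrow> ('i, 'k) fa \<Rightarrow> ('i, 'k) fa" where
  "fa_diff f g = (\<lambda>w. f w - g w)"
definition fa_smul :: "'k::field \<Rightarrow> ('i, 'k) fa \<Rightarrow> ('i, 'k) fa" where
  "fa_smul c f = (\<lambda>w. c * f w)"
definition fa_mult :: "('i, 'k::field) fa \<Rightarrow> ('i, 'k) fa \<Rightarrow> ('i, 'k) fa" where
  "fa_mult f g = (\<lambda>w. \<Sum>k\<le>length w. f (take k w) * g (drop k w))"
definition fa_word :: "'i gen list \<Rightarrow> ('i, 'k::field) fa" where
  "fa_word u = (\<lambda>w. if w = u then 1 else 0)"
definition fa_sum :: "('a \<Rightarrow> ('i, 'k::field) fa) \<Rightarrow> 'a set \<Rightarrow> ('i, 'k) fa" where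
  "fa_sum F A = (\<lambda>w. \<Sum>a\<in>A. F a w)"

definition fa_elems :: "'i gen set \<Rightarrow> ('i, 'k::field) fa set" where
  "fa_elems G = {f. finite {w. f w \<noteq> 0} \<and> (\<forall>w. f w \<noteq> 0 \<longrightarrow> set w \<subseteq> G)}"

inductive_set fa_ideal :: "'i gen set \<Rightarrow> ('i, 'k::field) fa set \<Rightarrow> ('i, 'k) fa set"
  for G S where
  zero: "fa_zero \<in> fa_ideal G S"
| step: "f \<in> fa_ideal G S \<Longrightarrow> r \<in> S \<Longrightarrow> set u \<subseteq> G \<Longrightarrow> set v \<subseteq> G \<Longrightarrow>
     fa_add f (fa_smul c (fa_mult (fa_mult (fa_word u) r) (fa_word v))) \<in> fa_ideal G S"

definition sg :: "bool \<Rightarrow> 'k::field" where "sg b = (if b then -1 else 1)"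

definition xmon :: "nat \<Rightarrow> nat \<Rightarrow> 'i gen list" where "xmon p r = replicate r (X p)"

definition QH_gens :: "nat \<Rightarrow> 'i list set \<Rightarrow> 'i gen set" where
  "QH_gens n Ib = E ` Ib \<union> X ` {..<n} \<union> T ` {a. Suc a < n}"

definition Qpoly :: "('i \<Rightarrow> 'i \<Rightarrow> nat \<times> nat \<Rightarrow> 'k::field) \<Rightarrow> 'i \<Rightarrow> 'i \<Rightarrow> nat \<Rightarrow> nat \<Rightarrow> ('i, 'k) fa" where
  "Qpoly t i j u v =
     fa_sum (\<lambda>(r, s). fa_smul (t i j (r, s)) (fa_word (xmon u r @ xmon v s))) {rs. t i j rs \<noteq> 0}"

text \<open>Right hand side of the braid relation (before multiplying by e(nu)), with the
  divided differences written out explicitly.\<close>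
definition braid_rhs :: "'i set \<Rightarrow> ('i \<Rightarrow> 'i \<Rightarrow> nat \<times> nat \<Rightarrow> 'k::field) \<Rightarrow> 'i list \<Rightarrow> nat \<Rightarrow> ('i, 'k) fa" where
  "braid_rhs Iodd t nu a =
    (let i = nu ! a; j = nu ! Suc a in
     if nu ! a = nu ! (a + 2) \<and> i \<notin> Iodd then
       fa_sum (\<lambda>(r, s). fa_smul (t i j (r, s))
          (fa_sum (\<lambda>k. fa_word (xmon (a + 2) k @ xmon a (r - 1 - k) @ xmon (Suc a) s)) {..<r}))
         {rs. t i j rs \<noteq> 0}
     else if nu ! a = nu ! (a + 2) \<and> i \<in> Iodd then
       fa_smul (sg (j \<in> Iodd))
        (fa_mult (fa_diff (fa_word [X (a + 2)]) (fa_word [X a]))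
          (fa_sum (\<lambda>(r, s). fa_smul (t i j (r, s))
             (fa_sum (\<lambda>k. fa_word (xmon (a + 2) (2 * k) @ xmon a (r - 2 - 2 * k) @ xmon (Suc a) s))
               {..<r div 2}))
            {rs. t i j rs \<noteq> 0}))
     else fa_zero)"

definition QH_rels :: "'i set \<Rightarrow> ('i \<Rightarrow> 'i \<Rightarrow> nat \<times> nat \<Rightarrow> 'k::field) \<Rightarrow> nat \<Rightarrow> 'i list set \<Rightarrow> ('i, 'k) fa set" where
  "QH_rels Iodd t n Ib =
     {fa_diff (fa_word [E mu, E nu]) (if mu = nu then fa_word [E nu] else fa_zero) | mu nu. mu \<in> Ib \<and> nu \<in> Ib}
   \<union> {fa_diff (fa_sum (\<lambda>nu. fa_word [E nu]) Ib) (fa_word [])}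
   \<union> {fa_diff (fa_word [X p, X q, E nu])
        (fa_smul (sg (nu ! p \<in> Iodd \<and> nu ! q \<in> Iodd)) (fa_word [X q, X p, E nu]))
       | p q nu. p < n \<and> q < n \<and> p \<noteq> q \<and> nu \<in> Ib}
   \<union> {fa_diff (fa_word [X p, E nu]) (fa_word [E nu, X p]) | p nu. p < n \<and> nu \<in> Ib}
   \<union> {fa_diff (fa_word [T a, E nu]) (fa_word [E (perm_act (sref a) nu), T a]) | a nu. Suc a < n \<and> nu \<in> Ib}
   \<union> {fa_diff (fa_word [T a, X p, E nu])
        (fa_smul (sg (nu ! p \<in> Iodd \<and> nu ! a \<in> Iodd \<and> nu ! Suc a \<in> Iodd)) (fa_word [X p, T a, E nu]))
       | a p nu. Suc a < n \<and> p < n \<and> p \<noteq> a \<and> p \<noteq> Suc a \<and> nu \<in> Ib}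
   \<union> {fa_diff (fa_diff (fa_word [T a, X (Suc a), E nu])
                 (fa_smul (sg (nu ! a \<in> Iodd \<and> nu ! Suc a \<in> Iodd)) (fa_word [X a, T a, E nu])))
        (if nu ! a = nu ! Suc a then fa_word [E nu] else fa_zero)
       | a nu. Suc a < n \<and> nu \<in> Ib}
   \<union> {fa_diff (fa_diff (fa_word [X (Suc a), T a, E nu])
                 (fa_smul (sg (nu ! a \<in> Iodd \<and> nu ! Suc a \<in> Iodd)) (fa_word [T a, X a, E nu])))
        (if nu ! a = nu ! Suc a then fa_word [E nu] else fa_zero)
       | a nu. Suc a < n \<and> nu \<in> Ib}
   \<union> {fa_diff (fa_word [T a, T a, E nu])
        (fa_mult (Qpoly t (nu ! a) (nu ! Suc a) a (Suc a)) (fa_word [E nu]))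
       | a nu. Suc a < n \<and> nu \<in> Ib}
   \<union> {fa_diff (fa_word [T a, T b, E nu])
        (fa_smul (sg (nu ! a \<in> Iodd \<and> nu ! Suc a \<in> Iodd \<and> nu ! b \<in> Iodd \<and> nu ! Suc b \<in> Iodd))
           (fa_word [T b, T a, E nu]))
       | a b nu. Suc a < n \<and> Suc b < n \<and> (a + 1 < b \<or> b + 1 < a) \<and> nu \<in> Ib}
   \<union> {fa_diff (fa_diff (fa_word [T (Suc a), T a, T (Suc a), E nu]) (fa_word [T a, T (Suc a), T a, E nu]))
        (fa_mult (braid_rhs Iodd t nu a) (fa_word [E nu]))
       | a nu. a + 2 < n \<and> nu \<in> Ib}"

definition cyc_rel :: "('i \<Rightarrow> ('b \<Rightarrow>\<^sub>0 int) \<Rightarrow> int) \<Rightarrow> ('b \<Rightarrow>\<^sub>0 int) \<Rightarrow> nat \<Rightarrow> 'i list set \<Rightarrow> ('i, 'k::field) fa set" where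
  "cyc_rel h Lam n Ib =
     (if n = 0 then {} else {fa_sum (\<lambda>nu. fa_word (xmon 0 (nat (h (nu ! 0) Lam)) @ [E nu])) Ib})"

text \<open>R^Lambda(beta) = (free algebra on QH_gens) / cyc_ideal.\<close>
definition cyc_ideal :: "'i set \<Rightarrow> ('i \<Rightarrow> ('b \<Rightarrow>\<^sub>0 int)) \<Rightarrow> ('i \<Rightarrow> ('b \<Rightarrow>\<^sub>0 int) \<Rightarrow> int) \<Rightarrow> 'i set
    \<Rightarrow> ('i \<Rightarrow> 'i \<Rightarrow> nat \<times> nat \<Rightarrow> 'k::field) \<Rightarrow> ('b \<Rightarrow>\<^sub>0 int) \<Rightarrow> nat \<Rightarrow> ('b \<Rightarrow>\<^sub>0 int) \<Rightarrow> ('i, 'k) fa set" where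
  "cyc_ideal I alpha h Iodd t Lam n beta =
     fa_ideal (QH_gens n (Ibeta I alpha n beta))
       (QH_rels Iodd t n (Ibeta I alpha n beta) \<union> cyc_rel h Lam n (Ibeta I alpha n beta))"

text \<open>e(nu) (F/J) e(mu), as a set of representatives in F.\<close>
definition corner :: "'i gen set \<Rightarrow> ('i, 'k::field) fa set \<Rightarrow> 'i list \<Rightarrow> 'i list \<Rightarrow> ('i, 'k) fa set" where
  "corner G J nu mu = {g \<in> fa_elems G. \<exists>f \<in> fa_elems G.
        fa_diff g (fa_mult (fa_mult (fa_word [E nu]) f) (fa_word [E mu])) \<in> J}"

definition quot_basis :: "('i, 'k::field) fa set \<Rightarrow> ('i, 'k) fa set \<Rightarrow> 'a set \<Rightarrow> ('a \<Rightarrow> ('i, 'k) fa) \<Rightarrow> bool" where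
  "quot_basis J C B b \<longleftrightarrow>
     (\<forall>x\<in>B. b x \<in> C) \<and>
     (\<forall>c. fa_sum (\<lambda>x. fa_smul (c x) (b x)) B \<in> J \<longrightarrow> (\<forall>x\<in>B. c x = 0)) \<and>
     (\<forall>g\<in>C. \<exists>c. fa_diff g (fa_sum (\<lambda>x. fa_smul (c x) (b x)) B) \<in> J)"

definition quot_indecomposable :: "'i gen set \<Rightarrow> ('i, 'k::field) fa set \<Rightarrow> bool" where
  "quot_indecomposable G J \<longleftrightarrow>
     (\<forall>z\<in>fa_elems G.
        (\<forall>f\<in>fa_elems G. fa_diff (fa_mult z f) (fa_mult f z) \<in> J) \<and> fa_diff (fa_mult z z) z \<in> J
        \<longrightarrow> z \<in> J \<or> fa_diff z (fa_word []) \<in> J)"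

definition NLam :: "('i \<Rightarrow> ('b \<Rightarrow>\<^sub>0 int)) \<Rightarrow> ('i \<Rightarrow> ('b \<Rightarrow>\<^sub>0 int) \<Rightarrow> int) \<Rightarrow> ('b \<Rightarrow>\<^sub>0 int)
    \<Rightarrow> (nat \<Rightarrow> nat) \<Rightarrow> 'i list \<Rightarrow> nat \<Rightarrow> int" where
  "NLam alpha h Lam w nu t = h (nu ! t) (Lam - (\<Sum>j\<in>{j. j < t \<and> w j < w t}. alpha (nu ! j)))"

definition basis_word :: "nat \<Rightarrow> nat list \<Rightarrow> (nat \<Rightarrow> nat) \<Rightarrow> 'i list \<Rightarrow> 'i gen list" where
  "basis_word n as r mu = map T as @ concat (map (\<lambda>k. xmon k (r k)) [0..<n]) @ [E mu]"

definition exps :: "nat \<Rightarrow> (nat \<Rightarrow> int) \<Rightarrow> (nat \<Rightarrow> nat) set" where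
  "exps n N = {r. (\<forall>k<n. int (r k) < N k) \<and> (\<forall>k\<ge>n. r k = 0)}"

end

theory Submission
  imports Defs
begin

text \<open>
  As the simple roots in \<open>beta\<close> are distinct, strands of equal colour never meet, and
  \<open>e(nu) R e(mu)\<close> is \<open>tau_d\<close> times a skew polynomial ring.  Remembering which pairs of strands
  have crossed gives a faithful representation of \<open>R e(mu)\<close> on polynomials.  In it the
  \<open>(nu, mu)\<close> corner of the cyclotomic ideal is generated by the elements
  \<open>x_i^(Lambda_i) * (\<Prod>j. Q_ij(x_i, x_j))\<close>, where \<open>j\<close> runs over the strands that are to the left
  of \<open>i\<close> in both \<open>mu\<close> and \<open>nu\<close>: pull strand \<open>i\<close> to the far left, apply the cyclotomic relation,
  and pull it back.  Such an element is monic in \<open>x_i\<close> of degree \<open>N\<close> up to a unit, with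
  coefficients in the variables of strands further left, whence the monomial basis.

  The diagonal corners are graded with scalars in degree 0, so a central idempotent restricts to 0
  or 1 on each \<open>e(mu)\<close>.  Nonzero corners force equal values, and any two
  \<open>mu\<close> with \<open>e(mu) \<noteq> 0\<close> are linked by a chain of nonzero corners.
\<close>

section \<open>The free algebra as a ring\<close>

text \<open>A presentation yields upper bounds easily; that nothing more collapses needs a model.
  The whole factor Q is put on the second meeting of two strands, while the first costs only a sign:
  words made of first crossings then act invertibly, which makes faithfulness checkable.

  The obstacle is odd parity. Odd dots anticommute and odd crossings anticommute at a distance, yet
  the braid relation carries no sign. Values are kept in commutative polynomials, and the signs are
  moved into substitutions x_j -> -x_j and into a sign attached to each crossing.

  Independence of the monomials comes from division in the last variable. Spanning needs
  termination, since a division can raise exponents of smaller variables; the symmetrizers d_i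
  supply a positive weight in which Q is homogeneous. The same weight makes elements without
  constant term nilpotent on a diagonal corner, which forces a central idempotent to be 0 or 1
  there.\<close>

abbreviation "lookup \<equiv> Poly_Mapping.lookup"
abbreviation "keys \<equiv> Poly_Mapping.keys"
abbreviation "single \<equiv> Poly_Mapping.single"

section \<open>Induction over finitely supported functions\<close>

lemma poly_mapping_sum_single: "p = (\<Sum>k\<in>keys p. single k (lookup p k))"
  by (rule poly_mapping_eqI) (auto simp: lookup_sum lookup_single when_def in_keys_iff)

lemma poly_mapping_induct_keys [consumes 1, case_names zero single add]:
  fixes p :: "'a \<Rightarrow>\<^sub>0 'b::comm_monoid_add"
  assumes "keys p \<subseteq> A" and zero: "P 0"
    and single: "\<And>k c. k \<in> A \<Longrightarrow> P (single k c)"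
    and add: "\<And>p q. P p \<Longrightarrow> P q \<Longrightarrow> P (p + q)"
  shows "P p"
proof -
  have "P (\<Sum>k\<in>K. single k (lookup p k))" if "finite K" "K \<subseteq> A" for K
    using that by (induction K rule: finite_induct) (auto intro: zero single add)
  from this[OF finite_keys assms(1)] show ?thesis
    by (metis poly_mapping_sum_single)
qed

lemma poly_mapping_induct [case_names zero single add]:
  fixes p :: "'a \<Rightarrow>\<^sub>0 'b::comm_monoid_add"
  assumes zero: "P 0"
    and single: "\<And>k c. P (single k c)"
    and add: "\<And>p q. P p \<Longrightarrow> P q \<Longrightarrow> P (p + q)"
  shows "P p"
  by (rule poly_mapping_induct_keys[of p UNIV]) (use assms in auto)

text \<open>The wrapper carries a \<open>monoid_add\<close> in which addition is concatenation.
  Finitely supported functions on it multiply by convolution, which is the product of the free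
  algebra, so the ring laws come for free.\<close>

datatype 'i gword = Gw (letters: "'i gen list")

instantiation gword :: (type) monoid_add
begin
definition zero_gword_def: "0 = Gw []"
definition plus_gword_def: "v + w = Gw (letters v @ letters w)"
instance by standard (auto simp: zero_gword_def plus_gword_def)
end

type_synonym ('i, 'k) falg = "'i gword \<Rightarrow>\<^sub>0 'k"

definition sc :: "'k::field \<Rightarrow> ('i, 'k) falg" where "sc c = single 0 c"
definition wd :: "'i gen list \<Rightarrow> ('i, 'k::field) falg" where "wd u = single (Gw u) 1"

lemma wd_append: "wd (u @ v) = wd u * wd v"
  by (simp add: wd_def mult_single plus_gword_def)

lemma wd_Nil [simp]: "wd [] = 1"
  by (simp add: wd_def flip: zero_gword_def)

lemma wd_Cons: "wd (g # u) = wd [g] * wd u"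
  using wd_append[of "[g]" u] by simp

lemma sc_0 [simp]: "sc 0 = 0" and sc_1 [simp]: "sc 1 = 1"
  by (simp_all add: sc_def)

lemma sc_add: "sc (a + b) = sc a + sc b"
  by (simp add: sc_def single_add)

lemma sc_mult: "sc (a * b) = sc a * sc b"
  by (simp add: sc_def mult_single)

lemma sc_uminus: "sc (- a) = - sc a"
  by (simp add: sc_def single_uminus)

lemma single_eq_sc_wd: "single w c = sc c * wd (letters w)"
  by (simp add: sc_def wd_def mult_single)

lemma sc_commute: "x * sc c = sc c * x"
  by (induction x rule: poly_mapping_induct)
    (simp_all add: sc_def mult_single algebra_simps)

text \<open>Bridge to the bare coefficient functions of the statement. It is injective, compatible
  with all operations, and reaches every finitely supported function, so the calculations can take
  place in a ring.\<close>

definition to_fa :: "('i, 'k::field) falg \<Rightarrow> ('i, 'k) fa" where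
  "to_fa p = (\<lambda>w. lookup p (Gw w))"

lemma inj_to_fa: "to_fa p = to_fa q \<Longrightarrow> p = q"
  by (rule poly_mapping_eqI) (metis gword.collapse to_fa_def)

lemma to_fa_zero: "to_fa 0 = fa_zero"
  by (simp add: to_fa_def fa_zero_def)

lemma to_fa_add: "to_fa (p + q) = fa_add (to_fa p) (to_fa q)"
  by (simp add: to_fa_def fa_add_def lookup_add)

lemma to_fa_diff: "to_fa (p - q) = fa_diff (to_fa p) (to_fa q)"
  by (simp add: to_fa_def fa_diff_def lookup_minus)

lemma to_fa_wd: "to_fa (wd u) = fa_word u"
  by (auto simp: to_fa_def fa_word_def wd_def lookup_single when_def fun_eq_iff)

lemma to_fa_sum: "to_fa (\<Sum>a\<in>A. F a) = fa_sum (\<lambda>a. to_fa (F a)) A"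
  by (simp add: to_fa_def fa_sum_def lookup_sum)

lemma fa_mult_add_left: "fa_mult (fa_add f g) h = fa_add (fa_mult f h) (fa_mult g h)"
  by (simp add: fa_mult_def fa_add_def algebra_simps sum.distrib)

lemma fa_mult_add_right: "fa_mult f (fa_add g h) = fa_add (fa_mult f g) (fa_mult f h)"
  by (simp add: fa_mult_def fa_add_def algebra_simps sum.distrib)

lemma fa_mult_zero: "fa_mult fa_zero f = fa_zero" "fa_mult f fa_zero = fa_zero"
  by (simp_all add: fa_mult_def fa_zero_def)

text \<open>A word is \<open>x @ y\<close> for given \<open>x\<close> and \<open>y\<close> at one
  splitting point only, namely \<open>length x\<close>, so the sum over splittings has at most one
  nonzero term.\<close>

lemma to_fa_mult_single:
  "to_fa (single v a * single w b) = fa_mult (to_fa (single v a)) (to_fa (single w b))"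
proof (rule ext)
  fix l
  obtain x y where vw: "v = Gw x" "w = Gw y" by (metis gword.collapse)
  have "fa_mult (to_fa (single v a)) (to_fa (single w b)) l
      = (\<Sum>k\<le>length l. if take k l = x \<and> drop k l = y then a * b else 0)"
    by (auto simp: fa_mult_def to_fa_def vw lookup_single when_def intro!: sum.cong)
  also have "\<dots> = (if l = x @ y then a * b else 0)"
  proof (cases "l = x @ y")
    case True
    then have "(take k l = x \<and> drop k l = y) \<longleftrightarrow> k = length x" if "k \<le> length l" for k
      using that by (metis append_eq_conv_conj length_take min.absorb2)
    then have "(\<Sum>k\<le>length l. if take k l = x \<and> drop k l = y then a * b else 0)
        = (\<Sum>k\<le>length l. if k = length x then a * b else 0)"
      by (intro sum.cong) auto
    with True show ?thesis by simp
  next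
    case False
    then have "\<not> (take k l = x \<and> drop k l = y)" for k by (metis append_take_drop_id)
    with False show ?thesis by (simp only: if_False sum.neutral_const)
  qed
  also have "\<dots> = to_fa (single v a * single w b) l"
    by (auto simp: to_fa_def vw mult_single plus_gword_def lookup_single when_def)
  finally show "to_fa (single v a * single w b) l
    = fa_mult (to_fa (single v a)) (to_fa (single w b)) l" by simp
qed

lemma to_fa_mult: "to_fa (p * q) = fa_mult (to_fa p) (to_fa q)"
proof (induction p rule: poly_mapping_induct)
  case zero
  show ?case by (simp add: to_fa_zero fa_mult_zero)
next
  case (single v a)
  show ?case
    by (induction q rule: poly_mapping_induct)
      (simp_all add: to_fa_zero fa_mult_zero to_fa_mult_single to_fa_add fa_mult_add_right distrib_left)
next
  case (add p p')
  then show ?case by (simp add: to_fa_add fa_mult_add_left distrib_right)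
qed

lemma to_fa_sc: "to_fa (sc c * p) = fa_smul c (to_fa p)"
  by (induction p rule: poly_mapping_induct)
    (simp_all add: to_fa_def fa_smul_def sc_def mult_single lookup_single when_def
       lookup_add distrib_left fun_eq_iff)

section \<open>The subalgebra on the admissible letters and its two-sided ideals\<close>

definition galg :: "'i gen set \<Rightarrow> ('i, 'k::field) falg set" where
  "galg G = {p. \<forall>w\<in>keys p. set (letters w) \<subseteq> G}"

lemma fa_elems_eq:
  fixes G :: "'i gen set"
  shows "(fa_elems G :: ('i, 'k::field) fa set) = to_fa ` galg G"
proof (intro equalityI subsetI)
  fix f :: "('i, 'k) fa"
  assume f: "f \<in> fa_elems G"
  let ?g = "\<lambda>w. f (letters w)"
  have "finite {w. ?g w \<noteq> 0}"
  proof -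
    have "{w. ?g w \<noteq> 0} \<subseteq> Gw ` {w. f w \<noteq> 0}"
      by (auto simp: image_iff) (metis gword.collapse)
    then show ?thesis using f by (auto simp: fa_elems_def intro: finite_subset)
  qed
  then have l: "lookup (Abs_poly_mapping ?g) = ?g" by simp
  then have "to_fa (Abs_poly_mapping ?g) = f" by (simp add: to_fa_def fun_eq_iff)
  moreover have "Abs_poly_mapping ?g \<in> galg G"
    using f unfolding galg_def fa_elems_def by (simp add: in_keys_iff l)
  ultimately show "f \<in> to_fa ` galg G" by (metis image_eqI)
next
  fix f :: "('i, 'k) fa"
  assume "f \<in> to_fa ` galg G"
  then obtain p where p: "p \<in> galg G" "f = to_fa p" by blast
  have "{w. f w \<noteq> 0} \<subseteq> letters ` keys p"
  proof
    fix w assume "w \<in> {w. f w \<noteq> 0}"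
    then have "Gw w \<in> keys p" using p by (simp add: to_fa_def in_keys_iff)
    then show "w \<in> letters ` keys p" by (metis gword.sel image_eqI)
  qed
  then have "finite {w. f w \<noteq> 0}" by (rule finite_subset) simp
  moreover have "set w \<subseteq> G" if "f w \<noteq> 0" for w
  proof -
    have "Gw w \<in> keys p" using p that by (simp add: to_fa_def in_keys_iff)
    with p(1) have "set (letters (Gw w)) \<subseteq> G" unfolding galg_def by blast
    then show ?thesis by simp
  qed
  ultimately show "f \<in> fa_elems G" by (simp add: fa_elems_def)
qed

lemma galg_add: "p \<in> galg G \<Longrightarrow> q \<in> galg G \<Longrightarrow> p + q \<in> galg G"
  using keys_add[of p q] by (auto simp: galg_def)

lemma galg_zero: "0 \<in> galg G"
  by (simp add: galg_def)

lemma galg_single: "set (letters w) \<subseteq> G \<Longrightarrow> single w c \<in> galg G"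
  by (simp add: galg_def)

lemma galg_induct [consumes 1, case_names zero word add]:
  assumes "p \<in> galg G" "P 0" "\<And>w c. set w \<subseteq> G \<Longrightarrow> P (sc c * wd w)"
    "\<And>p q. p \<in> galg G \<Longrightarrow> q \<in> galg G \<Longrightarrow> P p \<Longrightarrow> P q \<Longrightarrow> P (p + q)"
  shows "P p"
proof -
  have "p \<in> galg G \<and> P p"
  proof (rule poly_mapping_induct_keys[of p "{w. set (letters w) \<subseteq> G}" "\<lambda>p. p \<in> galg G \<and> P p"])
    show "keys p \<subseteq> {w. set (letters w) \<subseteq> G}" using assms(1) by (auto simp: galg_def)
  next
    fix w :: "'a gword" and c :: 'b
    assume "w \<in> {w. set (letters w) \<subseteq> G}"
    then show "single w c \<in> galg G \<and> P (single w c)"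
      by (metis assms(3) galg_single mem_Collect_eq single_eq_sc_wd)
  qed (use assms in \<open>auto simp: galg_zero galg_add\<close>)
  then show ?thesis ..
qed

lemma galg_sc_mult: "p \<in> galg G \<Longrightarrow> sc c * p \<in> galg G"
proof -
  assume "p \<in> galg G"
  moreover have "keys (sc c * p) \<subseteq> keys p"
    using keys_mult[of "sc c" p] by (auto simp: sc_def split: if_splits)
  ultimately show ?thesis by (auto simp: galg_def)
qed

lemma galg_uminus: "p \<in> galg G \<Longrightarrow> - p \<in> galg G"
  using galg_sc_mult[of p G "-1"] by (simp add: sc_uminus)

lemma galg_diff: "p \<in> galg G \<Longrightarrow> q \<in> galg G \<Longrightarrow> p - q \<in> galg G"
  using galg_add[of p G "- q"] galg_uminus by auto

lemma galg_mult: "p \<in> galg G \<Longrightarrow> q \<in> galg G \<Longrightarrow> p * q \<in> galg G"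
  using keys_mult[of p q] by (fastforce simp: galg_def plus_gword_def)

lemma galg_sum: "(\<And>a. a \<in> A \<Longrightarrow> F a \<in> galg G) \<Longrightarrow> (\<Sum>a\<in>A. F a) \<in> galg G"
  by (induction A rule: infinite_finite_induct) (auto simp: galg_zero galg_add)

lemma galg_wd: "set u \<subseteq> G \<Longrightarrow> wd u \<in> galg G"
  by (simp add: wd_def galg_single)

lemma galg_one: "1 \<in> galg G"
  using galg_wd[of "[]"] by simp

text \<open>Mirrors \<open>fa_ideal\<close> rule by rule, so that the two can be matched by
  induction. A step adds a multiple of one sandwiched relation; closure under sums and under
  products with elements of \<open>galg G\<close> has to be derived.\<close>

inductive_set ideal_gen :: "'i gen set \<Rightarrow> ('i, 'k::field) falg set \<Rightarrow> ('i, 'k) falg set"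
  for G R where
  zero: "0 \<in> ideal_gen G R"
| step: "f \<in> ideal_gen G R \<Longrightarrow> r \<in> R \<Longrightarrow> set u \<subseteq> G \<Longrightarrow> set v \<subseteq> G \<Longrightarrow>
     f + sc c * (wd u * r * wd v) \<in> ideal_gen G R"

lemma to_fa_step:
  "to_fa (p + sc c * (wd u * q * wd v))
    = fa_add (to_fa p) (fa_smul c (fa_mult (fa_mult (fa_word u) (to_fa q)) (fa_word v)))"
  by (subst to_fa_add, subst to_fa_sc) (simp only: to_fa_mult to_fa_wd)

lemma fa_ideal_eq: "fa_ideal G (to_fa ` R) = to_fa ` ideal_gen G R"
proof (intro equalityI subsetI)
  fix f assume "f \<in> fa_ideal G (to_fa ` R)"
  then show "f \<in> to_fa ` ideal_gen G R"
  proof induction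
    case zero
    show ?case by (metis image_eqI ideal_gen.zero to_fa_zero)
  next
    case (step f r u v c)
    then obtain p q where pq: "p \<in> ideal_gen G R" "f = to_fa p" "q \<in> R" "r = to_fa q" by blast
    have "p + sc c * (wd u * q * wd v) \<in> ideal_gen G R"
      using pq step.hyps by (intro ideal_gen.step)
    then have "to_fa (p + sc c * (wd u * q * wd v)) \<in> to_fa ` ideal_gen G R" by (rule imageI)
    then show ?case by (simp only: pq to_fa_step)
  qed
next
  have "to_fa p \<in> fa_ideal G (to_fa ` R)" if "p \<in> ideal_gen G R" for p
    using that
  proof induction
    case zero
    then show ?case by (simp add: to_fa_zero fa_ideal.zero)
  next
    case (step p r u v c)
    then show ?case
      by (simp only: to_fa_step) (intro fa_ideal.step imageI)
  qed
  then show "f \<in> fa_ideal G (to_fa ` R)" if "f \<in> to_fa ` ideal_gen G R" for f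
    using that by blast
qed

context
  fixes G :: "'i gen set" and R :: "('i, 'k::field) falg set"
begin

lemma ideal_gen_add:
  assumes "p \<in> ideal_gen G R" "q \<in> ideal_gen G R"
  shows "p + q \<in> ideal_gen G R"
  using assms(2)
proof (induction q rule: ideal_gen.induct)
  case (step f r u v c)
  then show ?case using ideal_gen.step[of "p + f" G R r u v c] by (simp only: add.assoc)
qed (simp add: assms(1))

lemma ideal_gen_sandwich:
  "p \<in> ideal_gen G R \<Longrightarrow> set u \<subseteq> G \<Longrightarrow> set v \<subseteq> G \<Longrightarrow> sc c * (wd u * p * wd v) \<in> ideal_gen G R"
proof (induction p rule: ideal_gen.induct)
  case zero
  show ?case by (simp add: ideal_gen.zero)
next
  case (step f r x y b)
  have "sc c * (wd u * (f + sc b * (wd x * r * wd y)) * wd v)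
      = sc c * (wd u * f * wd v) + sc (c * b) * (wd (u @ x) * r * wd (y @ v))"
  proof -
    have "wd u * (sc b * (wd x * r * wd y)) * wd v = sc b * (wd (u @ x) * r * wd (y @ v))"
    proof -
      have "wd u * (sc b * (wd x * r * wd y)) * wd v = (wd u * sc b) * (wd x * r * wd y) * wd v"
        by (simp only: mult.assoc)
      also have "\<dots> = sc b * (wd (u @ x) * r * wd (y @ v))"
        by (simp only: sc_commute wd_append mult.assoc)
      finally show ?thesis .
    qed
    then show ?thesis by (simp only: distrib_left distrib_right sc_mult mult.assoc)
  qed
  with step show ?case using ideal_gen.step[of "sc c * (wd u * f * wd v)" G R r "u @ x" "y @ v" "c * b"]
    by (simp only: set_append Un_subset_iff simp_thms)
qed

lemma ideal_gen_sc: "p \<in> ideal_gen G R \<Longrightarrow> sc c * p \<in> ideal_gen G R"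
  using ideal_gen_sandwich[of p "[]" "[]" c] by simp

lemma ideal_gen_base: "r \<in> R \<Longrightarrow> r \<in> ideal_gen G R"
  using ideal_gen.step[OF ideal_gen.zero, of r R "[]" G "[]" 1] by simp

lemma ideal_gen_uminus: "p \<in> ideal_gen G R \<Longrightarrow> - p \<in> ideal_gen G R"
  using ideal_gen_sc[of p "-1"] by (simp add: sc_uminus)

lemma ideal_gen_diff: "p \<in> ideal_gen G R \<Longrightarrow> q \<in> ideal_gen G R \<Longrightarrow> p - q \<in> ideal_gen G R"
  using ideal_gen_add[of p "- q"] ideal_gen_uminus by auto

lemma ideal_gen_sum: "(\<And>a. a \<in> A \<Longrightarrow> F a \<in> ideal_gen G R) \<Longrightarrow> (\<Sum>a\<in>A. F a) \<in> ideal_gen G R"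
  by (induction A rule: infinite_finite_induct) (auto simp: ideal_gen.zero ideal_gen_add)

lemma ideal_gen_mult_left: "q \<in> galg G \<Longrightarrow> p \<in> ideal_gen G R \<Longrightarrow> q * p \<in> ideal_gen G R"
proof (induction q rule: galg_induct)
  case (word w c)
  then show ?case using ideal_gen_sandwich[of p w "[]" c] by (simp add: mult.assoc)
qed (auto simp: ideal_gen.zero distrib_right ideal_gen_add)

lemma ideal_gen_mult_right: "q \<in> galg G \<Longrightarrow> p \<in> ideal_gen G R \<Longrightarrow> p * q \<in> ideal_gen G R"
proof (induction q rule: galg_induct)
  case (word w c)
  have "p * (sc c * wd w) = (p * sc c) * wd w" by (simp only: mult.assoc)
  also have "\<dots> = sc c * (wd [] * p * wd w)" by (simp only: sc_commute mult.assoc wd_Nil mult_1)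
  finally show ?case using ideal_gen_sandwich[of p "[]" w c] word by simp
qed (auto simp: ideal_gen.zero distrib_left ideal_gen_add)

end

lemma ideal_gen_mono: "p \<in> ideal_gen G R \<Longrightarrow> R \<subseteq> R' \<Longrightarrow> p \<in> ideal_gen G R'"
proof (induction rule: ideal_gen.induct)
  case (step f r u v c)
  then show ?case by (intro ideal_gen.step) auto
qed (rule ideal_gen.zero)

lemma ideal_gen_subset_galg: "p \<in> ideal_gen G R \<Longrightarrow> R \<subseteq> galg G \<Longrightarrow> p \<in> galg G"
proof (induction rule: ideal_gen.induct)
  case (step f r u v c)
  then show ?case by (intro galg_add galg_sc_mult galg_mult galg_wd) auto
qed (rule galg_zero)

section \<open>Commutative polynomials\<close>

type_synonym 'k mpl = "(nat \<Rightarrow>\<^sub>0 nat) \<Rightarrow>\<^sub>0 'k"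

lemma keys_plus_nat: "keys (m + m' :: nat \<Rightarrow>\<^sub>0 nat) = keys m \<union> keys m'"
  by (auto simp: in_keys_iff lookup_add)

lemma lookup_mult_keys:
  fixes f g :: "('a::monoid_add) \<Rightarrow>\<^sub>0 ('b::semiring_0)"
  shows "lookup (f * g) m
    = (\<Sum>a\<in>keys f. \<Sum>b\<in>keys g. if a + b = m then lookup f a * lookup g b else 0)"
proof -
  have "f * g = (\<Sum>a\<in>keys f. single a (lookup f a)) * (\<Sum>b\<in>keys g. single b (lookup g b))"
    by (simp only: poly_mapping_sum_single[symmetric])
  also have "\<dots> = (\<Sum>a\<in>keys f. \<Sum>b\<in>keys g. single (a + b) (lookup f a * lookup g b))"
    by (simp add: sum_product mult_single)
  finally show ?thesis
    by (simp add: lookup_sum lookup_single when_def)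
qed

text \<open>Leading coefficients of products are read off with this: when \<open>m\<close> arises
  from one pair of exponents only, no cancellation is possible.\<close>

lemma lookup_mult_unique:
  fixes f g :: "('a::monoid_add) \<Rightarrow>\<^sub>0 ('b::semiring_0)"
  assumes "\<And>a b. a \<in> keys f \<Longrightarrow> b \<in> keys g \<Longrightarrow> a + b = m \<longleftrightarrow> a = a0 \<and> b = b0"
  shows "lookup (f * g) m = lookup f a0 * lookup g b0"
proof -
  have "lookup (f * g) m
      = (\<Sum>a\<in>keys f. \<Sum>b\<in>keys g. if b = b0 then (if a = a0 then lookup f a * lookup g b else 0) else 0)"
    unfolding lookup_mult_keys by (intro sum.cong refl) (use assms in auto)
  also have "\<dots> = lookup f a0 * lookup g b0"
    by (cases "lookup g b0 = 0") (auto simp: in_keys_iff)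
  finally show ?thesis .
qed

definition cst :: "'k \<Rightarrow> 'k::field mpl" where "cst c = single 0 c"
definition mon :: "(nat \<Rightarrow>\<^sub>0 nat) \<Rightarrow> 'k::field mpl" where "mon m = single m 1"
definition xv :: "nat \<Rightarrow> 'k::field mpl" where "xv i = mon (single i 1)"

lemma mon_add: "mon (m + m') = mon m * mon m'"
  by (simp add: mon_def mult_single)

lemma mon_0 [simp]: "mon 0 = 1"
  by (simp add: mon_def)

lemma single_eq_cst_mon: "single m c = cst c * mon m"
  by (simp add: cst_def mon_def mult_single)

lemma cst_0 [simp]: "cst 0 = 0" and cst_1 [simp]: "cst 1 = 1"
  by (simp_all add: cst_def)

lemma cst_add: "cst (a + b) = cst a + cst b" and cst_mult: "cst (a * b) = cst a * cst b"
  and cst_uminus: "cst (- a) = - cst a"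
  by (simp_all add: cst_def single_add mult_single single_uminus)

lemma lookup_cst_mult: "lookup (cst c * p) m = c * lookup p m"
  by (induction p rule: poly_mapping_induct)
    (simp_all add: cst_def mult_single lookup_single when_def lookup_add distrib_left)

lemma xv_power: "xv i ^ r = mon (single i r)"
  by (induction r) (simp_all add: xv_def mon_def mult_single flip: single_add)

lemma keys_xv_power: "keys (xv i ^ r :: 'k::field mpl) = {single i r}"
  by (simp add: xv_power mon_def)

definition pol :: "nat \<Rightarrow> 'k::field mpl set" where
  "pol n = {p. \<forall>m\<in>keys p. keys m \<subseteq> {..<n}}"

lemma pol_zero: "0 \<in> pol n" and pol_one: "1 \<in> pol n" and pol_cst: "cst c \<in> pol n"
  by (auto simp: pol_def cst_def)

lemma pol_add: "p \<in> pol n \<Longrightarrow> q \<in> pol n \<Longrightarrow> p + q \<in> pol n"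
  using keys_add[of p q] by (auto simp: pol_def)

lemma pol_mult: "p \<in> pol n \<Longrightarrow> q \<in> pol n \<Longrightarrow> p * q \<in> pol n"
  using keys_mult[of p q] by (fastforce simp: pol_def keys_plus_nat)

lemma pol_uminus: "p \<in> pol n \<Longrightarrow> - p \<in> pol n"
  using pol_mult[OF pol_cst[of "-1"], of p n] by (simp add: cst_uminus)

lemma pol_diff: "p \<in> pol n \<Longrightarrow> q \<in> pol n \<Longrightarrow> p - q \<in> pol n"
  using pol_add[of p n "- q"] pol_uminus by auto

lemma pol_sum: "(\<And>a. a \<in> A \<Longrightarrow> F a \<in> pol n) \<Longrightarrow> sum F A \<in> pol n"
  by (induction A rule: infinite_finite_induct) (auto simp: pol_zero pol_add)

lemma pol_prod: "(\<And>a. a \<in> A \<Longrightarrow> F a \<in> pol n) \<Longrightarrow> prod F A \<in> pol n"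
  by (induction A rule: infinite_finite_induct) (auto simp: pol_one pol_mult)

lemma pol_mon: "keys m \<subseteq> {..<n} \<Longrightarrow> mon m \<in> pol n"
  by (simp add: pol_def mon_def)

lemma pol_xv: "i < n \<Longrightarrow> xv i \<in> pol n"
  by (simp add: xv_def pol_mon)

lemma pol_power: "p \<in> pol n \<Longrightarrow> p ^ r \<in> pol n"
  by (induction r) (auto simp: pol_one pol_mult)

lemmas pol_intros = pol_zero pol_one pol_cst pol_add pol_mult pol_uminus pol_diff pol_sum pol_prod
  pol_mon pol_xv pol_power

lemma pol_induct [consumes 1, case_names zero mon add]:
  assumes "p \<in> pol n" "P 0" "\<And>m c. keys m \<subseteq> {..<n} \<Longrightarrow> P (cst c * mon m)"
    "\<And>p q. P p \<Longrightarrow> P q \<Longrightarrow> P (p + q)"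
  shows "P p"
  by (rule poly_mapping_induct_keys[of p "{m. keys m \<subseteq> {..<n}}"])
    (use assms in \<open>auto simp: pol_def single_eq_cst_mon\<close>)

text \<open>Serves three purposes: the weight given by the symmetrizers, the total degree, and, with
  an indicator function, the exponent sum whose parity is the sign \<open>esign\<close>.\<close>

definition wt :: "(nat \<Rightarrow> nat) \<Rightarrow> (nat \<Rightarrow>\<^sub>0 nat) \<Rightarrow> nat" where
  "wt d m = (\<Sum>j\<in>keys m. d j * lookup m j)"

lemma wt_add: "wt d (m + m') = wt d m + wt d m'"
  unfolding wt_def by (rule setsum_keys_plus_distrib) (auto simp: algebra_simps)

lemma wt_0 [simp]: "wt d 0 = 0"
  by (simp add: wt_def)

lemma wt_single [simp]: "wt d (single i r) = d i * r"
  by (simp add: wt_def)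

lemma wt_eq_sum: "keys m \<subseteq> A \<Longrightarrow> finite A \<Longrightarrow> wt d m = (\<Sum>j\<in>A. d j * lookup m j)"
  unfolding wt_def by (rule sum.mono_neutral_left) (auto simp: in_keys_iff)

subsection \<open>Sign changes of variables\<close>

definition esign :: "nat set \<Rightarrow> (nat \<Rightarrow>\<^sub>0 nat) \<Rightarrow> 'k::field" where
  "esign S m = (-1) ^ wt (\<lambda>j. if j \<in> S then 1 else 0) m"

lemma esign_add: "esign S (m + m') = esign S m * esign S m'"
  by (simp add: esign_def wt_add power_add)

lemma esign_0 [simp]: "esign S 0 = 1"
  by (simp add: esign_def)

lemma esign_single: "esign S (single i r) = (if i \<in> S then (-1) ^ r else 1)"
  by (simp add: esign_def)

lemma esign_square: "esign S m * esign S m = (1::'k::field)"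
  by (simp add: esign_def flip: power_mult_distrib)

lemma esign_nonzero: "esign S m \<noteq> (0::'k::field)"
  by (simp add: esign_def)

text \<open>The substitution x_j -> -x_j for j in \<open>S\<close>, an involutive ring automorphism.
  Multiplication combined with such substitutions lets anticommuting dots act on commutative
  polynomials.\<close>

definition theta :: "nat set \<Rightarrow> 'k::field mpl \<Rightarrow> 'k mpl" where
  "theta S p = Poly_Mapping.mapp (\<lambda>m c. esign S m * c) p"

lemma lookup_theta: "lookup (theta S p) m = esign S m * lookup p m"
  by (simp add: theta_def lookup_mapp when_def in_keys_iff)

lemma theta_zero [simp]: "theta S 0 = 0"
  by (rule poly_mapping_eqI) (simp add: lookup_theta)

lemma theta_add: "theta S (p + q) = theta S p + theta S q"
  by (rule poly_mapping_eqI) (simp add: lookup_theta lookup_add distrib_left)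

lemma theta_single: "theta S (single m c) = single m (esign S m * c)"
  by (rule poly_mapping_eqI) (simp add: lookup_theta lookup_single when_def)

lemma theta_mon: "theta S (mon m) = cst (esign S m) * mon m"
  by (simp add: mon_def theta_single cst_def mult_single)

lemma theta_cst [simp]: "theta S (cst c) = cst c"
  by (simp add: cst_def theta_single)

lemma theta_one [simp]: "theta S 1 = 1"
  using theta_cst[of S 1] by (simp del: theta_cst)

lemma theta_mult: "theta S (p * q) = theta S p * theta S q"
proof (induction p rule: poly_mapping_induct)
  case (single m c)
  show ?case
    by (induction q rule: poly_mapping_induct)
      (simp_all add: theta_single mult_single esign_add theta_add distrib_left mult.assoc
        mult.left_commute)
qed (simp_all add: theta_add distrib_right)

lemma theta_prod: "theta S (prod F A) = (\<Prod>a\<in>A. theta S (F a))"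
  by (induction A rule: infinite_finite_induct) (simp_all add: theta_mult)

lemma theta_commute: "theta S (theta S' p) = theta S' (theta S p)"
  by (rule poly_mapping_eqI) (simp add: lookup_theta mult.left_commute)

lemma theta_invol [simp]: "theta S (theta S p) = p"
  by (rule poly_mapping_eqI) (simp add: lookup_theta esign_square flip: mult.assoc)

lemma theta_empty [simp]: "theta {} p = p"
  by (rule poly_mapping_eqI) (simp add: lookup_theta esign_def wt_def)

lemma theta_xv: "theta S (xv i) = (if i \<in> S then - xv i else xv i)"
  by (simp add: xv_def theta_mon esign_single cst_uminus)

lemma keys_theta: "keys (theta S p) = keys p"
  by (auto simp: in_keys_iff lookup_theta esign_nonzero)

lemma theta_pol: "p \<in> pol n \<Longrightarrow> theta S p \<in> pol n"
  by (simp add: pol_def keys_theta)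

subsection \<open>Division by polynomials monic in one variable\<close>

text \<open>Monic up to a unit in a strong sense: the pure power is the only monomial of x_k-degree
  at least \<open>N\<close>, so the top coefficient is a scalar. For \<open>N = 0\<close> this
  leaves only a nonzero constant.\<close>

definition lead_in :: "nat \<Rightarrow> nat \<Rightarrow> 'k::field mpl \<Rightarrow> bool" where
  "lead_in k N f \<longleftrightarrow> lookup f (single k N) \<noteq> 0 \<and> (\<forall>m\<in>keys f. m \<noteq> single k N \<longrightarrow> lookup m k < N)"

lemma lead_in_le: "lead_in k N f \<Longrightarrow> m \<in> keys f \<Longrightarrow> lookup m k \<le> N"
  by (cases "m = single k N") (auto simp: lead_in_def intro: less_imp_le)

lemma lead_in_top: "lead_in k N f \<Longrightarrow> m \<in> keys f \<Longrightarrow> lookup m k \<ge> N \<Longrightarrow> m = single k N"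
  by (auto simp: lead_in_def)

lemma lead_in_power: "lead_in k N (xv k ^ N)"
  by (simp add: lead_in_def xv_power mon_def)

lemma lead_in_mult:
  assumes f: "lead_in k N f" and g: "lead_in k M g"
  shows "lead_in k (N + M) (f * g)"
proof -
  have *: "a = single k N \<and> b = single k M"
    if "a \<in> keys f" "b \<in> keys g" "lookup (a + b) k \<ge> N + M" for a b
    using that lead_in_le[OF f, of a] lead_in_le[OF g, of b] lead_in_top[OF f, of a]
      lead_in_top[OF g, of b] by (simp add: lookup_add)
  have "lookup (f * g) (single k (N + M)) = lookup f (single k N) * lookup g (single k M)"
  proof (rule lookup_mult_unique)
    fix a b assume "a \<in> keys f" "b \<in> keys g"
    then show "a + b = single k (N + M) \<longleftrightarrow> a = single k N \<and> b = single k M"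
      using *[of a b] by (metis lookup_single_eq order_refl single_add)
  qed
  moreover have "lookup m k < N + M" if "m \<in> keys (f * g)" "m \<noteq> single k (N + M)" for m
  proof -
    obtain a b where "m = a + b" "a \<in> keys f" "b \<in> keys g" using \<open>m \<in> keys (f * g)\<close> keys_mult by blast
    then show ?thesis using *[of a b] that(2) by (auto simp: single_add not_le[symmetric])
  qed
  ultimately show ?thesis using f g by (auto simp: lead_in_def)
qed

lemma lead_in_prod:
  assumes "finite A" "\<And>a. a \<in> A \<Longrightarrow> lead_in k (N a) (f a)"
  shows "lead_in k (sum N A) (prod f A)"
  using assms
proof (induction A rule: finite_induct)
  case empty
  then show ?case using lead_in_power[of k 0] by simp
qed (auto intro: lead_in_mult)

text \<open>A monomial of maximal x_k-degree in \<open>q\<close>, multiplied by the pure power of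
  \<open>f\<close>, cannot be cancelled in the product and has x_k-degree at least
  \<open>N\<close>.\<close>

lemma lead_in_mult_eq_0:
  assumes f: "lead_in k N f" and small: "\<And>m. m \<in> keys (f * q) \<Longrightarrow> lookup m k < N"
  shows "q = 0"
proof (rule ccontr)
  assume "q \<noteq> 0"
  then have ne: "keys q \<noteq> {}" by auto
  define M where "M = Max ((\<lambda>m. lookup m k) ` keys q)"
  have M: "\<And>m. m \<in> keys q \<Longrightarrow> lookup m k \<le> M" unfolding M_def by (auto intro: Max_ge)
  have "M \<in> (\<lambda>m. lookup m k) ` keys q" unfolding M_def using ne by (intro Max_in) auto
  then obtain m where m: "m \<in> keys q" "lookup m k = M" by auto
  have "lookup (f * q) (single k N + m) = lookup f (single k N) * lookup q m"
  proof (rule lookup_mult_unique)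
    fix a b assume ab: "a \<in> keys f" "b \<in> keys q"
    show "a + b = single k N + m \<longleftrightarrow> a = single k N \<and> b = m"
    proof
      assume eq: "a + b = single k N + m"
      then have "lookup a k + lookup b k = N + M" using m by (metis lookup_add lookup_single_eq)
      then have "lookup a k \<ge> N" using M[OF ab(2)] by linarith
      then have "a = single k N" using lead_in_top[OF f ab(1)] by simp
      then show "a = single k N \<and> b = m" using eq by simp
    qed simp
  qed
  also have "\<dots> \<noteq> 0" using f m by (auto simp: lead_in_def in_keys_iff)
  finally have "single k N + m \<in> keys (f * q)" by (simp add: in_keys_iff)
  from small[OF this] show False by (simp add: lookup_add)
qed

lemma mon_split: "N \<le> lookup m k \<Longrightarrow> \<exists>m'. m = single k N + m'"
  for m :: "nat \<Rightarrow>\<^sub>0 nat"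
  by (rule exI[of _ "m - single k N"])
    (auto intro!: poly_mapping_eqI simp: lookup_add lookup_minus lookup_single when_def)

lemma lead_in_expand:
  assumes "lead_in k N f"
  obtains c g where "f = cst c * mon (single k N) + g" "c \<noteq> 0" "keys g \<subseteq> keys f"
    "\<And>m. m \<in> keys g \<Longrightarrow> lookup m k < N"
proof -
  define c where "c = lookup f (single k N)"
  define g where "g = f - cst c * mon (single k N)"
  have l: "lookup g m = (if m = single k N then 0 else lookup f m)" for m
    by (simp add: g_def lookup_minus lookup_cst_mult mon_def lookup_single when_def c_def)
  show ?thesis
  proof (rule that[of c g])
    show "keys g \<subseteq> keys f" by (auto simp: in_keys_iff l split: if_splits)
    show "lookup m k < N" if "m \<in> keys g" for m
      using that assms by (auto simp: in_keys_iff l lead_in_def split: if_splits)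
    show "c \<noteq> 0" using assms by (simp add: c_def lead_in_def)
  qed (simp add: g_def)
qed

text \<open>Replacing the pure power x_k^N by the remaining terms of \<open>f\<close> lowers the
  degree in x_k whatever happens to the other variables, so induction on that degree
  suffices.\<close>

lemma division_by_lead_in:
  assumes f: "lead_in k N f"
  shows "\<exists>q r. g = f * q + r \<and> (\<forall>m\<in>keys r. lookup m k < N)"
proof -
  define D where "D = {g. \<exists>q r. g = f * q + r \<and> (\<forall>m\<in>keys r. lookup m k < N)}"
  have add: "p + q \<in> D" if pq: "p \<in> D" "q \<in> D" for p q
  proof -
    obtain s r s' r' where "p = f * s + r" "\<forall>m\<in>keys r. lookup m k < N"
      "q = f * s' + r'" "\<forall>m\<in>keys r'. lookup m k < N"
      using pq unfolding D_def by auto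
    then show ?thesis using keys_add[of r r'] unfolding D_def
      by (intro CollectI exI[of _ "s + s'"] exI[of _ "r + r'"]) (auto simp: algebra_simps)
  qed
  have sc: "cst b * p \<in> D" if p: "p \<in> D" for p b
  proof -
    obtain s r where "p = f * s + r" "\<forall>m\<in>keys r. lookup m k < N"
      using p unfolding D_def by auto
    then show ?thesis unfolding D_def
      by (intro CollectI exI[of _ "cst b * s"] exI[of _ "cst b * r"])
        (simp add: distrib_left mult.left_commute in_keys_iff lookup_cst_mult)
  qed
  have comb: "p \<in> D" if "\<And>m. m \<in> keys p \<Longrightarrow> mon m \<in> D" for p
    by (rule poly_mapping_induct_keys[of p "{m. mon m \<in> D}"])
      (use that sc add sc[of _ 0] in \<open>auto simp: single_eq_cst_mon D_def intro: exI[of _ 0]\<close>)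
  obtain c h where h: "f = cst c * mon (single k N) + h" "c \<noteq> 0"
    "\<And>m. m \<in> keys h \<Longrightarrow> lookup m k < N" by (rule lead_in_expand[OF f]) blast
  have mon: "mon m \<in> D" for m
  proof (induction "lookup m k" arbitrary: m rule: less_induct)
    case less
    show ?case
    proof (cases "lookup m k < N")
      case True
      then show ?thesis unfolding D_def
        by (intro CollectI exI[of _ 0] exI[of _ "mon m"]) (auto simp: mon_def)
    next
      case False
      then obtain m' where m': "m = single k N + m'" using mon_split[of N m k] by auto
      have "mon m = f * (cst (inverse c) * mon m') + cst (- inverse c) * (h * mon m')"
      proof -
        have "cst (inverse c) * cst c = (1 :: 'a mpl)" using h(2) by (simp flip: cst_mult)
        then have "cst (inverse c) * (cst c * mon (single k N)) = (mon (single k N) :: 'a mpl)"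
          by (simp flip: mult.assoc)
        then show ?thesis by (simp add: h(1) m' mon_add algebra_simps cst_uminus)
      qed
      moreover have "f * (cst (inverse c) * mon m') \<in> D"
        unfolding D_def by (intro CollectI exI[of _ "cst (inverse c) * mon m'"] exI[of _ 0]) auto
      moreover have "h * mon m' \<in> D"
      proof (rule comb)
        fix a assume "a \<in> keys (h * mon m')"
        then obtain b where "b \<in> keys h" "a = b + m'"
          using keys_mult[of h "mon m'"] by (auto simp: mon_def)
        then have "lookup a k < lookup m k" using h(3) m' by (simp add: lookup_add)
        then show "mon a \<in> D" by (rule less)
      qed
      ultimately show ?thesis using add sc by metis
    qed
  qed
  have "g \<in> D" by (rule comb) (rule mon)
  then show ?thesis by (simp add: D_def)
qed

text \<open>For a triangular family, dividing the coefficients of \<open>f 0, \<dots>, f (K - 1)\<close> by \<open>f K\<close> leaves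
  a remainder of small degree in the variable \<open>K\<close>, so the coefficient of \<open>f K\<close> must vanish.\<close>

lemma triangular_reduced_eq_0:
  assumes lead: "\<And>i. i < K \<Longrightarrow> lead_in i (N i) (f i)"
    and tri: "\<And>i m. i < K \<Longrightarrow> m \<in> keys (f i) \<Longrightarrow> keys m \<subseteq> {..i}"
    and red: "\<And>m i. m \<in> keys (\<Sum>i<K. g i * f i) \<Longrightarrow> i < K \<Longrightarrow> lookup m i < N i"
  shows "(\<Sum>i<K. g i * f i) = 0"
  using assms
proof (induction K arbitrary: g)
  case (Suc K)
  have "\<exists>q r. g i = f K * q + r \<and> (\<forall>m\<in>keys r. lookup m K < N K)" for i
    using division_by_lead_in Suc.prems(1) by blast
  then obtain q r where qr: "\<And>i. g i = f K * q i + r i" "\<And>i m. m \<in> keys (r i) \<Longrightarrow> lookup m K < N K"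
    by metis
  define s where "s = (\<Sum>i<K. r i * f i)"
  define t where "t = g K + (\<Sum>i<K. q i * f i)"
  have tot: "(\<Sum>i<Suc K. g i * f i) = s + f K * t"
  proof -
    have "(\<Sum>i<K. g i * f i) = (\<Sum>i<K. r i * f i + f K * (q i * f i))"
      by (intro sum.cong refl) (simp add: qr(1) algebra_simps)
    then show ?thesis by (simp add: s_def t_def sum.distrib sum_distrib_left algebra_simps)
  qed
  have s: "lookup m K < N K" if "m \<in> keys s" for m
  proof -
    obtain i where i: "i < K" "m \<in> keys (r i * f i)"
      using \<open>m \<in> keys s\<close> keys_sum[of "\<lambda>i. r i * f i" "{..<K}"] by (auto simp: s_def)
    then obtain a b where ab: "m = a + b" "a \<in> keys (r i)" "b \<in> keys (f i)" using keys_mult by blast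
    then have "lookup b K = 0" using Suc.prems(2)[of i b] i by (force simp: in_keys_iff)
    then show ?thesis using ab qr(2) by (simp add: lookup_add)
  qed
  have "t = 0"
  proof (rule lead_in_mult_eq_0[OF Suc.prems(1)[of K]])
    fix m assume "m \<in> keys (f K * t)"
    moreover have "f K * t = (\<Sum>i<Suc K. g i * f i) - s" using tot by simp
    ultimately have "m \<in> keys (\<Sum>i<Suc K. g i * f i) \<or> m \<in> keys s"
      by (auto simp: in_keys_iff lookup_minus)
    then show "lookup m K < N K" using s Suc.prems(3) by blast
  qed simp
  then have eq: "(\<Sum>i<Suc K. g i * f i) = s" using tot by simp
  also have "s = 0" unfolding s_def
    by (rule Suc.IH) (use Suc.prems eq s_def in \<open>auto simp: less_Suc_eq\<close>)
  finally show ?case .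
qed simp

section \<open>Ideals in finitely many variables and reduction modulo a triangular family\<close>

definition span_ideal :: "nat \<Rightarrow> (nat \<Rightarrow> 'k::field mpl) \<Rightarrow> 'k mpl set" where
  "span_ideal n f = {\<Sum>i<n. g i * f i | g. \<forall>i<n. g i \<in> pol n}"

lemma span_ideal_add:
  assumes "p \<in> span_ideal n f" "q \<in> span_ideal n f"
  shows "p + q \<in> span_ideal n f"
proof -
  obtain g h where "\<forall>i<n. g i \<in> pol n" "\<forall>i<n. h i \<in> pol n"
    "p = (\<Sum>i<n. g i * f i)" "q = (\<Sum>i<n. h i * f i)" using assms by (auto simp: span_ideal_def)
  then show ?thesis unfolding span_ideal_def
    by (intro CollectI exI[of _ "\<lambda>i. g i + h i"]) (auto simp: distrib_right sum.distrib pol_add)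
qed

lemma span_ideal_mult:
  assumes "p \<in> span_ideal n f" "q \<in> pol n"
  shows "q * p \<in> span_ideal n f"
proof -
  obtain g where "\<forall>i<n. g i \<in> pol n" "p = (\<Sum>i<n. g i * f i)" using assms by (auto simp: span_ideal_def)
  then show ?thesis unfolding span_ideal_def using assms(2)
    by (intro CollectI exI[of _ "\<lambda>i. q * g i"]) (auto simp: sum_distrib_left mult.assoc pol_mult)
qed

lemma span_ideal_base: "i < n \<Longrightarrow> f i \<in> span_ideal n f"
  unfolding span_ideal_def
  by (intro CollectI exI[of _ "\<lambda>j. if j = i then 1 else 0"])
    (auto simp: pol_intros if_distrib[of "\<lambda>x. x * _"] cong: if_cong)

lemma span_ideal_zero: "0 \<in> span_ideal n f"
  unfolding span_ideal_def by (intro CollectI exI[of _ "\<lambda>_. 0"]) (auto simp: pol_intros)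

lemma span_ideal_uminus: "p \<in> span_ideal n f \<Longrightarrow> - p \<in> span_ideal n f"
  using span_ideal_mult[of p n f "- 1"] by (simp add: pol_intros)

lemma span_ideal_induct [consumes 1, case_names zero base add]:
  assumes "p \<in> span_ideal n f" "P 0"
    "\<And>i m c. i < n \<Longrightarrow> keys m \<subseteq> {..<n} \<Longrightarrow> P (cst c * mon m * f i)"
    "\<And>p q. P p \<Longrightarrow> P q \<Longrightarrow> P (p + q)"
  shows "P p"
proof -
  obtain h where h: "\<forall>i<n. h i \<in> pol n" "p = (\<Sum>i<n. h i * f i)"
    using assms(1) by (auto simp: span_ideal_def)
  have 1: "P (q * f i)" if "q \<in> pol n" "i < n" for q i
    using that by (induction q rule: pol_induct) (auto simp: assms distrib_right)
  have "P (\<Sum>i\<in>A. h i * f i)" if "A \<subseteq> {..<n}" for A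
    using finite_subset[OF that] that
    by (induction A rule: finite_induct) (auto intro!: assms(2,4) 1 h(1)[rule_format])
  then show ?thesis using h(2) by blast
qed

text \<open>Division by \<open>f k\<close> leaves the variables above \<open>k\<close> alone and
  lowers the exponent of \<open>k\<close>, but may raise the exponents below. So the exponent vector
  decreases when read from the top variable down; homogeneity bounds its entries and makes this
  well-founded.\<close>

lemma monomial_reduce:
  assumes lead: "\<And>i. i < n \<Longrightarrow> lead_in i (N i) (f i)"
    and tri: "\<And>i m. i < n \<Longrightarrow> m \<in> keys (f i) \<Longrightarrow> keys m \<subseteq> {..i}"
    and hom: "\<And>i m. i < n \<Longrightarrow> m \<in> keys (f i) \<Longrightarrow> wt d m = d i * N i"
    and d: "\<And>i. i < n \<Longrightarrow> d i > 0"
    and m: "keys m \<subseteq> {..<n}"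
  shows "\<exists>r. mon m - r \<in> span_ideal n f \<and>
    (\<forall>m'\<in>keys r. keys m' \<subseteq> {..<n} \<and> (\<forall>i<n. lookup m' i < N i) \<and> wt d m' = wt d m)"
proof -
  define D where "D = wt d m"
  define S where "S = {p. \<exists>r. p - r \<in> span_ideal n f \<and>
    (\<forall>m'\<in>keys r. keys m' \<subseteq> {..<n} \<and> (\<forall>i<n. lookup m' i < N i) \<and> wt d m' = D)}"
  have add: "p + q \<in> S" if pq: "p \<in> S" "q \<in> S" for p q
  proof -
    obtain r s where rs: "p - r \<in> span_ideal n f" "q - s \<in> span_ideal n f"
      "\<forall>m'\<in>keys r. keys m' \<subseteq> {..<n} \<and> (\<forall>i<n. lookup m' i < N i) \<and> wt d m' = D"
      "\<forall>m'\<in>keys s. keys m' \<subseteq> {..<n} \<and> (\<forall>i<n. lookup m' i < N i) \<and> wt d m' = D"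
      using pq unfolding S_def by blast
    have "(p + q) - (r + s) \<in> span_ideal n f"
      using span_ideal_add[OF rs(1,2)] by (simp add: algebra_simps)
    then show ?thesis unfolding S_def using keys_add[of r s] rs(3,4) by blast
  qed
  have sc: "cst b * p \<in> S" if p: "p \<in> S" for p b
  proof -
    obtain r where r: "p - r \<in> span_ideal n f"
      "\<forall>m'\<in>keys r. keys m' \<subseteq> {..<n} \<and> (\<forall>i<n. lookup m' i < N i) \<and> wt d m' = D"
      using p unfolding S_def by blast
    have "cst b * p - cst b * r \<in> span_ideal n f"
      using span_ideal_mult[OF r(1) pol_cst[of b]] by (simp add: algebra_simps)
    moreover have "keys (cst b * r) \<subseteq> keys r" by (auto simp: in_keys_iff lookup_cst_mult)
    ultimately show ?thesis unfolding S_def using r(2) by blast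
  qed
  have idl: "p \<in> S" if "p \<in> span_ideal n f" for p
    using that unfolding S_def by (intro CollectI exI[of _ 0]) auto
  have comb: "p \<in> S" if "\<And>m. m \<in> keys p \<Longrightarrow> mon m \<in> S" for p
    by (rule poly_mapping_induct_keys[of p "{m. mon m \<in> S}"])
      (use that sc add idl[OF span_ideal_zero] in \<open>auto simp: single_eq_cst_mon\<close>)
  \<comment> \<open>The exponent vector read as a number in base \<open>D + 1\<close>, with the last
    variable as the most significant digit. The base works because a monomial of weight
    \<open>D\<close> has all exponents at most \<open>D\<close>.\<close>
  define M where "M m = (\<Sum>j<n. lookup m j * (D + 1) ^ j)" for m :: "nat \<Rightarrow>\<^sub>0 nat"
  have dig: "(\<Sum>j<k. lookup m j * (D + 1) ^ j) < (D + 1) ^ k" if "\<And>j. j < k \<Longrightarrow> lookup m j \<le> D"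
    for m :: "nat \<Rightarrow>\<^sub>0 nat" and k
    using that
  proof (induction k)
    case (Suc k)
    have "lookup m k * (D + 1) ^ k \<le> D * (D + 1) ^ k" using Suc.prems[of k] by (intro mult_right_mono) auto
    moreover have "(\<Sum>j<k. lookup m j * (D + 1) ^ j) < (D + 1) ^ k" using Suc by auto
    ultimately have "(\<Sum>j<k. lookup m j * (D + 1) ^ j) + lookup m k * (D + 1) ^ k
        < (D + 1) ^ k + D * (D + 1) ^ k" by linarith
    then show ?case by simp
  qed simp
  have main: "mon m \<in> S" if "keys m \<subseteq> {..<n}" "wt d m = D" for m
    using that
  proof (induction "M m" arbitrary: m rule: less_induct)
    case less
    show ?case
    proof (cases "\<forall>i<n. lookup m i < N i")
      case True
      then show ?thesis using less.prems unfolding S_def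
        by (intro CollectI exI[of _ "mon m"]) (auto simp: mon_def span_ideal_zero)
    next
      case False
      then obtain k where k: "k < n" "N k \<le> lookup m k" by (auto simp: not_less)
      then obtain m' where m': "m = single k (N k) + m'" using mon_split by blast
      obtain c h where h: "f k = cst c * mon (single k (N k)) + h" "c \<noteq> 0" "keys h \<subseteq> keys (f k)"
        "\<And>m. m \<in> keys h \<Longrightarrow> lookup m k < N k" by (rule lead_in_expand[OF lead[OF k(1)]]) blast
      have keys_m': "keys m' \<subseteq> {..<n}" using less.prems m' by (simp add: keys_plus_nat)
      have "mon m = (cst (inverse c) * mon m') * f k + cst (- inverse c) * (h * mon m')"
      proof -
        have "cst (inverse c) * cst c = (1 :: 'a mpl)" using h(2) by (simp flip: cst_mult)
        then have "cst (inverse c) * (cst c * mon (single k (N k))) = (mon (single k (N k)) :: 'a mpl)"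
          by (simp flip: mult.assoc)
        then show ?thesis by (simp add: h(1) m' mon_add algebra_simps cst_uminus)
      qed
      moreover have "(cst (inverse c) * mon m') * f k \<in> S"
        by (intro idl span_ideal_mult span_ideal_base pol_intros k keys_m')
      moreover have "h * mon m' \<in> S"
      proof (rule comb)
        fix a assume "a \<in> keys (h * mon m')"
        then obtain b where b: "b \<in> keys h" "a = b + m'"
          using keys_mult[of h "mon m'"] by (auto simp: mon_def)
        have bf: "b \<in> keys (f k)" using b h(3) by blast
        have ka: "keys a \<subseteq> {..<n}" using tri[OF k(1) bf] keys_m' k(1) b by (force simp: keys_plus_nat)
        have wa: "wt d a = D" using hom[OF k(1) bf] less.prems m' b by (simp add: wt_add)
        have le: "lookup a j \<le> D" for j
        proof (cases "j \<in> keys a")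
          case True
          then have "d j * lookup a j \<le> wt d a" unfolding wt_def
            by (intro member_le_sum) auto
          moreover have "d j > 0" using True ka d by auto
          ultimately show ?thesis using wa by (cases "d j") auto
        qed (simp add: in_keys_iff)
        have gt: "lookup a j = lookup m j" if "j > k" for j
          using that tri[OF k(1) bf] b m' by (force simp: lookup_add in_keys_iff lookup_single when_def)
        have lt: "lookup a k < lookup m k" using h(4)[OF b(1)] b m' by (simp add: lookup_add)
        have split: "M x = (\<Sum>j<k. lookup x j * (D + 1) ^ j) + lookup x k * (D + 1) ^ k
            + (\<Sum>j\<in>{k<..<n}. lookup x j * (D + 1) ^ j)" for x
        proof -
          have "{..<n} = {..<k} \<union> {k} \<union> {k<..<n}" using k(1) by auto
          moreover have "({..<k} \<union> {k}) \<inter> {k<..<n} = {}" "{..<k} \<inter> {k} = {}" by auto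
          ultimately show ?thesis unfolding M_def by (simp only: sum.union_disjoint finite_Un
                finite_lessThan finite_greaterThanLessThan finite.intros sum.insert sum.empty
                empty_iff simp_thms add_0_right)
        qed
        \<comment> \<open>All digits below \<open>k\<close> together weigh less than one unit of
          digit \<open>k\<close>, so the loss there outweighs any gain further down.\<close>
        have "(\<Sum>j<k. lookup a j * (D + 1) ^ j) + lookup a k * (D + 1) ^ k < (lookup a k + 1) * (D + 1) ^ k"
          using dig[of k a] le by simp
        also have "\<dots> \<le> lookup m k * (D + 1) ^ k" using lt by (intro mult_right_mono) auto
        finally have "M a < M m" unfolding split using gt by simp
        then show "mon a \<in> S" using less.hyps ka wa by blast
      qed
      ultimately show ?thesis using add sc by metis
    qed
  qed
  have "mon m \<in> S" by (rule main) (use m D_def in auto)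
  then show ?thesis by (simp add: S_def D_def)
qed

section \<open>Inversions of permutations\<close>

lemma sref_sref [simp]: "sref a (sref a p) = p"
  by (simp add: sref_def)

lemma sref_comp_sref [simp]: "sref a \<circ> sref a = id"
  by (simp add: fun_eq_iff)

lemma comp_sref_sref [simp]: "x \<circ> sref a \<circ> sref a = x"
  by (simp add: fun_eq_iff)

lemma sref_left [simp]: "sref a a = Suc a" and sref_right [simp]: "sref a (Suc a) = a"
  by (simp_all add: sref_def)

lemma sref_other: "p \<noteq> a \<Longrightarrow> p \<noteq> Suc a \<Longrightarrow> sref a p = p"
  by (simp add: sref_def)

lemma sref_permutes: "Suc a < n \<Longrightarrow> sref a permutes {..<n}"
  unfolding sref_def by (rule permutes_swap_id) auto

lemma permutes_comp_sref: "x permutes {..<n} \<Longrightarrow> Suc a < n \<Longrightarrow> x \<circ> sref a permutes {..<n}"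
  by (rule permutes_compose[OF sref_permutes])

lemma permutes_comp_sref_iff: "Suc a < n \<Longrightarrow> x \<circ> sref a permutes {..<n} \<longleftrightarrow> x permutes {..<n}"
  using permutes_comp_sref[of x n a] permutes_comp_sref[of "x \<circ> sref a" n a] by auto

lemma inv_comp_sref: "x permutes {..<n} \<Longrightarrow> Suc a < n \<Longrightarrow> inv (x \<circ> sref a) = sref a \<circ> inv x"
  by (metis o_inv_distrib permutes_bij sref_permutes sref_comp_sref inv_unique_comp)

lemma sref_less: "p \<noteq> q \<Longrightarrow>
  sref a p < sref a q \<longleftrightarrow> (if {p, q} = {a, Suc a} then q < p else p < q)"
  by (auto simp: sref_def transpose_def doubleton_eq_iff)

text \<open>Permutations here send positions to strands, so \<open>inv x k\<close> is the position
  of strand \<open>k\<close>. Inversions are pairs of strands rather than of positions: they record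
  which strands have crossed.\<close>

definition Inv :: "nat \<Rightarrow> (nat \<Rightarrow> nat) \<Rightarrow> (nat \<times> nat) set" where
  "Inv n x = {(k, l). k < l \<and> l < n \<and> inv x l < inv x k}"

definition pr :: "(nat \<Rightarrow> nat) \<Rightarrow> nat \<Rightarrow> nat \<times> nat" where
  "pr x a = (min (x a) (x (Suc a)), max (x a) (x (Suc a)))"

lemma finite_Inv: "finite (Inv n x)"
  by (rule finite_subset[of _ "{..<n} \<times> {..<n}"]) (auto simp: Inv_def)

lemma Inv_id [simp]: "Inv n id = {}"
  by (auto simp: Inv_def)

lemma permutes_neq: "x permutes S \<Longrightarrow> p \<noteq> q \<Longrightarrow> x p \<noteq> x q"
  by (metis permutes_inj injD)

lemma permutes_less: "x permutes {..<n} \<Longrightarrow> p < n \<Longrightarrow> x p < n"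
  for n :: nat
  by (metis lessThan_iff permutes_in_image)

lemma pr_eq_iff:
  assumes "x permutes S" "k < l"
  shows "(k, l) = pr x a \<longleftrightarrow> {inv x k, inv x l} = {a, Suc a}"
proof -
  have inv: "inv x k = p \<longleftrightarrow> k = x p" for k p using assms(1) permutes_inverses by metis
  have "x a \<noteq> x (Suc a)" using permutes_neq[OF assms(1)] by simp
  then show ?thesis using assms(2) by (auto simp: pr_def doubleton_eq_iff inv)
qed

text \<open>Composition with \<open>sref a\<close> on the right exchanges the strands at two
  neighbouring positions, so a single pair changes its status. The exclusive or treats crossing and
  crossing back alike.\<close>

lemma Inv_swap:
  assumes x: "x permutes {..<n}" and a: "Suc a < n"
  shows "P \<in> Inv n (x \<circ> sref a) \<longleftrightarrow> (P \<in> Inv n x) \<noteq> (P = pr x a)"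
proof (cases "fst P < snd P \<and> snd P < n")
  case True
  obtain k l where P: "P = (k, l)" by fastforce
  with True have kl: "k < l" "l < n" by auto
  have "inv x l \<noteq> inv x k" using permutes_neq[OF permutes_inv[OF x]] kl by auto
  then have "P \<in> Inv n (x \<circ> sref a) \<longleftrightarrow>
      (if {inv x l, inv x k} = {a, Suc a} then inv x k < inv x l else inv x l < inv x k)"
    using kl by (simp add: P Inv_def inv_comp_sref[OF x a] sref_less)
  moreover have "P \<in> Inv n x \<longleftrightarrow> inv x l < inv x k" using kl by (simp add: P Inv_def)
  ultimately show ?thesis using pr_eq_iff[OF x kl(1), of a] \<open>inv x l \<noteq> inv x k\<close>
    by (auto simp: P insert_commute)
next
  case False
  have "x a \<noteq> x (Suc a)" using permutes_neq[OF x] by simp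
  then have "fst (pr x a) < snd (pr x a) \<and> snd (pr x a) < n"
    using permutes_less[OF x] a by (auto simp: pr_def)
  with False show ?thesis by (auto simp: Inv_def)
qed

lemma pr_in_Inv:
  assumes x: "x permutes {..<n}" and a: "Suc a < n"
  shows "pr x a \<in> Inv n x \<longleftrightarrow> x (Suc a) < x a"
proof -
  have "inv x (x p) = p" for p using x permutes_inverses by metis
  moreover have "x a \<noteq> x (Suc a)" using permutes_neq[OF x] by simp
  ultimately show ?thesis using permutes_less[OF x] a
    by (auto simp: Inv_def pr_def min_def max_def)
qed

lemma card_Inv_swap:
  assumes x: "x permutes {..<n}" and a: "Suc a < n"
  shows "card (Inv n (x \<circ> sref a)) = (if x a < x (Suc a) then Suc (card (Inv n x)) else card (Inv n x) - 1)"
proof (cases "x a < x (Suc a)")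
  case True
  then have nin: "pr x a \<notin> Inv n x" using pr_in_Inv[OF x a] by auto
  then have "P \<in> Inv n (x \<circ> sref a) \<longleftrightarrow> P \<in> insert (pr x a) (Inv n x)" for P
    using Inv_swap[OF x a, of P] by auto
  then have "Inv n (x \<circ> sref a) = insert (pr x a) (Inv n x)" by (rule set_eqI)
  with nin show ?thesis using True by (simp add: finite_Inv)
next
  case False
  then have "x (Suc a) < x a" using permutes_neq[OF x, of a "Suc a"] by simp
  then have nin: "pr x a \<in> Inv n x" using pr_in_Inv[OF x a] by auto
  then have "P \<in> Inv n (x \<circ> sref a) \<longleftrightarrow> P \<in> Inv n x - {pr x a}" for P
    using Inv_swap[OF x a, of P] by auto
  then have "Inv n (x \<circ> sref a) = Inv n x - {pr x a}" by (rule set_eqI)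
  with nin show ?thesis using False by (simp add: finite_Inv)
qed

lemma ascending_permutes_id:
  assumes x: "x permutes {..<n}" and asc: "\<And>a. Suc a < n \<Longrightarrow> x a < x (Suc a)"
  shows "x = id"
proof -
  have ge: "p \<le> x p" if "p < n" for p
    using that
  proof (induction p)
    case (Suc p)
    then show ?case using asc[of p] by (auto intro: le_less_trans)
  qed simp
  have "x p = p" for p
  proof (induction p rule: less_induct)
    case (less p)
    show ?case
    proof (cases "p < n")
      case True
      obtain q where q: "x q = p" "q < n"
        using x True by (metis lessThan_iff permutes_inverses(1) permutes_inv permutes_in_image)
      then have "q \<le> p" using ge by auto
      moreover have "\<not> q < p" using less[of q] q by auto
      ultimately show ?thesis using q by auto
    next
      case False
      then show ?thesis using x by (simp add: permutes_def)
    qed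
  qed
  then show ?thesis by auto
qed

section \<open>Reduced words as words made of first crossings\<close>

lemma word_perm_Cons: "word_perm (a # as) = sref a \<circ> word_perm as"
  by (simp add: word_perm_def)

lemma word_perm_permutes: "\<forall>a\<in>set as. Suc a < n \<Longrightarrow> word_perm as permutes {..<n}"
proof (induction as)
  case Nil
  then show ?case using permutes_id[of "{..<n}"] by (simp add: word_perm_def id_def)
next
  case (Cons a as)
  then have "word_perm as permutes {..<n}" "sref a permutes {..<n}" by (auto intro: sref_permutes)
  then show ?case unfolding word_perm_Cons by (rule permutes_compose)
qed

lemma inv_word_perm_Cons:
  assumes "\<forall>b\<in>set (a # as). Suc b < n"
  shows "inv (word_perm (a # as)) = inv (word_perm as) \<circ> sref a"
proof -
  have "bij (word_perm as)" "bij (sref a)"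
    using assms permutes_bij[OF word_perm_permutes[of as n]] permutes_bij[OF sref_permutes[of a n]]
    by auto
  then show ?thesis unfolding word_perm_Cons
    by (metis o_inv_distrib inv_unique_comp sref_comp_sref)
qed

text \<open>Read from the right, every letter crosses two strands that are still in their original
  order. The inverse appears because \<open>word_perm\<close> grows on the left while the model
  composes with \<open>sref a\<close> on the right.\<close>

fun ascending_word :: "nat \<Rightarrow> nat list \<Rightarrow> bool" where
  "ascending_word n [] \<longleftrightarrow> True"
| "ascending_word n (a # as) \<longleftrightarrow> Suc a < n \<and> ascending_word n as \<and>
     inv (word_perm as) a < inv (word_perm as) (Suc a)"

lemma ascending_word_set: "ascending_word n as \<Longrightarrow> \<forall>a\<in>set as. Suc a < n"
  by (induction as) auto

text \<open>Sorting by adjacent exchanges: undoing a descent lowers the number of inversions by one,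
  and a permutation without descents is the identity.\<close>

lemma ascending_word_exists:
  assumes "x permutes {..<n}"
  shows "\<exists>as. ascending_word n as \<and> inv (word_perm as) = x \<and> length as = card (Inv n x)"
  using assms
proof (induction "card (Inv n x)" arbitrary: x rule: less_induct)
  case less
  show ?case
  proof (cases "\<exists>a. Suc a < n \<and> x (Suc a) < x a")
    case True
    then obtain a where a: "Suc a < n" "x (Suc a) < x a" by blast
    define y where "y = x \<circ> sref a"
    have y: "y permutes {..<n}" "y a < y (Suc a)" "x = y \<circ> sref a"
      using less.prems a by (auto simp: y_def permutes_comp_sref)
    then have c: "card (Inv n x) = Suc (card (Inv n y))" using card_Inv_swap[OF y(1) a(1)] by simp
    with less.hyps[of y] y obtain as where as: "ascending_word n as" "inv (word_perm as) = y"
      "length as = card (Inv n y)" by auto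
    then have "inv (word_perm (a # as)) = x"
      using inv_word_perm_Cons[of a as n] ascending_word_set a y by auto
    then show ?thesis using as a y c by (intro exI[of _ "a # as"]) auto
  next
    case False
    have "x a < x (Suc a)" if "Suc a < n" for a
      using False that permutes_neq[OF less.prems, of a "Suc a"] by (metis linorder_neqE_nat n_not_Suc_n)
    then have "x = id" by (rule ascending_permutes_id[OF less.prems])
    then show ?thesis by (intro exI[of _ "[]"]) (auto simp: word_perm_def simp flip: id_def)
  qed
qed

lemma card_Inv_le_length:
  "\<forall>a\<in>set as. Suc a < n \<Longrightarrow> card (Inv n (inv (word_perm as))) \<le> length as"
proof (induction as)
  case Nil
  have "inv (word_perm []) = id" by (simp add: word_perm_def)
  then show ?case by (simp only: Inv_id card.empty le0)
next
  case (Cons a as)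
  have "card (Inv n (inv (word_perm as) \<circ> sref a)) \<le> Suc (card (Inv n (inv (word_perm as))))"
    using card_Inv_swap[of "inv (word_perm as)" n a] permutes_inv[OF word_perm_permutes[of as n]] Cons.prems
    by auto
  moreover have "card (Inv n (inv (word_perm as))) \<le> length as" using Cons by auto
  ultimately show ?case unfolding inv_word_perm_Cons[OF Cons.prems] length_Cons by linarith
qed

text \<open>A letter changes the number of inversions by one, so a word as long as the final number
  must increase it at every letter.\<close>

lemma ascending_word_if_length:
  assumes "\<forall>a\<in>set as. Suc a < n" "length as = card (Inv n (inv (word_perm as)))"
  shows "ascending_word n as"
  using assms
proof (induction as)
  case (Cons a as)
  have x: "inv (word_perm as) permutes {..<n}" using Cons.prems by (auto intro: permutes_inv word_perm_permutes)
  have le: "card (Inv n (inv (word_perm as))) \<le> length as" using Cons.prems by (intro card_Inv_le_length) auto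
  have "Suc (length as) = card (Inv n (inv (word_perm as) \<circ> sref a))"
    using Cons.prems(2) unfolding inv_word_perm_Cons[OF Cons.prems(1)] by (simp only: length_Cons)
  then have asc: "inv (word_perm as) a < inv (word_perm as) (Suc a)"
    and "length as = card (Inv n (inv (word_perm as)))"
    using card_Inv_swap[OF x, of a] Cons.prems(1) le by (auto split: if_splits)
  then show ?case using Cons by auto
qed simp

text \<open>Some ascending word represents the same permutation with as many letters as there are
  inversions, and no word can be shorter; minimal length is therefore exactly this number.\<close>

lemma reduced_expr_ascending:
  assumes "reduced_expr n w as"
  shows "ascending_word n as"
proof -
  have as: "\<forall>a\<in>set as. Suc a < n" "word_perm as = w" using assms by (auto simp: reduced_expr_def)
  then have w: "w permutes {..<n}" using word_perm_permutes by blast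
  obtain bs where bs: "ascending_word n bs" "inv (word_perm bs) = inv w" "length bs = card (Inv n (inv w))"
    using ascending_word_exists[OF permutes_inv[OF w]] by blast
  have "word_perm bs permutes {..<n}" using bs(1) ascending_word_set word_perm_permutes by blast
  then have "word_perm bs = w" using bs(2) w by (metis permutes_inv_inv)
  then have "length as \<le> length bs" using assms ascending_word_set[OF bs(1)] by (auto simp: reduced_expr_def)
  with bs(3) card_Inv_le_length[OF as(1)] as(2) have "length as = card (Inv n (inv (word_perm as)))"
    by auto
  then show ?thesis by (rule ascending_word_if_length[OF as(1)])
qed

text \<open>Inserting and deleting a factor of square 1 change a product by the same sign, so
  crossing and crossing back need not be told apart.\<close>

lemma prod_toggle:
  fixes g :: "'a \<Rightarrow> 'k::field"
  assumes "finite F" "\<And>P. P \<in> F' \<longleftrightarrow> (P \<in> F) \<noteq> (P = Q)" "g Q * g Q = 1"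
  shows "prod g F' = g Q * prod g F"
proof (cases "Q \<in> F")
  case True
  then have "F' = F - {Q}" using assms(2) by auto
  moreover have "prod g F = g Q * prod g (F - {Q})" using assms(1) True by (rule prod.remove)
  ultimately show ?thesis using assms(3) by (simp flip: mult.assoc)
next
  case False
  then have "F' = insert Q F" using assms(2) by auto
  then show ?thesis using assms(1) False by simp
qed

section \<open>The polynomial representation\<close>

text \<open>The left ideal generated by \<open>e(mu)\<close> is modelled on functions from permutations to
  polynomials: \<open>x\<close> stands for the idempotent of \<open>permute_list x mu\<close>, and the variable \<open>i\<close> for the
  dot on the strand that starts at position \<open>i\<close> of \<open>mu\<close>.  A crossing of two strands that have
  not met before acts as the identity up to sign, and one of two strands that have already crossed
  acts as multiplication by \<open>Q\<close>.\<close>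

locale column =
  fixes n :: nat and mu :: "'i list" and Iodd :: "'i set"
    and t :: "'i \<Rightarrow> 'i \<Rightarrow> nat \<times> nat \<Rightarrow> 'k::field"
    and L :: "'i \<Rightarrow> nat" and D :: "nat \<Rightarrow> nat \<Rightarrow> nat" and d :: "nat \<Rightarrow> nat"
  assumes len: "length mu = n" and dist: "distinct mu"
    and tsym: "i < n \<Longrightarrow> j < n \<Longrightarrow> t (mu ! i) (mu ! j) (r, s) = t (mu ! j) (mu ! i) (s, r)"
    and tlead: "i < n \<Longrightarrow> j < n \<Longrightarrow> i \<noteq> j \<Longrightarrow> t (mu ! i) (mu ! j) (D i j, 0) \<noteq> 0"
    and thom: "i < n \<Longrightarrow> j < n \<Longrightarrow> t (mu ! i) (mu ! j) (r, s) \<noteq> 0 \<Longrightarrow> d i * r + d j * s = d i * D i j"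
    and teven: "i < n \<Longrightarrow> j < n \<Longrightarrow> mu ! i \<in> Iodd \<Longrightarrow> odd r \<Longrightarrow> t (mu ! i) (mu ! j) (r, s) = 0"
    and dpos: "i < n \<Longrightarrow> d i > 0"
begin

definition par :: "nat \<Rightarrow> bool" where "par k \<longleftrightarrow> k < n \<and> mu ! k \<in> Iodd"

text \<open>Q for the colours of strands i and j, in the variables of these strands. In the intended
  instance \<open>D i j\<close> is minus a Cartan entry and \<open>d i\<close> a symmetrizer:
  \<open>thom\<close> is homogeneity of Q, and \<open>tlead\<close> says that the pure power of x_i
  occurs.\<close>

definition qp :: "nat \<Rightarrow> nat \<Rightarrow> 'k mpl" where
  "qp i j = (\<Sum>(r, s)\<in>{rs. t (mu ! i) (mu ! j) rs \<noteq> 0}.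
     cst (t (mu ! i) (mu ! j) (r, s)) * mon (single i r + single j s))"

text \<open>The factor of a crossing with strand \<open>i\<close> on the left before it. For
  \<open>i < j\<close> the strands are then still in the order of \<open>mu\<close>, so this is a
  first crossing.\<close>

definition qf :: "nat \<Rightarrow> nat \<Rightarrow> 'k mpl" where
  "qf i j = (if i < j then 1 else qp i j)"

text \<open>The sign of inserting x_i into a monomial of anticommuting odd variables written in
  increasing order: x_i passes the odd variables of smaller index.\<close>

definition before_odd :: "nat \<Rightarrow> nat set" where
  "before_odd i = (if par i then {j. par j \<and> j < i} else {})"

text \<open>A crossing of two odd strands is itself odd, so it anticommutes with every odd dot,
  wherever that dot sits.\<close>

definition cross_odd :: "(nat \<Rightarrow> nat) \<Rightarrow> nat \<Rightarrow> nat set" where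
  "cross_odd x a = (if par (x a) \<and> par (x (Suc a)) then Collect par else {})"

definition plt :: "nat \<times> nat \<Rightarrow> nat \<times> nat \<Rightarrow> bool" where
  "plt P Q \<longleftrightarrow> fst P < fst Q \<or> (fst P = fst Q \<and> snd P < snd Q)"

text \<open>The sign of moving the square root of 1 attached to \<open>Q\<close> past that attached
  to \<open>P\<close> into lexicographic order. \<open>br P P\<close> is 1, as equal factors meet
  and cancel.\<close>

definition br :: "nat \<times> nat \<Rightarrow> nat \<times> nat \<Rightarrow> 'k" where
  "br P Q = (if plt P Q then - 1 else 1)"

definition sig :: "(nat \<Rightarrow> nat) \<Rightarrow> nat \<times> nat \<Rightarrow> 'k" where
  "sig x P = (\<Prod>P'\<in>{P' \<in> Inv n x. par (fst P') \<and> par (snd P')}. br P' P)"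

definition oo :: "(nat \<Rightarrow> nat) \<Rightarrow> nat \<Rightarrow> 'k" where
  "oo x a = (\<Prod>p<a. if par (x p) then - 1 else 1)"

text \<open>Odd crossings of distant strands must anticommute while the braid relation holds without a
  sign.  Attaching anticommuting square roots of 1 to the odd pairs of strands (this is
  \<open>sig\<close>, the reordering sign in a monomial indexed by the odd inversions) gives the former, and
  makes the braid relation fail by a sign, which \<open>oo\<close> repairs.\<close>

definition kap :: "(nat \<Rightarrow> nat) \<Rightarrow> nat \<Rightarrow> 'k" where
  "kap x a = (if par (x a) \<and> par (x (Suc a)) then oo x a * sig x (pr x a) else 1)"

section \<open>Signs of crossings\<close>

lemma br_square: "br P Q * br P Q = 1"
  by (simp add: br_def)

lemma br_antisym: "P \<noteq> Q \<Longrightarrow> br P Q = - br Q P"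
  by (cases P; cases Q) (auto simp: br_def plt_def)

lemma br_refl: "br P P = 1"
  by (simp add: br_def plt_def)

lemma sig_square: "sig x P * sig x P = 1"
  unfolding sig_def by (simp add: br_square flip: prod.distrib)

lemma oo_square: "oo x a * oo x a = 1"
  unfolding oo_def by (simp flip: prod.distrib) (rule prod.neutral, simp)

lemma kap_square: "kap x a * kap x a = 1"
proof -
  have "oo x a * sig x (pr x a) * (oo x a * sig x (pr x a))
      = (oo x a * oo x a) * (sig x (pr x a) * sig x (pr x a))" by (simp only: ac_simps)
  then show ?thesis by (simp add: kap_def oo_square sig_square)
qed

lemma sig_swap:
  assumes "x permutes {..<n}" "Suc a < n"
  shows "sig (x \<circ> sref a) P = (if par (x a) \<and> par (x (Suc a)) then br (pr x a) P else 1) * sig x P"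
proof -
  have par_pr: "par (fst (pr x a)) \<and> par (snd (pr x a)) \<longleftrightarrow> par (x a) \<and> par (x (Suc a))"
    by (auto simp: pr_def min_def max_def)
  show ?thesis
  proof (cases "par (x a) \<and> par (x (Suc a))")
    case True
    have "(\<Prod>P'\<in>{P' \<in> Inv n (x \<circ> sref a). par (fst P') \<and> par (snd P')}. br P' P)
        = br (pr x a) P * (\<Prod>P'\<in>{P' \<in> Inv n x. par (fst P') \<and> par (snd P')}. br P' P)"
    proof (rule prod_toggle)
      fix Q
      show "Q \<in> {P' \<in> Inv n (x \<circ> sref a). par (fst P') \<and> par (snd P')} \<longleftrightarrow>
        (Q \<in> {P' \<in> Inv n x. par (fst P') \<and> par (snd P')}) \<noteq> (Q = pr x a)"
        using Inv_swap[OF assms, of Q] par_pr True by (cases "Q = pr x a") auto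
    qed (auto simp: finite_Inv br_square)
    then show ?thesis using True by (simp add: sig_def)
  next
    case False
    have "Q \<in> Inv n (x \<circ> sref a) \<and> par (fst Q) \<and> par (snd Q) \<longleftrightarrow>
      Q \<in> Inv n x \<and> par (fst Q) \<and> par (snd Q)" for Q
      using Inv_swap[OF assms, of Q] par_pr False by (cases "Q = pr x a") auto
    then have "{P' \<in> Inv n (x \<circ> sref a). par (fst P') \<and> par (snd P')}
      = {P' \<in> Inv n x. par (fst P') \<and> par (snd P')}" by blast
    then show ?thesis using False by (simp only: sig_def if_False mult_1)
  qed
qed

lemma oo_Suc: "oo x (Suc b) = oo x b * (if par (x b) then - 1 else 1)"
  by (simp add: oo_def)

lemma oo_swap_ge: "a \<le> b \<Longrightarrow> oo (x \<circ> sref b) a = oo x a"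
  unfolding oo_def by (rule prod.cong) (auto simp: sref_other)

lemma oo_swap_lt: "Suc b < a \<Longrightarrow> oo (x \<circ> sref b) a = oo x a"
proof (induction a)
  case (Suc a)
  show ?case
  proof (cases "Suc b = a")
    case True
    have "oo (x \<circ> sref b) (Suc a) = oo x (Suc a)"
      using oo_swap_ge[of b b x] by (simp add: oo_Suc flip: True)
    then show ?thesis .
  next
    case False
    then show ?thesis using Suc by (simp add: oo_Suc sref_other)
  qed
qed simp

lemma pr_swap_same: "pr (x \<circ> sref a) a = pr x a"
  by (simp add: pr_def min.commute max.commute)

lemma kap_swap_same:
  assumes "x permutes {..<n}" "Suc a < n"
  shows "kap (x \<circ> sref a) a * kap x a = 1"
  using kap_square[of x a] sig_swap[OF assms, of "pr x a"] oo_swap_ge[of a a x]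
  by (auto simp: kap_def pr_swap_same br_refl)

lemma pr_neq:
  assumes "x permutes {..<n}" "{a, Suc a} \<noteq> {b, Suc b}"
  shows "pr x a \<noteq> pr x b"
proof
  assume "pr x a = pr x b"
  then have "{x a, x (Suc a)} = {x b, x (Suc b)}"
    by (auto simp: pr_def min_def max_def split: if_splits)
  then have "x ` {a, Suc a} = x ` {b, Suc b}" by simp
  then show False using assms(2) permutes_inj[OF assms(1)] inj_image_eq_iff by metis
qed

text \<open>The exchanges do not disturb each other's counts in \<open>oo\<close>. They toggle
  different pairs of strands, and the reordering signs of two anticommuting factors taken in
  opposite orders differ by -1.\<close>

lemma kap_distant:
  assumes x: "x permutes {..<n}" and ab: "Suc a < n" "Suc b < n" "a + 1 < b \<or> b + 1 < a"
  shows "kap (x \<circ> sref b) a * kap x b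
    = sg (par (x a) \<and> par (x (Suc a)) \<and> par (x b) \<and> par (x (Suc b))) * (kap (x \<circ> sref a) b * kap x a)"
proof -
  have s: "sref b a = a" "sref b (Suc a) = Suc a" "sref a b = b" "sref a (Suc b) = Suc b"
    using ab by (auto simp: sref_other)
  have o: "oo (x \<circ> sref b) a = oo x a" "oo (x \<circ> sref a) b = oo x b"
    using ab by (auto intro: oo_swap_ge oo_swap_lt)
  have p: "pr (x \<circ> sref b) a = pr x a" "pr (x \<circ> sref a) b = pr x b"
    by (simp_all add: pr_def s)
  have ne: "pr x a \<noteq> pr x b" using ab by (intro pr_neq[OF x]) auto
  show ?thesis
    using br_antisym[OF ne]
    by (simp add: kap_def s o p sig_swap[OF x] ab sg_def)
qed

text \<open>The three pairs of strands are met in opposite orders on the two sides. If all strands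
  are odd, reversing three anticommuting factors costs (-1)^3. The factors \<open>oo\<close>
  compensate: beyond \<open>oo x a\<close> they pick up two signs on the left hand side and one on
  the right.\<close>

lemma kap_braid:
  assumes x: "x permutes {..<n}" and a: "Suc (Suc a) < n"
  shows "kap (x \<circ> sref (Suc a) \<circ> sref a) (Suc a) * (kap (x \<circ> sref (Suc a)) a * kap x (Suc a))
    = kap (x \<circ> sref a \<circ> sref (Suc a)) a * (kap (x \<circ> sref a) (Suc a) * kap x a)"
proof -
  define i j k where "i = x a" and "j = x (Suc a)" and "k = x (Suc (Suc a))"
  have s: "sref a (Suc (Suc a)) = Suc (Suc a)" "sref (Suc a) a = a" by (auto simp: sref_other)
  have a': "Suc a < n" using a by simp
  have x1: "x \<circ> sref a permutes {..<n}" "x \<circ> sref (Suc a) permutes {..<n}"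
    using x a by (auto intro: permutes_comp_sref)
  have neq: "i \<noteq> j" "i \<noteq> k" "j \<noteq> k"
    unfolding i_def j_def k_def using permutes_neq[OF x] by auto
  define P12 P13 P23 where "P12 = (min i j, max i j)" and "P13 = (min i k, max i k)"
    and "P23 = (min j k, max j k)"
  have p: "pr x a = P12" "pr x (Suc a) = P23" "pr (x \<circ> sref a) (Suc a) = P13"
    "pr (x \<circ> sref (Suc a)) a = P13" "pr (x \<circ> sref (Suc a) \<circ> sref a) (Suc a) = P12"
    "pr (x \<circ> sref a \<circ> sref (Suc a)) a = P23"
    by (simp_all add: pr_def P12_def P13_def P23_def i_def j_def k_def s)
  have ne: "P12 \<noteq> P13" "P12 \<noteq> P23" "P13 \<noteq> P23"
    unfolding P12_def P13_def P23_def using neq by (auto simp: min_def max_def)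
  have o: "oo x (Suc a) = oo x a * (if par i then - 1 else 1)"
    "oo (x \<circ> sref a) (Suc a) = oo x a * (if par j then - 1 else 1)"
    "oo (x \<circ> sref (Suc a)) a = oo x a"
    "oo (x \<circ> sref (Suc a) \<circ> sref a) (Suc a) = oo x a * (if par k then - 1 else 1)"
    "oo (x \<circ> sref a \<circ> sref (Suc a)) a = oo x a"
    using oo_swap_ge[of a a x] oo_swap_ge[of a "Suc a" x] oo_swap_ge[of a a "x \<circ> sref (Suc a)"]
      oo_swap_ge[of a "Suc a" "x \<circ> sref a"]
    by (simp_all add: oo_Suc i_def j_def k_def s)
  have g: "sig (x \<circ> sref a) P = (if par i \<and> par j then br P12 P else 1) * sig x P"
    "sig (x \<circ> sref (Suc a)) P = (if par j \<and> par k then br P23 P else 1) * sig x P"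
    "sig (x \<circ> sref a \<circ> sref (Suc a)) P = (if par i \<and> par k then br P13 P else 1) * sig (x \<circ> sref a) P"
    "sig (x \<circ> sref (Suc a) \<circ> sref a) P = (if par i \<and> par k then br P13 P else 1) * sig (x \<circ> sref (Suc a)) P"
    for P
    using sig_swap[OF x a', of P] sig_swap[OF x a, of P] sig_swap[OF x1(1) a, of P]
      sig_swap[OF x1(2) a', of P]
    by (simp_all add: p i_def j_def k_def s)
  have v: "(x \<circ> sref (Suc a) \<circ> sref a) (Suc a) = i" "(x \<circ> sref (Suc a) \<circ> sref a) (Suc (Suc a)) = j"
    "(x \<circ> sref (Suc a)) a = i" "(x \<circ> sref (Suc a)) (Suc a) = k" "x (Suc a) = j" "x (Suc (Suc a)) = k"
    "(x \<circ> sref a \<circ> sref (Suc a)) a = j" "(x \<circ> sref a \<circ> sref (Suc a)) (Suc a) = k"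
    "(x \<circ> sref a) (Suc a) = i" "(x \<circ> sref a) (Suc (Suc a)) = k" "x a = i"
    by (simp_all add: i_def j_def k_def s)
  show ?thesis
    unfolding kap_def v p o g
    using br_antisym[OF ne(1)] br_antisym[OF ne(2)] br_antisym[OF ne(3)]
    by (cases "par i"; cases "par j"; cases "par k") (simp_all add: ac_simps)
qed

section \<open>Operators for the generators and their relations\<close>

definition Eop :: "'i list \<Rightarrow> ((nat \<Rightarrow> nat) \<Rightarrow> 'k mpl) \<Rightarrow> (nat \<Rightarrow> nat) \<Rightarrow> 'k mpl" where
  "Eop nu v u = (if permute_list u mu = nu then v u else 0)"

definition Xop :: "nat \<Rightarrow> ((nat \<Rightarrow> nat) \<Rightarrow> 'k mpl) \<Rightarrow> (nat \<Rightarrow> nat) \<Rightarrow> 'k mpl" where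
  "Xop p v u = xv (u p) * theta (before_odd (u p)) (v u)"

definition Tco :: "(nat \<Rightarrow> nat) \<Rightarrow> nat \<Rightarrow> 'k mpl" where
  "Tco x a = cst (kap x a) * qf (x a) (x (Suc a))"

text \<open>\<open>u\<close> denotes the order after the crossing, so \<open>v\<close> is evaluated
  at the source \<open>u \<circ> sref a\<close>; \<open>Top_apply\<close> is the form with the
  source as parameter.\<close>

definition Top :: "nat \<Rightarrow> ((nat \<Rightarrow> nat) \<Rightarrow> 'k mpl) \<Rightarrow> (nat \<Rightarrow> nat) \<Rightarrow> 'k mpl" where
  "Top a v u = Tco (u \<circ> sref a) a * theta (cross_odd (u \<circ> sref a) a) (v (u \<circ> sref a))"

lemma Top_apply: "Top a v (x \<circ> sref a) = Tco x a * theta (cross_odd x a) (v x)"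
  by (simp add: Top_def)

text \<open>Only finiteness of the support of \<open>t\<close> is wanted, so the bound on
  \<open>s\<close> is crude.\<close>

lemma thom_zero: "i < n \<Longrightarrow> j < n \<Longrightarrow> t (mu ! i) (mu ! j) (r, s) \<noteq> 0 \<Longrightarrow> r \<le> D i j \<and> s \<le> d i * D i j"
proof -
  assume a: "i < n" "j < n" "t (mu ! i) (mu ! j) (r, s) \<noteq> 0"
  then have eq: "d i * r + d j * s = d i * D i j" and p: "d i > 0" "d j > 0" using thom dpos by auto
  have "d i * r \<le> d i * D i j" using eq by linarith
  moreover have "s \<le> d j * s" using p by simp
  ultimately show ?thesis using eq p by (metis le_add2 mult_le_cancel1 order_trans)
qed

lemma finite_t: "i < n \<Longrightarrow> j < n \<Longrightarrow> finite {rs. t (mu ! i) (mu ! j) rs \<noteq> 0}"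
  by (rule finite_subset[of _ "{..D i j} \<times> {..d i * D i j}"]) (use thom_zero in auto)

lemma teven2: "i < n \<Longrightarrow> j < n \<Longrightarrow> mu ! j \<in> Iodd \<Longrightarrow> odd s \<Longrightarrow> t (mu ! i) (mu ! j) (r, s) = 0"
  using teven[of j i s r] tsym[of i j r s] by simp

lemma qp_commute:
  assumes "i < n" "j < n"
  shows "qp i j = qp j i"
  unfolding qp_def
  by (rule sum.reindex_bij_witness[of _ prod.swap prod.swap])
    (use tsym[OF assms] in \<open>auto simp: add.commute\<close>)

lemma keys_qp:
  assumes "i < n" "j < n" "m \<in> keys (qp i j)"
  obtains r s where "t (mu ! i) (mu ! j) (r, s) \<noteq> 0" "m = single i r + single j s"
proof -
  let ?F = "\<lambda>(r, s). (cst (t (mu ! i) (mu ! j) (r, s)) * mon (single i r + single j s) :: 'k mpl)"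
  have "m \<in> (\<Union>rs\<in>{rs. t (mu ! i) (mu ! j) rs \<noteq> 0}. keys (?F rs))"
    using assms(3) keys_sum[of ?F] unfolding qp_def by blast
  then show ?thesis using that
    by (auto simp: single_eq_cst_mon[symmetric] split: if_splits)
qed

text \<open>Odd strands enter Q with even exponents only, so a sign change of odd variables cannot
  be seen.\<close>

lemma theta_qp:
  assumes "i < n" "j < n" "S \<subseteq> Collect par"
  shows "theta S (qp i j) = qp i j"
proof (rule poly_mapping_eqI)
  fix m
  show "lookup (theta S (qp i j)) m = lookup (qp i j) m"
  proof (cases "m \<in> keys (qp i j)")
    case True
    then obtain r s where rs: "t (mu ! i) (mu ! j) (r, s) \<noteq> 0" "m = single i r + single j s"
      using keys_qp assms by blast
    have S: "mu ! k \<in> Iodd" if "k \<in> S" for k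
      using that assms(3) par_def by blast
    have "even r" if "i \<in> S"
      using rs(1) teven[OF assms(1,2) S[OF that]] by blast
    moreover have "even s" if "j \<in> S"
      using rs(1) teven2[OF assms(1,2) S[OF that]] by blast
    ultimately have "esign S m = (1::'k)" by (simp add: rs(2) esign_add esign_single)
    then show ?thesis by (simp add: lookup_theta)
  qed (simp add: lookup_theta in_keys_iff)
qed

lemma theta_qf: "i < n \<Longrightarrow> j < n \<Longrightarrow> S \<subseteq> Collect par \<Longrightarrow> theta S (qf i j) = qf i j"
  by (simp add: qf_def theta_qp)

lemma before_odd_par: "before_odd i \<subseteq> Collect par" and cross_odd_par: "cross_odd x a \<subseteq> Collect par"
  by (auto simp: before_odd_def cross_odd_def)

lemma theta_Tco:
  assumes "x permutes {..<n}" "Suc a < n" "S \<subseteq> Collect par"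
  shows "theta S (Tco x a) = Tco x a"
  using permutes_less[OF assms(1)] assms by (simp add: Tco_def theta_mult theta_qf)

lemma qp_pol: "i < n \<Longrightarrow> j < n \<Longrightarrow> qp i j \<in> pol n"
  unfolding qp_def by (intro pol_sum) (auto intro!: pol_intros simp: keys_plus_nat split: if_splits)

lemma qf_pol: "i < n \<Longrightarrow> j < n \<Longrightarrow> qf i j \<in> pol n"
  by (simp add: qf_def qp_pol pol_one)

lemma Tco_pol: "x permutes {..<n} \<Longrightarrow> Suc a < n \<Longrightarrow> Tco x a \<in> pol n"
  using permutes_less[of x n] by (simp add: Tco_def pol_mult pol_cst qf_pol)

lemma qf_swap: "i < n \<Longrightarrow> j < n \<Longrightarrow> i \<noteq> j \<Longrightarrow> qf i j * qf j i = qp i j"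
  by (auto simp: qf_def qp_commute)

lemma Tco_swap:
  assumes "x permutes {..<n}" "Suc a < n"
  shows "Tco (x \<circ> sref a) a * Tco x a = qp (x a) (x (Suc a))"
proof -
  have "x a \<noteq> x (Suc a)" "x a < n" "x (Suc a) < n"
    using permutes_neq[OF assms(1)] permutes_less[OF assms(1)] assms(2) by auto
  then have "qf (x (Suc a)) (x a) * qf (x a) (x (Suc a)) = qp (x a) (x (Suc a))"
    using qf_swap by (metis mult.commute)
  moreover have "cst (kap (x \<circ> sref a) a) * cst (kap x a) = (1 :: 'k mpl)"
    using kap_swap_same[OF assms] by (simp flip: cst_mult)
  ultimately have "(cst (kap (x \<circ> sref a) a) * cst (kap x a)) *
      (qf (x (Suc a)) (x a) * qf (x a) (x (Suc a))) = qp (x a) (x (Suc a))" by simp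
  then show ?thesis by (simp add: Tco_def ac_simps)
qed

lemma Top_Top:
  assumes "x permutes {..<n}" "Suc a < n" "Suc b < n"
  shows "Top a (Top b v) (x \<circ> sref b \<circ> sref a)
    = Tco (x \<circ> sref b) a * Tco x b * theta (cross_odd (x \<circ> sref b) a) (theta (cross_odd x b) (v x))"
  unfolding Top_apply
  by (simp add: theta_mult theta_Tco assms cross_odd_par mult.assoc)

lemma Top_square:
  assumes "x permutes {..<n}" "Suc a < n"
  shows "Top a (Top a v) x = qp (x a) (x (Suc a)) * v x"
proof -
  have "cross_odd (x \<circ> sref a) a = cross_odd x a" by (simp add: cross_odd_def conj_commute)
  then show ?thesis
    using Top_Top[OF assms(1,2,2), of v] by (simp add: Tco_swap[OF assms])
qed

lemma Top_distant:
  assumes x: "x permutes {..<n}" and ab: "Suc a < n" "Suc b < n" "a + 1 < b \<or> b + 1 < a"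
  shows "Top a (Top b v) (x \<circ> sref b \<circ> sref a)
    = cst (sg (par (x a) \<and> par (x (Suc a)) \<and> par (x b) \<and> par (x (Suc b))))
      * Top b (Top a v) (x \<circ> sref b \<circ> sref a)"
proof -
  have s: "sref b a = a" "sref b (Suc a) = Suc a" "sref a b = b" "sref a (Suc b) = Suc b"
    using ab by (auto simp: sref_other)
  have "sref b \<circ> sref a = sref a \<circ> sref b"
    using ab by (auto simp: fun_eq_iff sref_def transpose_def)
  then have comm: "x \<circ> sref b \<circ> sref a = x \<circ> sref a \<circ> sref b" by (metis comp_assoc)
  have c: "cross_odd (x \<circ> sref b) a = cross_odd x a" "cross_odd (x \<circ> sref a) b = cross_odd x b"
    by (simp_all add: cross_odd_def s)
  have T: "Tco (x \<circ> sref b) a * Tco x b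
      = cst (sg (par (x a) \<and> par (x (Suc a)) \<and> par (x b) \<and> par (x (Suc b)))) * (Tco (x \<circ> sref a) b * Tco x a)"
  proof -
    have "Tco (x \<circ> sref b) a * Tco x b = cst (kap (x \<circ> sref b) a * kap x b) *
        (qf (x a) (x (Suc a)) * qf (x b) (x (Suc b)))"
      by (simp add: Tco_def s cst_mult ac_simps)
    also have "\<dots> = cst (sg (par (x a) \<and> par (x (Suc a)) \<and> par (x b) \<and> par (x (Suc b)))) * (Tco (x \<circ> sref a) b * Tco x a)"
      unfolding kap_distant[OF assms] by (simp add: Tco_def s cst_mult ac_simps)
    finally show ?thesis .
  qed
  show ?thesis
    unfolding Top_Top[OF x ab(1,2)] T c
    unfolding comm Top_Top[OF x ab(2,1)] c
    by (simp only: theta_commute[of "cross_odd x a"] mult.assoc)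
qed

text \<open>Each side passes every pair of the three strands once, so the polynomial factors agree
  by commutativity and the sign identity \<open>kap_braid\<close> remains. No correction term
  arises, as no crossing acts by a divided difference.\<close>

lemma Top_braid:
  assumes x: "x permutes {..<n}" and a: "Suc (Suc a) < n"
  defines "u \<equiv> x \<circ> sref a \<circ> sref (Suc a) \<circ> sref a"
  shows "Top (Suc a) (Top a (Top (Suc a) v)) u = Top a (Top (Suc a) (Top a v)) u"
proof -
  have s: "sref a (Suc (Suc a)) = Suc (Suc a)" "sref (Suc a) a = a" by (auto simp: sref_other)
  have a': "Suc a < n" using a by simp
  have x1: "x \<circ> sref a permutes {..<n}" "x \<circ> sref (Suc a) permutes {..<n}"
    using x a by (auto intro: permutes_comp_sref)
  have x2: "x \<circ> sref a \<circ> sref (Suc a) permutes {..<n}" "x \<circ> sref (Suc a) \<circ> sref a permutes {..<n}"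
    using x1 a a' by (auto intro: permutes_comp_sref)
  have "sref a (sref (Suc a) (sref a p)) = sref (Suc a) (sref a (sref (Suc a) p))" for p
    by (auto simp: sref_def transpose_def)
  then have u: "u = x \<circ> sref (Suc a) \<circ> sref a \<circ> sref (Suc a)" by (simp add: u_def fun_eq_iff)
  have K: "Tco (x \<circ> sref (Suc a) \<circ> sref a) (Suc a) * (Tco (x \<circ> sref (Suc a)) a * Tco x (Suc a))
      = Tco (x \<circ> sref a \<circ> sref (Suc a)) a * (Tco (x \<circ> sref a) (Suc a) * Tco x a)"
  proof -
    let ?q = "qf (x a) (x (Suc a)) * qf (x a) (x (Suc (Suc a))) * qf (x (Suc a)) (x (Suc (Suc a)))"
    have "Tco (x \<circ> sref (Suc a) \<circ> sref a) (Suc a) * (Tco (x \<circ> sref (Suc a)) a * Tco x (Suc a))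
       = cst (kap (x \<circ> sref (Suc a) \<circ> sref a) (Suc a) * (kap (x \<circ> sref (Suc a)) a * kap x (Suc a))) * ?q"
      by (simp add: Tco_def s cst_mult ac_simps)
    also have "\<dots> = Tco (x \<circ> sref a \<circ> sref (Suc a)) a * (Tco (x \<circ> sref a) (Suc a) * Tco x a)"
      unfolding kap_braid[OF x a] by (simp add: Tco_def s cst_mult ac_simps)
    finally show ?thesis .
  qed
  have c: "cross_odd (x \<circ> sref (Suc a) \<circ> sref a) (Suc a) = cross_odd x a"
    "cross_odd (x \<circ> sref a \<circ> sref (Suc a)) a = cross_odd x (Suc a)"
    "cross_odd (x \<circ> sref a) (Suc a) = cross_odd (x \<circ> sref (Suc a)) a"
    by (simp_all add: cross_odd_def s)
  have 1: "Top (Suc a) (Top a (Top (Suc a) v)) u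
    = Tco (x \<circ> sref (Suc a) \<circ> sref a) (Suc a) * (Tco (x \<circ> sref (Suc a)) a * Tco x (Suc a)) *
      theta (cross_odd x a) (theta (cross_odd (x \<circ> sref (Suc a)) a) (theta (cross_odd x (Suc a)) (v x)))"
    unfolding u Top_apply
    by (simp add: theta_mult theta_Tco x x1 x2 a a' cross_odd_par mult.assoc c)
  have 2: "Top a (Top (Suc a) (Top a v)) u
    = Tco (x \<circ> sref a \<circ> sref (Suc a)) a * (Tco (x \<circ> sref a) (Suc a) * Tco x a) *
      theta (cross_odd x (Suc a)) (theta (cross_odd (x \<circ> sref (Suc a)) a) (theta (cross_odd x a) (v x)))"
    unfolding u_def Top_apply
    by (simp add: theta_mult theta_Tco x x1 x2 a a' cross_odd_par mult.assoc c)
  have "theta A (theta B (theta C p)) = theta C (theta B (theta A p))" for A B C and p :: "'k mpl"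
    by (rule poly_mapping_eqI) (simp add: lookup_theta ac_simps)
  then show ?thesis unfolding 1 2 K by simp
qed

text \<open>The dot stays on its strand and so keeps its variable, while its position moves by
  \<open>sref a\<close>. One identity thereby covers all three relations between dots and
  crossings.\<close>

lemma Top_Xop:
  assumes x: "x permutes {..<n}" and a: "Suc a < n" and p: "p < n"
  shows "Top a (Xop p v) (x \<circ> sref a)
    = cst (sg (par (x p) \<and> par (x a) \<and> par (x (Suc a)))) * Xop (sref a p) (Top a v) (x \<circ> sref a)"
proof -
  have "theta (cross_odd x a) (xv (x p)) = cst (sg (par (x p) \<and> par (x a) \<and> par (x (Suc a)))) * (xv (x p) :: 'k mpl)"
    by (simp add: theta_xv cross_odd_def sg_def cst_uminus)
  then show ?thesis
    unfolding Top_apply Xop_def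
    by (simp add: theta_mult theta_Tco x a before_odd_par theta_commute[of "cross_odd x a"] ac_simps Top_def)
qed

lemma Xop_Xop:
  assumes x: "x permutes {..<n}" and pq: "p < n" "q < n" "p \<noteq> q"
  shows "Xop p (Xop q v) x = cst (sg (par (x p) \<and> par (x q))) * Xop q (Xop p v) x"
proof -
  have ne: "x p \<noteq> x q" using permutes_neq[OF x pq(3)] .
  let ?i = "x p" and ?j = "x q"
  have th: "theta (before_odd i) (xv j) = (cst (sg (par i \<and> par j \<and> j < i)) * xv j :: 'k mpl)" for i j
    by (simp add: theta_xv before_odd_def sg_def cst_uminus)
  \<comment> \<open>Of two distinct strands exactly one has the smaller index, so exactly one of the
    two orders of the dots produces the sign.\<close>
  have sg: "(sg (par ?i \<and> par ?j \<and> ?j < ?i) :: 'k)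
      = sg (par ?i \<and> par ?j) * sg (par ?j \<and> par ?i \<and> ?i < ?j)"
    using ne by (auto simp: sg_def)
  show ?thesis
    unfolding Xop_def theta_mult th sg
    by (simp add: cst_mult theta_commute[of "before_odd ?i"] ac_simps)
qed

end

section \<open>The defining relations\<close>

definition qpoly :: "('i \<Rightarrow> 'i \<Rightarrow> nat \<times> nat \<Rightarrow> 'k::field) \<Rightarrow> 'i \<Rightarrow> 'i \<Rightarrow> nat \<Rightarrow> nat \<Rightarrow> ('i, 'k) falg" where
  "qpoly t i j u v = (\<Sum>(r, s)\<in>{rs. t i j rs \<noteq> 0}. sc (t i j (r, s)) * wd (xmon u r @ xmon v s))"

lemma to_fa_qpoly: "to_fa (qpoly t i j u v) = Qpoly t i j u v"
  unfolding qpoly_def Qpoly_def to_fa_sum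
  by (simp add: case_prod_unfold to_fa_sc to_fa_wd)

text \<open>The relations in the case of pairwise distinct entries, where the delta terms and the right
  hand side of the braid relation vanish.\<close>

inductive_set qh_rels :: "'i set \<Rightarrow> ('i \<Rightarrow> 'i \<Rightarrow> nat \<times> nat \<Rightarrow> 'k::field) \<Rightarrow> nat \<Rightarrow> 'i list set \<Rightarrow> ('i, 'k) falg set"
  for Iodd t n Ib where
  idem: "mu \<in> Ib \<Longrightarrow> nu \<in> Ib \<Longrightarrow>
    wd [E mu, E nu] - (if mu = nu then wd [E nu] else 0) \<in> qh_rels Iodd t n Ib"
| unit: "(\<Sum>nu\<in>Ib. wd [E nu]) - wd [] \<in> qh_rels Iodd t n Ib"
| XX: "p < n \<Longrightarrow> q < n \<Longrightarrow> p \<noteq> q \<Longrightarrow> nu \<in> Ib \<Longrightarrow>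
    wd [X p, X q, E nu] - sc (sg (nu ! p \<in> Iodd \<and> nu ! q \<in> Iodd)) * wd [X q, X p, E nu]
      \<in> qh_rels Iodd t n Ib"
| XE: "p < n \<Longrightarrow> nu \<in> Ib \<Longrightarrow> wd [X p, E nu] - wd [E nu, X p] \<in> qh_rels Iodd t n Ib"
| TE: "Suc a < n \<Longrightarrow> nu \<in> Ib \<Longrightarrow>
    wd [T a, E nu] - wd [E (perm_act (sref a) nu), T a] \<in> qh_rels Iodd t n Ib"
| TX: "Suc a < n \<Longrightarrow> p < n \<Longrightarrow> p \<noteq> a \<Longrightarrow> p \<noteq> Suc a \<Longrightarrow> nu \<in> Ib \<Longrightarrow>
    wd [T a, X p, E nu]
      - sc (sg (nu ! p \<in> Iodd \<and> nu ! a \<in> Iodd \<and> nu ! Suc a \<in> Iodd)) * wd [X p, T a, E nu]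
      \<in> qh_rels Iodd t n Ib"
| TX1: "Suc a < n \<Longrightarrow> nu \<in> Ib \<Longrightarrow>
    wd [T a, X (Suc a), E nu] - sc (sg (nu ! a \<in> Iodd \<and> nu ! Suc a \<in> Iodd)) * wd [X a, T a, E nu]
      \<in> qh_rels Iodd t n Ib"
| TX2: "Suc a < n \<Longrightarrow> nu \<in> Ib \<Longrightarrow>
    wd [X (Suc a), T a, E nu] - sc (sg (nu ! a \<in> Iodd \<and> nu ! Suc a \<in> Iodd)) * wd [T a, X a, E nu]
      \<in> qh_rels Iodd t n Ib"
| TT: "Suc a < n \<Longrightarrow> nu \<in> Ib \<Longrightarrow>
    wd [T a, T a, E nu] - qpoly t (nu ! a) (nu ! Suc a) a (Suc a) * wd [E nu] \<in> qh_rels Iodd t n Ib"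
| TTd: "Suc a < n \<Longrightarrow> Suc b < n \<Longrightarrow> a + 1 < b \<or> b + 1 < a \<Longrightarrow> nu \<in> Ib \<Longrightarrow>
    wd [T a, T b, E nu]
      - sc (sg (nu ! a \<in> Iodd \<and> nu ! Suc a \<in> Iodd \<and> nu ! b \<in> Iodd \<and> nu ! Suc b \<in> Iodd)) * wd [T b, T a, E nu]
      \<in> qh_rels Iodd t n Ib"
| braid: "a + 2 < n \<Longrightarrow> nu \<in> Ib \<Longrightarrow>
    wd [T (Suc a), T a, T (Suc a), E nu] - wd [T a, T (Suc a), T a, E nu] \<in> qh_rels Iodd t n Ib"

lemma fa_diff_zero: "fa_diff f fa_zero = f"
  by (simp add: fa_diff_def fa_zero_def)

lemma to_fa_mult_wd: "to_fa (p * wd u) = fa_mult (to_fa p) (fa_word u)"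
  by (simp add: to_fa_mult to_fa_wd)

lemma to_fa_qh_rels:
  assumes "\<And>nu. nu \<in> Ib \<Longrightarrow> length nu = n \<and> distinct nu"
  shows "to_fa ` qh_rels Iodd t n Ib = QH_rels Iodd t n Ib"
proof -
  have d1: "nu ! a \<noteq> nu ! Suc a" if "nu \<in> Ib" "Suc a < n" for nu a
    using assms[OF that(1)] that(2) by (simp add: nth_eq_iff_index_eq)
  have d2: "braid_rhs Iodd t nu a = fa_zero" if "nu \<in> Ib" "a + 2 < n" for nu a
    using assms[OF that(1)] that(2) by (simp add: braid_rhs_def nth_eq_iff_index_eq Let_def)
  note tofa = to_fa_diff to_fa_sc to_fa_wd to_fa_zero if_distrib[of to_fa]
  show ?thesis
  proof (intro equalityI subsetI)
    fix f assume "f \<in> to_fa ` qh_rels Iodd t n Ib"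
    then obtain r where "r \<in> qh_rels Iodd t n Ib" and f: "f = to_fa r" by blast
    then show "f \<in> QH_rels Iodd t n Ib"
    proof cases
      case (idem mu nu)
      then show ?thesis unfolding f QH_rels_def by (auto simp: tofa)
    next
      case unit
      then have "f \<in> {fa_diff (fa_sum (\<lambda>nu. fa_word [E nu]) Ib) (fa_word [])}"
        unfolding f by (simp only: to_fa_diff to_fa_sum to_fa_wd singleton_iff)
      then show ?thesis unfolding QH_rels_def by (simp only: Un_iff simp_thms)
    next
      case (XX p q nu)
      then have "f \<in> {fa_diff (fa_word [X p, X q, E nu])
        (fa_smul (sg (nu ! p \<in> Iodd \<and> nu ! q \<in> Iodd)) (fa_word [X q, X p, E nu]))
       | p q nu. p < n \<and> q < n \<and> p \<noteq> q \<and> nu \<in> Ib}" unfolding f by (auto simp only: tofa)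
      then show ?thesis unfolding QH_rels_def by (simp only: Un_iff simp_thms)
    next
      case (XE p nu)
      then have "f \<in> {fa_diff (fa_word [X p, E nu]) (fa_word [E nu, X p]) | p nu. p < n \<and> nu \<in> Ib}"
        unfolding f by (auto simp only: tofa)
      then show ?thesis unfolding QH_rels_def by (simp only: Un_iff simp_thms)
    next
      case (TE a nu)
      then have "f \<in> {fa_diff (fa_word [T a, E nu]) (fa_word [E (perm_act (sref a) nu), T a]) | a nu. Suc a < n \<and> nu \<in> Ib}"
        unfolding f by (auto simp only: tofa)
      then show ?thesis unfolding QH_rels_def by (simp only: Un_iff simp_thms)
    next
      case (TX a p nu)
      then have "f \<in> {fa_diff (fa_word [T a, X p, E nu])
        (fa_smul (sg (nu ! p \<in> Iodd \<and> nu ! a \<in> Iodd \<and> nu ! Suc a \<in> Iodd)) (fa_word [X p, T a, E nu]))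
       | a p nu. Suc a < n \<and> p < n \<and> p \<noteq> a \<and> p \<noteq> Suc a \<and> nu \<in> Ib}"
        unfolding f by (auto simp only: tofa)
      then show ?thesis unfolding QH_rels_def by (simp only: Un_iff simp_thms)
    next
      case (TX1 a nu)
      then have "f = fa_diff (fa_diff (fa_word [T a, X (Suc a), E nu])
                 (fa_smul (sg (nu ! a \<in> Iodd \<and> nu ! Suc a \<in> Iodd)) (fa_word [X a, T a, E nu])))
        (if nu ! a = nu ! Suc a then fa_word [E nu] else fa_zero)"
        unfolding f using d1 by (simp add: tofa fa_diff_zero)
      then have "f \<in> {fa_diff (fa_diff (fa_word [T a, X (Suc a), E nu])
                 (fa_smul (sg (nu ! a \<in> Iodd \<and> nu ! Suc a \<in> Iodd)) (fa_word [X a, T a, E nu])))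
        (if nu ! a = nu ! Suc a then fa_word [E nu] else fa_zero)
       | a nu. Suc a < n \<and> nu \<in> Ib}" using TX1(2,3) by blast
      then show ?thesis unfolding QH_rels_def by (simp only: Un_iff simp_thms)
    next
      case (TX2 a nu)
      then have "f = fa_diff (fa_diff (fa_word [X (Suc a), T a, E nu])
                 (fa_smul (sg (nu ! a \<in> Iodd \<and> nu ! Suc a \<in> Iodd)) (fa_word [T a, X a, E nu])))
        (if nu ! a = nu ! Suc a then fa_word [E nu] else fa_zero)"
        unfolding f using d1 by (simp add: tofa fa_diff_zero)
      then have "f \<in> {fa_diff (fa_diff (fa_word [X (Suc a), T a, E nu])
                 (fa_smul (sg (nu ! a \<in> Iodd \<and> nu ! Suc a \<in> Iodd)) (fa_word [T a, X a, E nu])))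
        (if nu ! a = nu ! Suc a then fa_word [E nu] else fa_zero)
       | a nu. Suc a < n \<and> nu \<in> Ib}" using TX2(2,3) by blast
      then show ?thesis unfolding QH_rels_def by (simp only: Un_iff simp_thms)
    next
      case (TT a nu)
      then have "f \<in> {fa_diff (fa_word [T a, T a, E nu])
        (fa_mult (Qpoly t (nu ! a) (nu ! Suc a) a (Suc a)) (fa_word [E nu]))
       | a nu. Suc a < n \<and> nu \<in> Ib}"
        unfolding f by (auto simp only: to_fa_diff to_fa_wd to_fa_mult_wd to_fa_qpoly)
      then show ?thesis unfolding QH_rels_def by (simp only: Un_iff simp_thms)
    next
      case (TTd a b nu)
      then have "f \<in> {fa_diff (fa_word [T a, T b, E nu])
        (fa_smul (sg (nu ! a \<in> Iodd \<and> nu ! Suc a \<in> Iodd \<and> nu ! b \<in> Iodd \<and> nu ! Suc b \<in> Iodd))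
           (fa_word [T b, T a, E nu]))
       | a b nu. Suc a < n \<and> Suc b < n \<and> (a + 1 < b \<or> b + 1 < a) \<and> nu \<in> Ib}"
        unfolding f TTd(1) to_fa_diff to_fa_sc to_fa_wd using TTd(2-5) by blast
      then show ?thesis unfolding QH_rels_def by (simp only: Un_iff simp_thms)
    next
      case (braid a nu)
      then have "f = fa_diff (fa_diff (fa_word [T (Suc a), T a, T (Suc a), E nu]) (fa_word [T a, T (Suc a), T a, E nu]))
        (fa_mult (braid_rhs Iodd t nu a) (fa_word [E nu]))"
        unfolding f using d2 by (simp add: tofa fa_mult_zero fa_diff_zero)
      then have "f \<in> {fa_diff (fa_diff (fa_word [T (Suc a), T a, T (Suc a), E nu]) (fa_word [T a, T (Suc a), T a, E nu]))
        (fa_mult (braid_rhs Iodd t nu a) (fa_word [E nu]))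
       | a nu. a + 2 < n \<and> nu \<in> Ib}" using braid(2,3) by blast
      then show ?thesis unfolding QH_rels_def by (simp only: Un_iff simp_thms)
    qed
  next
    fix f assume f: "f \<in> QH_rels Iodd t n Ib"
    have I: "f \<in> to_fa ` qh_rels Iodd t n Ib" if "f = to_fa r" "r \<in> qh_rels Iodd t n Ib" for r
      using that by blast
    from f show "f \<in> to_fa ` qh_rels Iodd t n Ib"
      unfolding QH_rels_def Un_iff
    proof (elim disjE CollectE exE conjE singletonE)
      fix mu nu assume "f = fa_diff (fa_word [E mu, E nu]) (if mu = nu then fa_word [E nu] else fa_zero)"
        "mu \<in> Ib" "nu \<in> Ib"
      then show ?thesis by (intro I[OF _ qh_rels.idem[of mu Ib nu]]) (simp_all add: tofa)
    next
      assume "f = fa_diff (fa_sum (\<lambda>nu. fa_word [E nu]) Ib) (fa_word [])"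
      then show ?thesis by (intro I[OF _ qh_rels.unit]) (simp add: to_fa_diff to_fa_sum to_fa_wd del: wd_Nil)
    next
      fix p q nu assume "f = fa_diff (fa_word [X p, X q, E nu])
        (fa_smul (sg (nu ! p \<in> Iodd \<and> nu ! q \<in> Iodd)) (fa_word [X q, X p, E nu]))"
        "p < n" "q < n" "p \<noteq> q" "nu \<in> Ib"
      then show ?thesis by (intro I[OF _ qh_rels.XX[of p n q nu]]) (simp_all add: tofa)
    next
      fix p nu assume "f = fa_diff (fa_word [X p, E nu]) (fa_word [E nu, X p])" "p < n" "nu \<in> Ib"
      then show ?thesis by (intro I[OF _ qh_rels.XE[of p n nu]]) (simp_all add: tofa)
    next
      fix a nu assume "f = fa_diff (fa_word [T a, E nu]) (fa_word [E (perm_act (sref a) nu), T a])"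
        "Suc a < n" "nu \<in> Ib"
      then show ?thesis by (intro I[OF _ qh_rels.TE[of a n nu]]) (simp_all add: tofa)
    next
      fix a p nu assume "f = fa_diff (fa_word [T a, X p, E nu])
        (fa_smul (sg (nu ! p \<in> Iodd \<and> nu ! a \<in> Iodd \<and> nu ! Suc a \<in> Iodd)) (fa_word [X p, T a, E nu]))"
        "Suc a < n" "p < n" "p \<noteq> a" "p \<noteq> Suc a" "nu \<in> Ib"
      then show ?thesis by (intro I[OF _ qh_rels.TX[of a n p nu]]) (simp_all add: tofa)
    next
      fix a nu assume "f = fa_diff (fa_diff (fa_word [T a, X (Suc a), E nu])
                 (fa_smul (sg (nu ! a \<in> Iodd \<and> nu ! Suc a \<in> Iodd)) (fa_word [X a, T a, E nu])))
        (if nu ! a = nu ! Suc a then fa_word [E nu] else fa_zero)" "Suc a < n" "nu \<in> Ib"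
      then show ?thesis using d1
        by (intro I[OF _ qh_rels.TX1[of a n nu]]) (simp_all add: tofa fa_diff_zero)
    next
      fix a nu assume "f = fa_diff (fa_diff (fa_word [X (Suc a), T a, E nu])
                 (fa_smul (sg (nu ! a \<in> Iodd \<and> nu ! Suc a \<in> Iodd)) (fa_word [T a, X a, E nu])))
        (if nu ! a = nu ! Suc a then fa_word [E nu] else fa_zero)" "Suc a < n" "nu \<in> Ib"
      then show ?thesis using d1
        by (intro I[OF _ qh_rels.TX2[of a n nu]]) (simp_all add: tofa fa_diff_zero)
    next
      fix a nu assume "f = fa_diff (fa_word [T a, T a, E nu])
        (fa_mult (Qpoly t (nu ! a) (nu ! Suc a) a (Suc a)) (fa_word [E nu]))" "Suc a < n" "nu \<in> Ib"
      then show ?thesis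
        by (intro I[OF _ qh_rels.TT[of a n nu]]) (simp_all add: to_fa_diff to_fa_wd to_fa_mult_wd to_fa_qpoly)
    next
      fix a b nu assume "f = fa_diff (fa_word [T a, T b, E nu])
        (fa_smul (sg (nu ! a \<in> Iodd \<and> nu ! Suc a \<in> Iodd \<and> nu ! b \<in> Iodd \<and> nu ! Suc b \<in> Iodd))
           (fa_word [T b, T a, E nu]))" "Suc a < n" "Suc b < n" "nu \<in> Ib" "a + 1 < b"
      then show ?thesis by (intro I[OF _ qh_rels.TTd[of a n b nu]]) (simp_all add: tofa)
    next
      fix a b nu assume "f = fa_diff (fa_word [T a, T b, E nu])
        (fa_smul (sg (nu ! a \<in> Iodd \<and> nu ! Suc a \<in> Iodd \<and> nu ! b \<in> Iodd \<and> nu ! Suc b \<in> Iodd))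
           (fa_word [T b, T a, E nu]))" "Suc a < n" "Suc b < n" "nu \<in> Ib" "b + 1 < a"
      then show ?thesis by (intro I[OF _ qh_rels.TTd[of a n b nu]]) (simp_all add: tofa)
    next
      fix a nu assume "f = fa_diff (fa_diff (fa_word [T (Suc a), T a, T (Suc a), E nu]) (fa_word [T a, T (Suc a), T a, E nu]))
        (fa_mult (braid_rhs Iodd t nu a) (fa_word [E nu]))" "a + 2 < n" "nu \<in> Ib"
      then show ?thesis using d2
        by (intro I[OF _ qh_rels.braid[of a n nu]]) (simp_all add: tofa fa_mult_zero fa_diff_zero)
    qed
  qed
qed

section \<open>The representation annihilates the defining relations\<close>

context column
begin

text \<open>Generated from \<open>mu\<close> instead of from the root beta; \<open>Ibeta_eq\<close>
  and \<open>Ib_mset\<close> identify the two.\<close>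

definition Ib :: "'i list set" where "Ib = {permute_list u mu | u. u permutes {..<n}}"

abbreviation "G \<equiv> QH_gens n Ib"

definition J0 :: "('i, 'k) falg set" where "J0 = ideal_gen G (qh_rels Iodd t n Ib)"

fun act :: "'i gen \<Rightarrow> ((nat \<Rightarrow> nat) \<Rightarrow> 'k mpl) \<Rightarrow> (nat \<Rightarrow> nat) \<Rightarrow> 'k mpl" where
  "act (E nu) = Eop nu"
| "act (X p) = Xop p"
| "act (T a) = Top a"

definition actw :: "'i gen list \<Rightarrow> ((nat \<Rightarrow> nat) \<Rightarrow> 'k mpl) \<Rightarrow> (nat \<Rightarrow> nat) \<Rightarrow> 'k mpl" where
  "actw w v = foldr act w v"

definition actp :: "('i, 'k) falg \<Rightarrow> ((nat \<Rightarrow> nat) \<Rightarrow> 'k mpl) \<Rightarrow> (nat \<Rightarrow> nat) \<Rightarrow> 'k mpl" where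
  "actp p v u = (\<Sum>w\<in>keys p. cst (lookup p w) * actw (letters w) v u)"

lemma actw_Nil [simp]: "actw [] v = v" and actw_Cons [simp]: "actw (g # w) v = act g (actw w v)"
  and actw_append: "actw (w @ w') v = actw w (actw w' v)"
  by (simp_all add: actw_def)

lemma act_add: "act g (\<lambda>u. v u + w u) = (\<lambda>u. act g v u + act g w u)"
  by (cases g) (simp_all add: fun_eq_iff Eop_def Xop_def Top_def theta_add distrib_left)

lemma act_cst: "act g (\<lambda>u. cst c * v u) = (\<lambda>u. cst c * act g v u)"
  by (cases g) (simp_all add: fun_eq_iff Eop_def Xop_def Top_def theta_mult ac_simps)

lemma act_zero: "act g (\<lambda>_. 0) = (\<lambda>_. 0)"
  by (cases g) (simp_all add: fun_eq_iff Eop_def Xop_def Top_def)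

lemma actw_add: "actw g (\<lambda>u. v u + w u) = (\<lambda>u. actw g v u + actw g w u)"
  by (induction g) (simp_all add: act_add)

lemma actw_cst: "actw g (\<lambda>u. cst c * v u) = (\<lambda>u. cst c * actw g v u)"
  by (induction g) (simp_all add: act_cst)

lemma actw_zero: "actw g (\<lambda>_. 0) = (\<lambda>_. 0)"
  by (induction g) (simp_all add: act_zero)

lemma actp_zero: "actp 0 v u = 0"
  by (simp add: actp_def)

lemma actp_single: "actp (single w c) v u = cst c * actw (letters w) v u"
  by (simp add: actp_def)

lemma actp_wd: "actp (wd w) v = actw w v"
  by (simp add: wd_def actp_single fun_eq_iff)

lemma actp_add: "actp (p + q) v u = actp p v u + actp q v u"
  unfolding actp_def
  by (rule setsum_keys_plus_distrib) (simp_all add: cst_add distrib_right)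

lemma actp_mult: "actp (p * q) v = actp p (actp q v)"
proof (induction p rule: poly_mapping_induct)
  case (single w c)
  show ?case
  proof (induction q rule: poly_mapping_induct)
    case zero
    have "actp 0 v = (\<lambda>_. 0)" by (simp add: actp_zero fun_eq_iff)
    then show ?case by (simp add: actp_zero actp_single actw_zero fun_eq_iff)
  next
    case (single w' c')
    have "actp (single w' c') v = (\<lambda>u. cst c' * actw (letters w') v u)"
      by (simp add: fun_eq_iff actp_single)
    then show ?case
      by (simp add: fun_eq_iff mult_single actp_single plus_gword_def actw_append cst_mult actw_cst mult.assoc)
  next
    case (add p q)
    have "actp (p + q) v = (\<lambda>u. actp p v u + actp q v u)" by (simp add: fun_eq_iff actp_add)
    then show ?case using add by (simp add: fun_eq_iff distrib_left actp_add actp_single actw_add)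
  qed
qed (simp_all add: fun_eq_iff actp_zero actp_add distrib_right)

lemma actp_sc: "actp (sc c * p) v u = cst c * actp p v u"
  by (simp add: actp_mult sc_def actp_single zero_gword_def)

lemma actp_uminus: "actp (- p) v u = - actp p v u"
  using actp_sc[of "-1" p v u] by (simp add: sc_uminus cst_uminus)

lemma actp_diff: "actp (p - q) v u = actp p v u - actp q v u"
  using actp_add[of p "- q" v u] by (simp add: actp_uminus)

lemma actp_sum: "actp (\<Sum>a\<in>A. F a) v u = (\<Sum>a\<in>A. actp (F a) v u)"
  by (induction A rule: infinite_finite_induct) (simp_all add: actp_zero actp_add)

lemma actp_zero_right: "actp p (\<lambda>_. 0) u = 0"
  by (simp add: actp_def actw_zero)

lemma actp_add_right: "actp p (\<lambda>u. v u + w u) u = actp p v u + actp p w u"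
  by (simp add: actp_def actw_add distrib_left sum.distrib)

lemma actp_cst_right: "actp p (\<lambda>u. cst c * v u) u = cst c * actp p v u"
  by (simp add: actp_def actw_cst sum_distrib_left ac_simps)

text \<open>Functions have to vanish outside the permutations because the idempotents of
  \<open>Ib\<close> are guaranteed to sum to 1 only on permutations.\<close>

definition Vs :: "((nat \<Rightarrow> nat) \<Rightarrow> 'k mpl) set" where
  "Vs = {v. (\<forall>u. \<not> u permutes {..<n} \<longrightarrow> v u = 0) \<and> (\<forall>u. v u \<in> pol n)}"

lemma act_Vs:
  assumes "v \<in> Vs" "g \<in> G"
  shows "act g v \<in> Vs"
proof -
  have v: "v u = 0" if "\<not> u permutes {..<n}" for u using that assms(1) by (simp add: Vs_def)
  have vp: "v u \<in> pol n" for u using assms(1) by (simp add: Vs_def)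
  consider nu where "g = E nu" | p where "g = X p" "p < n" | a where "g = T a" "Suc a < n"
    using assms(2) by (auto simp: QH_gens_def)
  then show ?thesis
  proof cases
    case 1
    then show ?thesis by (auto simp: Vs_def Eop_def v vp pol_zero)
  next
    case 2
    have "Xop p v u \<in> pol n" for u
    proof (cases "u permutes {..<n}")
      case True
      then show ?thesis unfolding Xop_def
        by (intro pol_mult pol_xv theta_pol vp permutes_less[OF _ 2(2)])
    qed (simp add: Xop_def v pol_zero)
    then show ?thesis using 2 by (auto simp: Vs_def Xop_def v)
  next
    case 3
    have "Top a v u \<in> pol n" for u
    proof (cases "u \<circ> sref a permutes {..<n}")
      case True
      then show ?thesis unfolding Top_def
        by (intro pol_mult Tco_pol theta_pol vp 3)
    qed (simp add: Top_def v pol_zero)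
    then show ?thesis using 3 by (auto simp: Vs_def Top_def v permutes_comp_sref_iff)
  qed
qed

lemma actw_Vs: "v \<in> Vs \<Longrightarrow> set w \<subseteq> G \<Longrightarrow> actw w v \<in> Vs"
  by (induction w) (auto intro: act_Vs)

lemma actp_Vs:
  assumes "v \<in> Vs" "p \<in> galg G"
  shows "actp p v \<in> Vs"
proof -
  have "actw (letters w) v \<in> Vs" if "w \<in> keys p" for w
    using assms that by (intro actw_Vs) (auto simp: galg_def)
  then show ?thesis unfolding Vs_def actp_def by (auto intro!: sum.neutral pol_sum pol_mult pol_cst)
qed

lemma Ib_iff: "nu \<in> Ib \<longleftrightarrow> (\<exists>u. u permutes {..<n} \<and> nu = permute_list u mu)"
  by (auto simp: Ib_def)

lemma permute_list_nth': "u permutes {..<n} \<Longrightarrow> p < n \<Longrightarrow> permute_list u mu ! p = mu ! u p"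
  using permute_list_nth len by blast

text \<open>Distinct entries let the final sequence determine the permutation, so a corner
  corresponds to a single component of the model.\<close>

lemma permute_list_inj:
  assumes "u permutes {..<n}" "x permutes {..<n}" "permute_list u mu = permute_list x mu"
  shows "u = x"
proof
  fix p
  show "u p = x p"
  proof (cases "p < n")
    case True
    then have "mu ! u p = mu ! x p" using assms permute_list_nth' by metis
    then show ?thesis using dist len permutes_less assms True by (metis nth_eq_iff_index_eq)
  qed (use assms in \<open>simp add: permutes_def\<close>)
qed

lemma finite_Ib: "finite Ib"
proof -
  have "Ib = (\<lambda>u. permute_list u mu) ` {u. u permutes {..<n}}" by (auto simp: Ib_def)
  then show ?thesis by (simp add: finite_permutations)
qed

lemma perm_act_sref: "Suc a < length nu \<Longrightarrow> perm_act (sref a) nu = permute_list (sref a) nu"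
proof -
  have "inv (sref a) = sref a" by (metis inv_unique_comp sref_comp_sref)
  then show ?thesis by (simp add: perm_act_def permute_list_def)
qed

lemma permute_list_comp_sref: "Suc a < n \<Longrightarrow>
  permute_list (x \<circ> sref a) mu = perm_act (sref a) (permute_list x mu)"
  using permute_list_compose[of "sref a" mu x] sref_permutes[of a n] perm_act_sref[of a "permute_list x mu"] len by simp

lemma perm_act_sref_Ib: "Suc a < n \<Longrightarrow> nu \<in> Ib \<Longrightarrow> perm_act (sref a) nu \<in> Ib"
  by (auto simp: Ib_iff simp flip: permute_list_comp_sref intro: permutes_comp_sref)

lemma perm_act_sref_twice: "Suc a < n \<Longrightarrow> nu \<in> Ib \<Longrightarrow> perm_act (sref a) (perm_act (sref a) nu) = nu"
  by (auto simp: Ib_iff simp flip: permute_list_comp_sref)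

lemma Eop_cases:
  assumes "v \<in> Vs"
  obtains "Eop nu v x = 0"
  | "x permutes {..<n}" "nu = permute_list x mu" "Eop nu v x = v x"
  using assms by (cases "x permutes {..<n} \<and> permute_list x mu = nu") (auto simp: Eop_def Vs_def)

text \<open>The twist by \<open>before_odd\<close> never touches the variable of its own strand. The
  twists of r dots therefore compose and, being involutions, leave only the parity of r.\<close>

lemma actw_xmon: "actw (xmon p r) v u
  = xv (u p) ^ r * (if odd r then theta (before_odd (u p)) (v u) else v u)"
proof (induction r)
  case (Suc r)
  have "theta (before_odd (u p)) (xv (u p)) = (xv (u p) :: 'k mpl)"
    by (simp add: theta_xv before_odd_def)
  then have "theta (before_odd (u p)) (xv (u p) ^ r) = (xv (u p) ^ r :: 'k mpl)"
    by (induction r) (simp_all add: theta_mult)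
  then show ?case using Suc by (simp add: xmon_def Xop_def theta_mult)
qed (simp add: xmon_def)

text \<open>Odd dots occur in Q with even exponents only, so their twists cancel and plain
  multiplication remains.\<close>

lemma qpoly_act:
  assumes x: "x permutes {..<n}" and a: "Suc a < n" and nu: "nu = permute_list x mu"
  shows "actp (qpoly t (nu ! a) (nu ! Suc a) a (Suc a)) v x = qp (x a) (x (Suc a)) * v x"
proof -
  have a': "a < n" using a by simp
  have nth: "nu ! a = mu ! x a" "nu ! Suc a = mu ! x (Suc a)"
    using permute_list_nth'[OF x] a a' nu by auto
  have lt: "x a < n" "x (Suc a) < n" using permutes_less[OF x] a a' by auto
  have *: "actw (xmon a r @ xmon (Suc a) s) v x = mon (single (x a) r + single (x (Suc a)) s) * v x"
    if "t (nu ! a) (nu ! Suc a) (r, s) \<noteq> 0" for r s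
  proof -
    have "\<not> par (x a) \<or> even r" "\<not> par (x (Suc a)) \<or> even s"
      using that teven[OF lt, of r s] teven2[OF lt, of s r] by (auto simp: nth par_def)
    then show ?thesis
      by (auto simp: actw_append actw_xmon before_odd_def mon_add xv_power mult.assoc)
  qed
  show ?thesis
    unfolding qpoly_def actp_sum qp_def sum_distrib_right
    by (rule sum.cong) (auto simp: nth[symmetric] actp_sc actp_wd * mult.assoc)
qed

lemma par_iff:
  assumes "x permutes {..<n}" "nu = permute_list x mu" "p < n"
  shows "par (x p) \<longleftrightarrow> nu ! p \<in> Iodd"
  using assms permute_list_nth'[OF assms(1,3)] permutes_less[OF assms(1,3)] by (auto simp: par_def)

lemma act_rel:
  assumes "r \<in> qh_rels Iodd t n Ib" "v \<in> Vs"
  shows "actp r v u = 0"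
  using assms(1)
proof cases
  case (idem lam nu)
  then show ?thesis by (simp add: actp_diff actp_wd actp_zero Eop_def)
next
  case unit
  have "(\<Sum>nu\<in>Ib. Eop nu v u) = v u"
  proof (cases "u permutes {..<n}")
    case True
    then have "permute_list u mu \<in> Ib" by (auto simp: Ib_iff)
    then show ?thesis by (simp add: Eop_def finite_Ib)
  next
    case False
    then have "v u = 0" using assms(2) by (simp add: Vs_def)
    then show ?thesis by (auto simp: Eop_def intro: sum.neutral)
  qed
  then show ?thesis unfolding unit by (simp add: actp_diff actp_sum actp_wd del: wd_Nil)
next
  case (XX p q nu)
  show ?thesis
    by (rule Eop_cases[OF assms(2), of nu u])
      (use XX Xop_Xop[of u p q "Eop nu v"] permute_list_nth' permutes_less in
        \<open>auto simp: actp_diff actp_sc actp_wd Xop_def par_def\<close>)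
next
  case (XE p nu)
  then show ?thesis by (simp add: actp_diff actp_wd Xop_def Eop_def)
next
  case (TE a nu)
  have "permute_list u mu = perm_act (sref a) nu \<longleftrightarrow> permute_list (u \<circ> sref a) mu = nu"
    if "u permutes {..<n}"
  proof -
    have "permute_list u mu \<in> Ib" using that by (auto simp: Ib_iff)
    then show ?thesis using perm_act_sref_twice TE by (metis permute_list_comp_sref)
  qed
  moreover have "v (u \<circ> sref a) = 0" if "\<not> u permutes {..<n}"
    using that assms(2) TE by (simp add: Vs_def permutes_comp_sref_iff)
  ultimately show ?thesis using TE by (cases "u permutes {..<n}") (auto simp: actp_diff actp_wd Top_def Eop_def)
next
  case (TX a p nu)
  then have p: "sref a p = p" by (simp add: sref_other)
  show ?thesis
  proof (rule Eop_cases[OF assms(2), of nu "u \<circ> sref a"])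
    assume x: "u \<circ> sref a permutes {..<n}" "nu = permute_list (u \<circ> sref a) mu"
    have "a < n" using TX(2) by simp
    note par = par_iff[OF x TX(3)] par_iff[OF x this] par_iff[OF x TX(2)]
    show ?thesis
      using Top_Xop[OF x(1) TX(2,3), of "Eop nu v"] unfolding par TX(1) p
      by (simp add: actp_diff actp_sc actp_wd)
  qed (use TX in \<open>auto simp: actp_diff actp_sc actp_wd Xop_def Top_def p\<close>)
next
  case (TX1 a nu)
  show ?thesis
  proof (rule Eop_cases[OF assms(2), of nu "u \<circ> sref a"])
    assume x: "u \<circ> sref a permutes {..<n}" "nu = permute_list (u \<circ> sref a) mu"
    have "a < n" using TX1(2) by simp
    note par = par_iff[OF x this] par_iff[OF x TX1(2)]
    have "Top a (Xop (Suc a) (Eop nu v)) u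
        = cst (sg (nu ! a \<in> Iodd \<and> nu ! Suc a \<in> Iodd)) * Xop a (Top a (Eop nu v)) u"
      using Top_Xop[OF x(1) TX1(2,2), of "Eop nu v"] unfolding par by (simp add: conj_ac)
    then show ?thesis unfolding TX1(1) by (simp add: actp_diff actp_sc actp_wd)
  qed (use TX1 in \<open>auto simp: actp_diff actp_sc actp_wd Xop_def Top_def\<close>)
next
  case (TX2 a nu)
  show ?thesis
  proof (rule Eop_cases[OF assms(2), of nu "u \<circ> sref a"])
    assume x: "u \<circ> sref a permutes {..<n}" "nu = permute_list (u \<circ> sref a) mu"
    let ?s = "sg (nu ! a \<in> Iodd \<and> nu ! Suc a \<in> Iodd) :: 'k"
    have "a < n" using TX2(2) by simp
    note par = par_iff[OF x this] par_iff[OF x TX2(2)]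
    have "Top a (Xop a (Eop nu v)) u = cst ?s * Xop (Suc a) (Top a (Eop nu v)) u"
      using Top_Xop[OF x(1), of a a "Eop nu v"] TX2 unfolding par by simp
    moreover have "cst ?s * (cst ?s * z) = z" for z :: "'k mpl" by (simp add: sg_def cst_uminus)
    ultimately show ?thesis unfolding TX2 by (simp add: actp_diff actp_sc actp_wd)
  qed (use TX2 in \<open>auto simp: actp_diff actp_sc actp_wd Xop_def Top_def\<close>)
next
  case (TT a nu)
  show ?thesis
  proof (rule Eop_cases[OF assms(2), of nu u])
    assume x: "u permutes {..<n}" "nu = permute_list u mu" "Eop nu v u = v u"
    show ?thesis unfolding TT
      using qpoly_act[OF x(1) TT(2) x(2), of "Eop nu v"] Top_square[OF x(1) TT(2), of "Eop nu v"]
      by (simp add: actp_diff actp_wd actp_mult)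
  next
    assume 0: "Eop nu v u = 0"
    have "actp (qpoly t (nu ! a) (nu ! Suc a) a (Suc a)) (Eop nu v) u = 0"
      unfolding qpoly_def actp_sum
      by (rule sum.neutral) (auto simp: actp_sc actp_wd actw_append actw_xmon 0)
    then show ?thesis unfolding TT by (simp add: actp_diff actp_wd actp_mult Top_def 0)
  qed
next
  case (TTd a b nu)
  \<comment> \<open>The relation is tested at the final order \<open>u\<close>; undoing both
    crossings gives the order at which it starts.\<close>
  let ?x = "u \<circ> sref a \<circ> sref b"
  have "sref b \<circ> sref a = sref a \<circ> sref b"
    using TTd(4) by (auto simp: fun_eq_iff sref_def transpose_def)
  then have comm: "u \<circ> sref b \<circ> sref a = ?x" by (metis comp_assoc)
  show ?thesis
  proof (rule Eop_cases[OF assms(2), of nu ?x])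
    assume x: "?x permutes {..<n}" "nu = permute_list ?x mu"
    note par = par_iff[OF x]
    have u: "?x \<circ> sref b \<circ> sref a = u" by simp
    show ?thesis unfolding TTd
      using Top_distant[OF x(1) TTd(2,3,4), of "Eop nu v"] TTd(2,3) unfolding u
      by (simp add: actp_diff actp_sc actp_wd par del: comp_apply)
  next
    assume "Eop nu v ?x = 0"
    then show ?thesis unfolding TTd by (simp add: actp_diff actp_sc actp_wd Top_def comm)
  qed
next
  case (braid a nu)
  let ?x = "u \<circ> sref a \<circ> sref (Suc a) \<circ> sref a"
  \<comment> \<open>Both sides of the braid relation start from the same order.\<close>
  have br: "?x = u \<circ> sref (Suc a) \<circ> sref a \<circ> sref (Suc a)"
    by (auto simp: sref_def transpose_def fun_eq_iff)
  have u: "?x \<circ> sref a \<circ> sref (Suc a) \<circ> sref a = u" by simp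
  show ?thesis
  proof (rule Eop_cases[OF assms(2), of nu ?x])
    assume x: "?x permutes {..<n}"
    show ?thesis unfolding braid
      using Top_braid[OF x, of a "Eop nu v"] braid(2) unfolding u by (simp add: actp_diff actp_wd)
  next
    assume 0: "Eop nu v ?x = 0"
    then have "Eop nu v (u \<circ> sref (Suc a) \<circ> sref a \<circ> sref (Suc a)) = 0" by (simp only: br)
    with 0 show ?thesis unfolding braid by (simp add: actp_diff actp_wd Top_def)
  qed
qed

lemma act_J0:
  assumes "y \<in> J0" "v \<in> Vs"
  shows "actp y v u = 0"
  using assms(1) unfolding J0_def
proof (induction rule: ideal_gen.induct)
  case (step f r w w' c)
  have "actp (wd w * r * wd w') v u = 0"
  proof -
    have "actw w' v \<in> Vs" using step actw_Vs assms(2) by blast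
    then have "actp r (actw w' v) = (\<lambda>_. 0)" using act_rel step by (simp add: fun_eq_iff)
    then show ?thesis by (simp add: actp_mult actp_wd actw_zero)
  qed
  then show ?case using step by (simp add: actp_add actp_sc)
qed (rule actp_zero)

end

section \<open>Spanning by normal words and faithfulness\<close>

context column
begin

text \<open>Equality in the algebra before the cyclotomic relation is imposed.\<close>

definition eqv :: "('i, 'k) falg \<Rightarrow> ('i, 'k) falg \<Rightarrow> bool" (infix "\<approx>" 50) where
  "p \<approx> q \<longleftrightarrow> p - q \<in> J0"

lemma eqv_refl: "p \<approx> p"
  by (simp add: eqv_def J0_def ideal_gen.zero)

lemma eqv_sym: "p \<approx> q \<Longrightarrow> q \<approx> p"
  unfolding eqv_def J0_def using ideal_gen_uminus by fastforce

lemma eqv_trans [trans]: "p \<approx> q \<Longrightarrow> q \<approx> r \<Longrightarrow> p \<approx> r"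
  unfolding eqv_def J0_def using ideal_gen_add by fastforce

lemma eqv_add: "p \<approx> q \<Longrightarrow> p' \<approx> q' \<Longrightarrow> p + p' \<approx> q + q'"
  unfolding eqv_def J0_def using ideal_gen_add[of "p - q" _ _ "p' - q'"] by (simp add: algebra_simps)

lemma eqv_sc: "p \<approx> q \<Longrightarrow> sc c * p \<approx> sc c * q"
  unfolding eqv_def J0_def using ideal_gen_sc[of "p - q"] by (simp add: right_diff_distrib)

lemma eqv_left: "p \<approx> q \<Longrightarrow> x \<in> galg G \<Longrightarrow> x * p \<approx> x * q"
  unfolding eqv_def J0_def using ideal_gen_mult_left[of x G "p - q"] by (simp add: right_diff_distrib)

lemma eqv_right: "p \<approx> q \<Longrightarrow> x \<in> galg G \<Longrightarrow> p * x \<approx> q * x"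
  unfolding eqv_def J0_def using ideal_gen_mult_right[of x G "p - q"] by (simp add: left_diff_distrib)

lemma eqv_sum: "(\<And>a. a \<in> A \<Longrightarrow> F a \<approx> H a) \<Longrightarrow> sum F A \<approx> sum H A"
  by (induction A rule: infinite_finite_induct) (auto simp: eqv_refl intro: eqv_add)

lemma eqv_0_iff: "p \<approx> 0 \<longleftrightarrow> p \<in> J0"
  by (simp add: eqv_def)

lemma eqv_actp: "p \<approx> q \<Longrightarrow> v \<in> Vs \<Longrightarrow> actp p v u = actp q v u"
  using act_J0[of "p - q" v u] by (simp add: eqv_def actp_diff)

lemma eqv_rel: "p - q \<in> qh_rels Iodd t n Ib \<Longrightarrow> p \<approx> q"
  unfolding eqv_def J0_def by (rule ideal_gen_base)

lemma gens: "nu \<in> Ib \<Longrightarrow> E nu \<in> G" "p < n \<Longrightarrow> X p \<in> G" "Suc a < n \<Longrightarrow> T a \<in> G"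
  by (auto simp: QH_gens_def)

lemma wdE: "nu \<in> Ib \<Longrightarrow> wd [E nu] \<in> galg G" and wdX: "p < n \<Longrightarrow> wd [X p] \<in> galg G"
  and wdT: "Suc a < n \<Longrightarrow> wd [T a] \<in> galg G"
  by (auto intro!: galg_wd gens)

lemma sc_left_commute: "x * (sc c * y) = sc c * (x * y)"
  by (metis mult.assoc sc_commute)

lemma wd_sc_commute: "wd w * (sc c * y) = sc c * (wd w * y)"
  by (rule sc_left_commute)

lemma sc_sg_cancel: "sc (sg b) * (sc (sg b) * x) = x"
  by (simp add: sg_def sc_uminus)

lemma eqv_sg_swap: "p \<approx> sc (sg b) * q \<Longrightarrow> q \<approx> sc (sg b) * p"
  using eqv_sc[of p "sc (sg b) * q" "sg b"] by (auto simp: sc_sg_cancel intro: eqv_sym)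

lemma E_decomp: "y \<in> galg G \<Longrightarrow> y \<approx> (\<Sum>nu\<in>Ib. wd [E nu] * y)"
  using eqv_right[OF eqv_rel[OF qh_rels.unit], of y] by (simp add: sum_distrib_right eqv_sym)

text \<open>Relations hold in front of a single idempotent, with signs or polynomials depending on
  it. Inserting the sum of all idempotents makes them applicable to any \<open>y\<close>, at the
  price of a different factor on each component.\<close>

lemma E_transport:
  assumes "\<And>nu. nu \<in> Ib \<Longrightarrow> A * wd [E nu] \<approx> B * (f nu * wd [E nu])"
    and "A \<in> galg G" "y \<in> galg G"
  shows "A * y \<approx> B * (\<Sum>nu\<in>Ib. f nu * (wd [E nu] * y))"
proof -
  have "A * y \<approx> A * (\<Sum>nu\<in>Ib. wd [E nu] * y)" by (intro eqv_left E_decomp assms)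
  also have "\<dots> = (\<Sum>nu\<in>Ib. A * wd [E nu] * y)" by (simp add: sum_distrib_left mult.assoc)
  also have "\<dots> \<approx> (\<Sum>nu\<in>Ib. B * (f nu * wd [E nu]) * y)"
    by (intro eqv_sum eqv_right assms)
  also have "\<dots> = B * (\<Sum>nu\<in>Ib. f nu * (wd [E nu] * y))" by (simp add: sum_distrib_left mult.assoc)
  finally show ?thesis .
qed

text \<open>Subspaces closed under congruence, idempotents and dots, with no condition on crossings.
  The signs and polynomials that the relations produce are absorbed by such a subspace.\<close>

definition subm :: "('i, 'k) falg set \<Rightarrow> bool" where
  "subm S \<longleftrightarrow> S \<subseteq> galg G \<and> 0 \<in> S \<and> (\<forall>x\<in>S. \<forall>y\<in>S. x + y \<in> S) \<and> (\<forall>c. \<forall>x\<in>S. sc c * x \<in> S)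
    \<and> (\<forall>x\<in>galg G. \<forall>y\<in>S. x \<approx> y \<longrightarrow> x \<in> S) \<and> (\<forall>nu\<in>Ib. \<forall>x\<in>S. wd [E nu] * x \<in> S)
    \<and> (\<forall>p<n. \<forall>x\<in>S. wd [X p] * x \<in> S)"

lemma subm_galg: "subm S \<Longrightarrow> x \<in> S \<Longrightarrow> x \<in> galg G"
  and subm_zero: "subm S \<Longrightarrow> 0 \<in> S"
  and subm_add: "subm S \<Longrightarrow> x \<in> S \<Longrightarrow> y \<in> S \<Longrightarrow> x + y \<in> S"
  and subm_sc: "subm S \<Longrightarrow> x \<in> S \<Longrightarrow> sc c * x \<in> S"
  and subm_eqv: "subm S \<Longrightarrow> x \<in> galg G \<Longrightarrow> y \<in> S \<Longrightarrow> x \<approx> y \<Longrightarrow> x \<in> S"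
  and subm_E: "subm S \<Longrightarrow> nu \<in> Ib \<Longrightarrow> x \<in> S \<Longrightarrow> wd [E nu] * x \<in> S"
  and subm_X: "subm S \<Longrightarrow> p < n \<Longrightarrow> x \<in> S \<Longrightarrow> wd [X p] * x \<in> S"
  unfolding subm_def by blast+

lemma subm_sum: "subm S \<Longrightarrow> (\<And>a. a \<in> A \<Longrightarrow> F a \<in> S) \<Longrightarrow> sum F A \<in> S"
  by (induction A rule: infinite_finite_induct) (auto intro: subm_zero subm_add)

lemma subm_xmon: "subm S \<Longrightarrow> p < n \<Longrightarrow> x \<in> S \<Longrightarrow> wd (xmon p r) * x \<in> S"
proof (induction r)
  case (Suc r)
  then show ?case using subm_X[of S p "wd (xmon p r) * x"]
    by (simp add: xmon_def wd_Cons[of _ "replicate r _"] mult.assoc)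
qed (simp add: xmon_def)

lemma subm_twist:
  assumes "subm S" "y \<in> S" "\<And>nu z. nu \<in> Ib \<Longrightarrow> z \<in> S \<Longrightarrow> f nu * z \<in> S"
  shows "(\<Sum>nu\<in>Ib. f nu * (wd [E nu] * y)) \<in> S"
  by (intro subm_sum assms subm_E)

text \<open>Again stable under dots and idempotents, because with distinct entries a dot slides
  through a crossing at the cost of a sign only.\<close>

definition tset :: "nat \<Rightarrow> ('i, 'k) falg set \<Rightarrow> ('i, 'k) falg set" where
  "tset a S = {z \<in> galg G. \<exists>y\<in>S. z \<approx> wd [T a] * y}"

lemma tsetI: "subm S \<Longrightarrow> Suc a < n \<Longrightarrow> y \<in> S \<Longrightarrow> wd [T a] * y \<in> tset a S"
  unfolding tset_def using galg_mult[OF wdT[of a] subm_galg[of S y]] eqv_refl by auto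

lemma tset_mono: "S \<subseteq> S' \<Longrightarrow> tset a S \<subseteq> tset a S'"
  by (auto simp: tset_def)

lemma ET: "Suc a < n \<Longrightarrow> nu \<in> Ib \<Longrightarrow> wd [E nu] * wd [T a] \<approx> wd [T a] * wd [E (perm_act (sref a) nu)]"
  using eqv_rel[OF qh_rels.TE[of a n "perm_act (sref a) nu" Ib]]
  by (simp add: perm_act_sref_twice perm_act_sref_Ib eqv_sym flip: wd_append)

lemma XT:
  assumes "Suc a < n" "p < n" "nu \<in> Ib"
  shows "\<exists>b. wd [X p] * wd [T a] * wd [E nu] \<approx> wd [T a] * (sc (sg b) * wd [X (sref a p)] * wd [E nu])"
proof -
  consider "p = a" | "p = Suc a" | "p \<noteq> a" "p \<noteq> Suc a" by blast
  then show ?thesis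
  proof cases
    case 1
    show ?thesis using eqv_sg_swap[OF eqv_rel[OF qh_rels.TX1[OF assms(1,3)]]]
      by (auto simp: 1 wd_sc_commute mult.assoc simp flip: wd_append)
  next
    case 2
    show ?thesis using eqv_rel[OF qh_rels.TX2[OF assms(1,3)]]
      by (auto simp: 2 wd_sc_commute mult.assoc simp flip: wd_append)
  next
    case 3
    show ?thesis using eqv_sg_swap[OF eqv_rel[OF qh_rels.TX[OF assms(1,2) 3 assms(3)]]]
      by (auto simp: sref_other[OF 3] wd_sc_commute mult.assoc simp flip: wd_append)
  qed
qed

lemma tset_subm:
  assumes S: "subm S" and a: "Suc a < n"
  shows "subm (tset a S)"
  unfolding subm_def
proof (intro conjI ballI allI impI)
  show "tset a S \<subseteq> galg G" by (auto simp: tset_def)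
  show "0 \<in> tset a S"
    unfolding tset_def using S by (auto intro!: bexI[of _ 0] simp: galg_zero eqv_refl subm_zero)
next
  fix x y assume "x \<in> tset a S" "y \<in> tset a S"
  then obtain x' y' where "x' \<in> S" "x \<approx> wd [T a] * x'" "y' \<in> S" "y \<approx> wd [T a] * y'"
    "x \<in> galg G" "y \<in> galg G" by (auto simp: tset_def)
  then show "x + y \<in> tset a S" unfolding tset_def using S eqv_add[of x "wd [T a] * x'" y "wd [T a] * y'"]
    by (auto intro!: bexI[of _ "x' + y'"] galg_add subm_add simp: distrib_left)
next
  fix c x assume "x \<in> tset a S"
  then obtain x' where "x' \<in> S" "x \<approx> wd [T a] * x'" "x \<in> galg G" by (auto simp: tset_def)
  then show "sc c * x \<in> tset a S" unfolding tset_def using S eqv_sc[of x "wd [T a] * x'" c]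
    by (auto intro!: bexI[of _ "sc c * x'"] galg_sc_mult subm_sc simp: wd_sc_commute)
next
  fix x y assume "x \<in> galg G" "y \<in> tset a S" "x \<approx> y"
  then show "x \<in> tset a S" unfolding tset_def by (auto intro: eqv_trans)
next
  fix nu x assume nu: "nu \<in> Ib" and x: "x \<in> tset a S"
  then obtain x' where x': "x' \<in> S" "x \<approx> wd [T a] * x'" "x \<in> galg G" by (auto simp: tset_def)
  have "wd [E nu] * x \<approx> wd [E nu] * (wd [T a] * x')" by (intro eqv_left x' wdE nu)
  also have "\<dots> = wd [E nu] * wd [T a] * x'" by (simp add: mult.assoc)
  also have "\<dots> \<approx> wd [T a] * wd [E (perm_act (sref a) nu)] * x'"
    by (intro eqv_right ET a nu subm_galg[OF S] x')
  finally show "wd [E nu] * x \<in> tset a S" unfolding tset_def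
    using subm_E[OF S perm_act_sref_Ib[OF a nu] x'(1)] x'(3)
    by (auto intro!: bexI[of _ "wd [E (perm_act (sref a) nu)] * x'"] galg_mult wdE nu simp: mult.assoc)
next
  fix p x assume p: "p < n" and x: "x \<in> tset a S"
  then obtain x' where x': "x' \<in> S" "x \<approx> wd [T a] * x'" "x \<in> galg G" by (auto simp: tset_def)
  have p': "sref a p < n" using p sref_permutes[OF a] permutes_less by blast
  obtain b where b: "\<And>nu. nu \<in> Ib \<Longrightarrow>
      wd [X p] * wd [T a] * wd [E nu] \<approx> wd [T a] * (sc (sg (b nu)) * wd [X (sref a p)] * wd [E nu])"
    using XT[OF a p] by metis
  define y where "y = (\<Sum>nu\<in>Ib. sc (sg (b nu)) * wd [X (sref a p)] * (wd [E nu] * x'))"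
  have y: "y \<in> S" unfolding y_def
    by (intro subm_twist[OF S] x') (auto simp: mult.assoc intro!: subm_sc[OF S] subm_X[OF S] p')
  have "wd [X p] * x \<approx> wd [X p] * (wd [T a] * x')" by (intro eqv_left x' wdX p)
  also have "\<dots> = wd [X p] * wd [T a] * x'" by (simp add: mult.assoc)
  also have "\<dots> \<approx> wd [T a] * y" unfolding y_def
    by (intro E_transport b galg_mult wdX wdT a p subm_galg[OF S] x')
  finally show "wd [X p] * x \<in> tset a S" unfolding tset_def using y x'(3)
    by (auto intro!: galg_mult wdX p)
qed

text \<open>Up to subspaces distant crossings commute outright: the sign depends on the idempotent
  and disappears into \<open>S\<close>.\<close>

lemma tset_comm:
  assumes S: "subm S" and ab: "Suc a < n" "Suc b < n" "a + 1 < b \<or> b + 1 < a" and z: "z \<in> tset b S"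
  shows "wd [T a] * z \<in> tset b (tset a S)"
proof -
  obtain x where x: "x \<in> S" "z \<approx> wd [T b] * x" "z \<in> galg G" using z by (auto simp: tset_def)
  define s where "s nu = (sg (nu ! a \<in> Iodd \<and> nu ! Suc a \<in> Iodd \<and> nu ! b \<in> Iodd \<and> nu ! Suc b \<in> Iodd) :: 'k)" for nu
  define y where "y = (\<Sum>nu\<in>Ib. sc (s nu) * (wd [E nu] * x))"
  have y: "y \<in> S" unfolding y_def by (intro subm_twist[OF S] x subm_sc[OF S])
  have "wd [T a] * z \<approx> wd [T a] * (wd [T b] * x)" by (intro eqv_left x wdT ab)
  also have "\<dots> = wd [T a] * wd [T b] * x" by (simp add: mult.assoc)
  also have "\<dots> \<approx> wd [T b] * wd [T a] * y"
    unfolding y_def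
  proof (rule E_transport)
    fix nu assume "nu \<in> Ib"
    from eqv_rel[OF qh_rels.TTd[OF ab this]]
    show "wd [T a] * wd [T b] * wd [E nu] \<approx> wd [T b] * wd [T a] * (sc (s nu) * wd [E nu])"
      by (simp add: s_def wd_sc_commute mult.assoc flip: wd_append)
  qed (use subm_galg[OF S x(1)] in \<open>auto intro!: galg_mult wdT ab\<close>)
  finally show ?thesis
    using tsetI[OF S ab(1) y] x(3) ab
    by (auto simp: tset_def[of b] mult.assoc intro!: galg_mult wdT)
qed

text \<open>In front of each idempotent the square of a crossing is a polynomial in the dots, and
  \<open>S\<close> is closed under dots.\<close>

lemma tset_square:
  assumes S: "subm S" and a: "Suc a < n" and z: "z \<in> tset a S"
  shows "wd [T a] * z \<in> S"
proof -
  obtain x where x: "x \<in> S" "z \<approx> wd [T a] * x" "z \<in> galg G" using z by (auto simp: tset_def)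
  define f where "f nu = qpoly t (nu ! a) (nu ! Suc a) a (Suc a)" for nu
  define y where "y = (\<Sum>nu\<in>Ib. f nu * (wd [E nu] * x))"
  have "f nu * z \<in> S" if "z \<in> S" for nu z
    unfolding f_def qpoly_def sum_distrib_right
    using a that by (intro subm_sum[OF S])
      (auto simp: mult.assoc wd_append intro!: subm_sc[OF S] subm_xmon[OF S])
  then have y: "y \<in> S" unfolding y_def by (intro subm_twist[OF S] x)
  have "wd [T a] * z \<approx> wd [T a] * (wd [T a] * x)" by (intro eqv_left x wdT a)
  also have "\<dots> = wd [T a] * wd [T a] * x" by (simp add: mult.assoc)
  also have "\<dots> \<approx> 1 * y" unfolding y_def
  proof (rule E_transport)
    fix nu assume "nu \<in> Ib"
    from eqv_rel[OF qh_rels.TT[OF a this]]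
    show "wd [T a] * wd [T a] * wd [E nu] \<approx> 1 * (f nu * wd [E nu])"
      by (simp add: f_def flip: wd_append)
  qed (use subm_galg[OF S x(1)] in \<open>auto intro!: galg_mult wdT a\<close>)
  finally show ?thesis using subm_eqv[OF S _ y] x a by (auto intro!: galg_mult wdT)
qed

lemma tset_braid:
  assumes S: "subm S" and a: "Suc (Suc a) < n" and z: "z \<in> tset a (tset (Suc a) S)"
  shows "wd [T (Suc a)] * z \<in> tset a (tset (Suc a) (tset a S))"
proof -
  have a': "Suc a < n" using a by simp
  obtain w where w: "w \<in> tset (Suc a) S" "z \<approx> wd [T a] * w" "z \<in> galg G" using z by (auto simp: tset_def)
  then obtain x where x: "x \<in> S" "w \<approx> wd [T (Suc a)] * x" by (auto simp: tset_def)
  define y where "y = (\<Sum>nu\<in>Ib. 1 * (wd [E nu] * x))"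
  have y: "y \<in> S" unfolding y_def by (intro subm_twist[OF S] x) simp
  have "z \<approx> wd [T a] * (wd [T (Suc a)] * x)" by (rule eqv_trans[OF w(2)]) (intro eqv_left x wdT a')
  then have "wd [T (Suc a)] * z \<approx> wd [T (Suc a)] * (wd [T a] * (wd [T (Suc a)] * x))"
    by (intro eqv_left wdT a)
  also have "\<dots> = wd [T (Suc a)] * wd [T a] * wd [T (Suc a)] * x" by (simp add: mult.assoc)
  also have "\<dots> \<approx> wd [T a] * wd [T (Suc a)] * wd [T a] * y" unfolding y_def
  proof (rule E_transport)
    fix nu assume "nu \<in> Ib"
    moreover have "a + 2 < n" using a by simp
    ultimately have "wd [T (Suc a), T a, T (Suc a), E nu] \<approx> wd [T a, T (Suc a), T a, E nu]"
      by (intro eqv_rel qh_rels.braid)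
    then show "wd [T (Suc a)] * wd [T a] * wd [T (Suc a)] * wd [E nu]
        \<approx> wd [T a] * wd [T (Suc a)] * wd [T a] * (1 * wd [E nu])"
      by (simp flip: wd_append)
  qed (use subm_galg[OF S x(1)] in \<open>auto intro!: galg_mult wdT a a'\<close>)
  finally have 1: "wd [T (Suc a)] * z \<approx> wd [T a] * (wd [T (Suc a)] * (wd [T a] * y))"
    by (simp add: mult.assoc)
  have "wd [T (Suc a)] * (wd [T a] * y) \<in> tset (Suc a) (tset a S)"
    by (intro tsetI tset_subm S a a' y)
  with 1 show ?thesis using w(3) a by (auto simp: tset_def[of a "tset (Suc a) _"] intro!: galg_mult wdT)
qed

definition tsets :: "nat list \<Rightarrow> ('i, 'k) falg set \<Rightarrow> ('i, 'k) falg set" where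
  "tsets as S = foldr tset as S"

lemma tsets_simps [simp]: "tsets [] S = S" "tsets (a # as) S = tset a (tsets as S)"
  and tsets_append: "tsets (as @ bs) S = tsets as (tsets bs S)"
  by (simp_all add: tsets_def)

lemma tsets_subm: "subm S \<Longrightarrow> \<forall>a\<in>set as. Suc a < n \<Longrightarrow> subm (tsets as S)"
  by (induction as) (auto intro: tset_subm)

lemma tsets_mono: "S \<subseteq> S' \<Longrightarrow> tsets as S \<subseteq> tsets as S'"
  by (induction as) (auto intro!: tset_mono simp del: tset_def)

lemma tset_subset:
  assumes "subm S'" "\<And>y. y \<in> S \<Longrightarrow> wd [T a] * y \<in> S'"
  shows "tset a S \<subseteq> S'"
  unfolding tset_def using assms subm_eqv by blast

lemma tsets_comm:
  assumes S: "subm S" and a: "Suc a < n"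
  shows "\<forall>b\<in>set bs. Suc b < n \<and> (a + 1 < b \<or> b + 1 < a) \<Longrightarrow> z \<in> tsets bs S \<Longrightarrow>
    wd [T a] * z \<in> tsets bs (tset a S)"
proof (induction bs arbitrary: z)
  case Nil
  then show ?case using tsetI[OF S a] by simp
next
  case (Cons b bs)
  have s: "subm (tsets bs S)" "subm (tsets bs (tset a S))"
    using Cons.prems S a by (auto intro!: tsets_subm tset_subm)
  have "wd [T a] * z \<in> tset b (tset a (tsets bs S))"
    using Cons.prems by (intro tset_comm s a) auto
  moreover have "tset a (tsets bs S) \<subseteq> tsets bs (tset a S)"
    using Cons by (intro tset_subset s) auto
  ultimately show ?case using tset_mono[of "tset a (tsets bs S)" "tsets bs (tset a S)" b] by auto
qed

section \<open>Normally ordered words in the dots\<close>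

definition xword :: "(nat \<Rightarrow> nat) \<Rightarrow> 'i gen list" where
  "xword r = concat (map (\<lambda>k. xmon k (r k)) [0..<n])"

text \<open>Normal ordering: a commutative monomial is written with the dots in increasing position.
  The map is linear but need not be multiplicative.\<close>

definition Xi :: "'k mpl \<Rightarrow> ('i, 'k) falg" where
  "Xi q = (\<Sum>m\<in>keys q. sc (lookup q m) * wd (xword (lookup m) @ [E mu]))"

lemma Xi_add: "Xi (p + q) = Xi p + Xi q"
  unfolding Xi_def by (rule setsum_keys_plus_distrib) (simp_all add: sc_add distrib_right)

lemma Xi_zero: "Xi 0 = 0"
  by (simp add: Xi_def)

lemma Xi_cst_mon: "Xi (cst c * mon m) = sc c * wd (xword (lookup m) @ [E mu])"
  by (simp add: Xi_def flip: single_eq_cst_mon)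

lemma Xi_cst: "Xi (cst c * q) = sc c * Xi q"
proof (induction q rule: poly_mapping_induct)
  case (single m b)
  show ?case by (simp only: single_eq_cst_mon Xi_cst_mon sc_mult mult.assoc flip: cst_mult mult.assoc)
qed (simp_all add: Xi_zero Xi_add distrib_left)

lemma set_xword: "set (xword r) \<subseteq> X ` {..<n}"
  by (auto simp: xword_def xmon_def)

lemma X_image_G: "X ` {..<n} \<subseteq> G"
  by (auto simp: QH_gens_def)

lemma mu_Ib: "mu \<in> Ib"
  unfolding Ib_iff by (intro exI[of _ id] conjI permutes_id) simp

lemma wd_xword: "wd (xword r @ [E mu]) \<in> galg G"
  using set_xword X_image_G gens(1)[OF mu_Ib] by (intro galg_wd) fastforce

lemma Xi_galg: "Xi q \<in> galg G"
  unfolding Xi_def by (intro galg_sum galg_sc_mult wd_xword)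

lemma Xword_E:
  assumes "set w \<subseteq> X ` {..<n}" "nu \<in> Ib"
  shows "wd w * wd [E nu] \<approx> wd [E nu] * wd w"
  using assms(1)
proof (induction w)
  case Nil
  show ?case by (simp add: eqv_refl)
next
  case (Cons g w)
  then obtain p where p: "g = X p" "p < n" by auto
  have "wd (g # w) * wd [E nu] = wd [X p] * (wd w * wd [E nu])" by (simp add: p wd_Cons[of "X p" w] mult.assoc)
  also have "\<dots> \<approx> wd [X p] * (wd [E nu] * wd w)" using Cons p by (intro eqv_left wdX) auto
  also have "\<dots> = wd [X p, E nu] * wd w" by (simp add: wd_Cons[of "X p" "[_]"] mult.assoc)
  also have "\<dots> \<approx> wd [E nu, X p] * wd w"
    using Cons.prems X_image_G by (intro eqv_right eqv_rel qh_rels.XE p assms galg_wd) auto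
  also have "\<dots> = wd [E nu] * wd (g # w)"
    by (simp add: p wd_Cons[of "E nu" "[_]"] wd_Cons[of "X p" w] mult.assoc)
  finally show ?case .
qed

lemma Xword_Emu:
  assumes "set w \<subseteq> X ` {..<n}"
  shows "wd w * wd [E mu] \<approx> wd [E mu] * (wd w * wd [E mu])"
proof -
  have "wd w * wd [E mu] \<approx> wd w * wd [E mu, E mu]"
    using eqv_rel[of "wd [E mu, E mu]" "wd [E mu]"] qh_rels.idem[OF mu_Ib mu_Ib, of Iodd t n] assms X_image_G
    by (intro eqv_left[OF eqv_sym] galg_wd) auto
  also have "\<dots> = (wd w * wd [E mu]) * wd [E mu]" by (simp add: wd_Cons[of "E mu" "[_]"] mult.assoc)
  also have "\<dots> \<approx> (wd [E mu] * wd w) * wd [E mu]"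
    by (intro eqv_right Xword_E assms mu_Ib wdE)
  finally show ?thesis by (simp add: mult.assoc)
qed

lemma XX_swap:
  assumes "set w \<subseteq> X ` {..<n}" "p < n" "q < n" "p \<noteq> q"
  shows "\<exists>c. wd [X p] * (wd [X q] * (wd w * wd [E mu])) \<approx> sc c * (wd [X q] * (wd [X p] * (wd w * wd [E mu])))"
proof -
  let ?z = "wd w * wd [E mu]"
  have z: "?z \<in> galg G" using assms X_image_G by (intro galg_mult galg_wd wdE mu_Ib) auto
  have "wd [X p] * (wd [X q] * ?z) \<approx> wd [X p] * (wd [X q] * (wd [E mu] * ?z))"
    using assms by (intro eqv_left wdX Xword_Emu)
  also have "\<dots> = wd [X p, X q, E mu] * ?z" by (simp add: mult.assoc flip: wd_append)
  also have "\<dots> \<approx> sc (sg (mu ! p \<in> Iodd \<and> mu ! q \<in> Iodd)) * wd [X q, X p, E mu] * ?z"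
    by (intro eqv_right eqv_rel qh_rels.XX z assms mu_Ib)
  also have "\<dots> = sc (sg (mu ! p \<in> Iodd \<and> mu ! q \<in> Iodd)) * (wd [X q] * (wd [X p] * (wd [E mu] * ?z)))"
    by (simp add: wd_Cons[of "X q" "[_,_]"] wd_Cons[of "X p" "[_]"] mult.assoc)
  also have "\<dots> \<approx> sc (sg (mu ! p \<in> Iodd \<and> mu ! q \<in> Iodd)) * (wd [X q] * (wd [X p] * ?z))"
    using assms by (intro eqv_sc eqv_left wdX eqv_sym[OF Xword_Emu])
  finally show ?thesis by blast
qed

lemma XX_swap_power:
  assumes "set w \<subseteq> X ` {..<n}" "p < n" "q < n" "p \<noteq> q"
  shows "\<exists>c. wd [X p] * (wd (xmon q r) * (wd w * wd [E mu])) \<approx> sc c * (wd (xmon q r) * (wd [X p] * (wd w * wd [E mu])))"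
proof (induction r)
  case 0
  show ?case by (auto simp: xmon_def intro!: exI[of _ 1] eqv_refl)
next
  case (Suc r)
  then obtain c where c: "wd [X p] * (wd (xmon q r) * (wd w * wd [E mu]))
    \<approx> sc c * (wd (xmon q r) * (wd [X p] * (wd w * wd [E mu])))" by blast
  have w': "set (xmon q r @ w) \<subseteq> X ` {..<n}" using assms by (auto simp: xmon_def)
  have x: "wd (xmon q (Suc r)) = wd [X q] * wd (xmon q r)"
    by (simp add: xmon_def wd_Cons[of _ "replicate r _"])
  obtain b where b: "wd [X p] * (wd [X q] * (wd (xmon q r @ w) * wd [E mu]))
      \<approx> sc b * (wd [X q] * (wd [X p] * (wd (xmon q r @ w) * wd [E mu])))"
    using XX_swap[OF w' assms(2-)] by blast
  have "wd [X p] * (wd (xmon q (Suc r)) * (wd w * wd [E mu]))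
    = wd [X p] * (wd [X q] * (wd (xmon q r @ w) * wd [E mu]))" by (simp add: x wd_append mult.assoc)
  also have "\<dots> \<approx> sc b * (wd [X q] * (wd [X p] * (wd (xmon q r @ w) * wd [E mu])))" by (rule b)
  also have "\<dots> = sc b * (wd [X q] * (wd [X p] * (wd (xmon q r) * (wd w * wd [E mu]))))"
    by (simp add: wd_append mult.assoc)
  also have "\<dots> \<approx> sc b * (wd [X q] * (sc c * (wd (xmon q r) * (wd [X p] * (wd w * wd [E mu])))))"
    by (intro eqv_sc eqv_left c wdX assms)
  also have "\<dots> = sc (b * c) * (wd (xmon q (Suc r)) * (wd [X p] * (wd w * wd [E mu])))"
    by (simp add: x sc_mult wd_sc_commute mult.assoc)
  finally show ?case by blast
qed

text \<open>The scalar is left unspecified, since spanning only needs x_p to reach its place in the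
  ordered monomial.\<close>

lemma X_insert:
  assumes "distinct ks" "set ks \<subseteq> {..<n}" "p \<in> set ks"
  shows "\<exists>c. wd [X p] * (wd (concat (map (\<lambda>k. xmon k (r k)) ks)) * wd [E mu])
    \<approx> sc c * (wd (concat (map (\<lambda>k. xmon k ((r(p := Suc (r p))) k)) ks)) * wd [E mu])"
  using assms
proof (induction ks)
  case (Cons k ks)
  let ?W = "\<lambda>r ks. concat (map (\<lambda>k. xmon k (r k)) ks) :: 'i gen list"
  have w: "set (?W r ks) \<subseteq> X ` {..<n}" using Cons.prems by (auto simp: xmon_def)
  show ?case
  proof (cases "k = p")
    case True
    then have "p \<notin> set ks" using Cons.prems by auto
    then have "?W (r(p := Suc (r p))) ks = ?W r ks" by (intro arg_cong[of _ _ concat] map_cong) auto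
    then have "wd [X p] * (wd (?W r (k # ks)) * wd [E mu])
        = (wd (?W (r(p := Suc (r p))) (k # ks)) * wd [E mu] :: ('i, 'k) falg)"
      using True by (simp add: xmon_def mult.assoc flip: wd_append)
    then show ?thesis by (intro exI[of _ 1]) (simp add: eqv_refl)
  next
    case False
    then obtain c where c: "wd [X p] * (wd (?W r ks) * wd [E mu])
        \<approx> sc c * (wd (?W (r(p := Suc (r p))) ks) * wd [E mu])" using Cons by auto
    obtain b where b: "wd [X p] * (wd (xmon k (r k)) * (wd (?W r ks) * wd [E mu]))
        \<approx> sc b * (wd (xmon k (r k)) * (wd [X p] * (wd (?W r ks) * wd [E mu])))"
      using XX_swap_power[OF w, of p k "r k"] Cons.prems False by auto
    have "wd [X p] * (wd (?W r (k # ks)) * wd [E mu])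
        = wd [X p] * (wd (xmon k (r k)) * (wd (?W r ks) * wd [E mu]))" by (simp add: wd_append mult.assoc)
    also have "\<dots> \<approx> sc b * (wd (xmon k (r k)) * (wd [X p] * (wd (?W r ks) * wd [E mu])))" by (rule b)
    also have "\<dots> \<approx> sc b * (wd (xmon k (r k)) * (sc c * (wd (?W (r(p := Suc (r p))) ks) * wd [E mu])))"
      using Cons.prems by (intro eqv_sc eqv_left c galg_wd) (auto simp: xmon_def QH_gens_def)
    also have "\<dots> = sc (b * c) * (wd (?W (r(p := Suc (r p))) (k # ks)) * wd [E mu])"
      using False by (simp add: sc_mult wd_sc_commute wd_append mult.assoc)
    finally show ?thesis by blast
  qed
qed simp

lemma X_Xmon:
  assumes "p < n"
  shows "\<exists>c. wd [X p] * wd (xword (lookup m) @ [E mu]) \<approx> sc c * wd (xword (lookup (m + single p 1)) @ [E mu])"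
proof -
  have "lookup (m + single p 1) = (lookup m)(p := Suc (lookup m p))"
    by (auto simp: fun_eq_iff lookup_add lookup_single when_def)
  then show ?thesis using X_insert[of "[0..<n]" p "lookup m"] assms by (auto simp: xword_def wd_append atLeast0LessThan)
qed

section \<open>The span of the normal words, built up along a chain of symmetric groups\<close>

definition Sp0 :: "('i, 'k) falg set" where
  "Sp0 = {y \<in> galg G. \<exists>q\<in>pol n. y \<approx> Xi q}"

lemma Sp0_add: "x \<in> Sp0 \<Longrightarrow> y \<in> Sp0 \<Longrightarrow> x + y \<in> Sp0"
  unfolding Sp0_def
  by (auto intro!: galg_add) (metis Xi_add eqv_add pol_add)

lemma Sp0_sc: "x \<in> Sp0 \<Longrightarrow> sc c * x \<in> Sp0"
  unfolding Sp0_def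
  by (auto intro!: galg_sc_mult) (metis Xi_cst eqv_sc pol_mult pol_cst)

lemma Sp0_eqv: "x \<in> galg G \<Longrightarrow> y \<in> Sp0 \<Longrightarrow> x \<approx> y \<Longrightarrow> x \<in> Sp0"
  unfolding Sp0_def by (auto intro: eqv_trans)

lemma Sp0_zero: "0 \<in> Sp0"
  unfolding Sp0_def by (auto intro!: bexI[of _ 0] simp: galg_zero Xi_zero pol_zero eqv_refl)

lemma Sp0_mon: "keys m \<subseteq> {..<n} \<Longrightarrow> wd (xword (lookup m) @ [E mu]) \<in> Sp0"
  unfolding Sp0_def using Xi_cst_mon[of 1 m] wd_xword
  by (auto intro!: bexI[of _ "mon m"] pol_mon simp: eqv_refl)

lemma Sp0_left:
  assumes g: "g \<in> galg G" and *: "\<And>m. keys m \<subseteq> {..<n} \<Longrightarrow> g * wd (xword (lookup m) @ [E mu]) \<in> Sp0"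
    and y: "y \<in> Sp0"
  shows "g * y \<in> Sp0"
proof -
  obtain q where q: "q \<in> pol n" "y \<approx> Xi q" "y \<in> galg G" using y by (auto simp: Sp0_def)
  have "g * Xi q \<in> Sp0" using q(1)
  proof (induction q rule: pol_induct)
    case (mon m c)
    then show ?case using Sp0_sc[OF *[OF mon]] by (simp add: Xi_cst_mon sc_left_commute[of g])
  qed (auto simp: Xi_zero Xi_add distrib_left Sp0_zero Sp0_add)
  then show ?thesis using Sp0_eqv[of "g * y"] eqv_left[OF q(2) g] galg_mult[OF g q(3)] by blast
qed

lemma Sp0_subm: "subm Sp0"
  unfolding subm_def
proof (intro conjI ballI allI impI)
  fix nu x assume nu: "nu \<in> Ib" and x: "x \<in> Sp0"
  show "wd [E nu] * x \<in> Sp0"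
  proof (rule Sp0_left[OF wdE[OF nu] _ x])
    fix m :: "nat \<Rightarrow>\<^sub>0 nat" assume m: "keys m \<subseteq> {..<n}"
    let ?w = "xword (lookup m)"
    have w: "wd ?w \<in> galg G" using set_xword X_image_G by (intro galg_wd) blast
    have "wd [E nu] * wd (?w @ [E mu]) = (wd [E nu] * wd ?w) * wd [E mu]" by (simp add: wd_append mult.assoc)
    also have "\<dots> \<approx> (wd ?w * wd [E nu]) * wd [E mu]"
      by (intro eqv_right eqv_sym[OF Xword_E] set_xword nu wdE mu_Ib)
    also have "\<dots> = wd ?w * wd [E nu, E mu]" by (simp add: mult.assoc flip: wd_append)
    also have "\<dots> \<approx> wd ?w * (if nu = mu then wd [E mu] else 0)"
      by (intro eqv_left w eqv_rel qh_rels.idem nu mu_Ib)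
    also have "\<dots> = sc (if nu = mu then 1 else 0) * wd (?w @ [E mu])" by (simp add: wd_append)
    finally show "wd [E nu] * wd (?w @ [E mu]) \<in> Sp0"
      by (rule Sp0_eqv[OF galg_mult[OF wdE[OF nu] wd_xword] Sp0_sc[OF Sp0_mon[OF m]]])
  qed
next
  fix p x assume p: "p < n" and x: "x \<in> Sp0"
  show "wd [X p] * x \<in> Sp0"
  proof (rule Sp0_left[OF wdX[OF p] _ x])
    fix m :: "nat \<Rightarrow>\<^sub>0 nat" assume m: "keys m \<subseteq> {..<n}"
    obtain c where c: "wd [X p] * wd (xword (lookup m) @ [E mu])
        \<approx> sc c * wd (xword (lookup (m + single p 1)) @ [E mu])" using X_Xmon[OF p] by blast
    have "wd (xword (lookup (m + single p 1)) @ [E mu]) \<in> Sp0"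
      using m p by (intro Sp0_mon) (auto simp: keys_plus_nat)
    from Sp0_eqv[OF galg_mult[OF wdX[OF p] wd_xword] Sp0_sc[OF this] c]
    show "wd [X p] * wd (xword (lookup m) @ [E mu]) \<in> Sp0" .
  qed
next
  show "Sp0 \<subseteq> galg G" by (auto simp: Sp0_def)
qed (blast intro: Sp0_zero Sp0_add Sp0_sc Sp0_eqv)+

text \<open>\<open>Sp k\<close> uses crossings among the first \<open>k + 1\<close> positions only.
  The recursion follows the coset representatives s_j ... s_k of one symmetric group in the next; j
  = k + 1 is the empty word.\<close>

fun Sp :: "nat \<Rightarrow> ('i, 'k) falg set" where
  "Sp 0 = Sp0"
| "Sp (Suc k) = {y \<in> galg G. \<exists>f. (\<forall>j\<le>Suc k. f j \<in> tsets [j..<Suc k] (Sp k)) \<and> y \<approx> (\<Sum>j\<le>Suc k. f j)}"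

declare Sp.simps(2) [simp del]

lemma Sp_SucI:
  assumes "y \<in> galg G" "\<And>j. j \<le> Suc k \<Longrightarrow> f j \<in> tsets [j..<Suc k] (Sp k)" "y \<approx> (\<Sum>j\<le>Suc k. f j)"
  shows "y \<in> Sp (Suc k)"
  using assms unfolding Sp.simps by blast

lemma Sp_SucE:
  assumes "y \<in> Sp (Suc k)"
  obtains f where "y \<in> galg G" "\<And>j. j \<le> Suc k \<Longrightarrow> f j \<in> tsets [j..<Suc k] (Sp k)" "y \<approx> (\<Sum>j\<le>Suc k. f j)"
  using assms unfolding Sp.simps by blast

lemma Sp_Suc_base:
  assumes "\<And>j. j \<le> Suc k \<Longrightarrow> subm (tsets [j..<Suc k] (Sp k))" "j \<le> Suc k" "z \<in> tsets [j..<Suc k] (Sp k)"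
  shows "z \<in> Sp (Suc k)"
proof (rule Sp_SucI[where f = "\<lambda>i. if i = j then z else 0"])
  show "z \<in> galg G" using assms subm_galg by blast
  show "z \<approx> (\<Sum>i\<le>Suc k. if i = j then z else 0)" using assms(2) by (simp add: eqv_refl)
qed (use assms subm_zero in auto)

lemma Sp_Suc_add:
  assumes "\<And>j. j \<le> Suc k \<Longrightarrow> subm (tsets [j..<Suc k] (Sp k))" "x \<in> Sp (Suc k)" "y \<in> Sp (Suc k)"
  shows "x + y \<in> Sp (Suc k)"
proof -
  obtain f where f: "x \<in> galg G" "\<And>j. j \<le> Suc k \<Longrightarrow> f j \<in> tsets [j..<Suc k] (Sp k)" "x \<approx> (\<Sum>j\<le>Suc k. f j)"
    using assms(2) by (rule Sp_SucE) blast
  obtain g where g: "y \<in> galg G" "\<And>j. j \<le> Suc k \<Longrightarrow> g j \<in> tsets [j..<Suc k] (Sp k)" "y \<approx> (\<Sum>j\<le>Suc k. g j)"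
    using assms(3) by (rule Sp_SucE) blast
  show ?thesis
  proof (rule Sp_SucI[where f = "\<lambda>j. f j + g j"])
    show "x + y \<approx> (\<Sum>j\<le>Suc k. f j + g j)" unfolding sum.distrib by (intro eqv_add f g)
  qed (use f g galg_add subm_add[OF assms(1)] in auto)
qed

lemma Sp_Suc_eqv: "x \<in> galg G \<Longrightarrow> y \<in> Sp (Suc k) \<Longrightarrow> x \<approx> y \<Longrightarrow> x \<in> Sp (Suc k)"
  unfolding Sp.simps using eqv_trans by blast

lemma Sp_Suc_zero:
  assumes "\<And>j. j \<le> Suc k \<Longrightarrow> subm (tsets [j..<Suc k] (Sp k))"
  shows "0 \<in> Sp (Suc k)"
  using Sp_Suc_base[OF assms, of 0 0] subm_zero[OF assms[of 0]] by simp

lemma Sp_Suc_left: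
  assumes s: "\<And>j. j \<le> Suc k \<Longrightarrow> subm (tsets [j..<Suc k] (Sp k))" and g: "g \<in> galg G"
    and *: "\<And>j z. j \<le> Suc k \<Longrightarrow> z \<in> tsets [j..<Suc k] (Sp k) \<Longrightarrow> g * z \<in> Sp (Suc k)"
    and y: "y \<in> Sp (Suc k)"
  shows "g * y \<in> Sp (Suc k)"
proof -
  obtain f where f: "y \<in> galg G" "\<And>j. j \<le> Suc k \<Longrightarrow> f j \<in> tsets [j..<Suc k] (Sp k)" "y \<approx> (\<Sum>j\<le>Suc k. f j)"
    using y by (rule Sp_SucE) blast
  have "g * y \<approx> g * (\<Sum>j\<le>Suc k. f j)" by (intro eqv_left f g)
  then have "g * y \<approx> (\<Sum>j\<le>Suc k. g * f j)" by (simp only: sum_distrib_left)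
  moreover have "(\<Sum>j\<in>A. g * f j) \<in> Sp (Suc k)" if "A \<subseteq> {..Suc k}" for A
    using finite_subset[OF that] that
    by (induction A rule: finite_induct) (auto intro!: Sp_Suc_zero Sp_Suc_add s * f)
  ultimately show ?thesis using Sp_Suc_eqv galg_mult[OF g f(1)] by blast
qed

text \<open>A crossing T_a in front of T_j ... T_k commutes through it into \<open>Sp k\<close>,
  lengthens it, shortens it by the quadratic relation, or passes through it as T_(a-1) after one
  braid move. In every case a representative followed by an element of \<open>Sp k\<close>
  results.\<close>

lemma Sp_closed:
  assumes "k < n"
  shows "subm (Sp k) \<and> (\<forall>a<k. \<forall>y\<in>Sp k. wd [T a] * y \<in> Sp k)"
  using assms
proof (induction k)
  case 0
  show ?case by (simp add: Sp0_subm)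
next
  case (Suc k)
  then have S: "subm (Sp k)" and T: "\<And>a y. a < k \<Longrightarrow> y \<in> Sp k \<Longrightarrow> wd [T a] * y \<in> Sp k" by auto
  have s: "subm (tsets [j..<Suc k] (Sp k))" for j
    using Suc.prems by (intro tsets_subm S) auto
  note left = Sp_Suc_left[OF s]
  note base = Sp_Suc_base[OF s]
  have tsub: "tset a (Sp k) \<subseteq> Sp k" if "a < k" for a using T that by (intro tset_subset S)
  have "subm (Sp (Suc k))" unfolding subm_def
  proof (intro conjI ballI allI impI)
    show "Sp (Suc k) \<subseteq> galg G" by (auto simp: Sp.simps)
  next
    fix c x assume "x \<in> Sp (Suc k)"
    then have "sc c * 1 * x \<in> Sp (Suc k)"
    proof (rule left[rotated 2])
      show "sc c * 1 \<in> galg G" by (intro galg_sc_mult galg_one)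
      show "sc c * 1 * z \<in> Sp (Suc k)" if "j \<le> Suc k" "z \<in> tsets [j..<Suc k] (Sp k)" for j z
        using base[OF that(1) subm_sc[OF s that(2)], of c] by simp
    qed
    then show "sc c * x \<in> Sp (Suc k)" by simp
  next
    fix nu x assume nu: "nu \<in> Ib" and "x \<in> Sp (Suc k)"
    from this(2) show "wd [E nu] * x \<in> Sp (Suc k)"
      by (rule left[OF wdE[OF nu], rotated]) (rule base, assumption, rule subm_E[OF s nu])
  next
    fix p x assume p: "p < n" and "x \<in> Sp (Suc k)"
    from this(2) show "wd [X p] * x \<in> Sp (Suc k)"
      by (rule left[OF wdX[OF p], rotated]) (rule base, assumption, rule subm_X[OF s p])
  next
    show "0 \<in> Sp (Suc k)" by (rule Sp_Suc_zero[OF s])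
  next
    fix x y assume "x \<in> Sp (Suc k)" "y \<in> Sp (Suc k)"
    then show "x + y \<in> Sp (Suc k)" by (rule Sp_Suc_add[OF s])
  next
    fix x y assume "x \<in> galg G" "y \<in> Sp (Suc k)" "x \<approx> y"
    then show "x \<in> Sp (Suc k)" by (rule Sp_Suc_eqv)
  qed
  moreover have "wd [T a] * y \<in> Sp (Suc k)" if a: "a < Suc k" and y: "y \<in> Sp (Suc k)" for a y
  proof (rule left[OF _ _ y])
    have a': "Suc a < n" using a Suc.prems by simp
    then show "wd [T a] \<in> galg G" by (rule wdT)
    fix j z assume j: "j \<le> Suc k" and z: "z \<in> tsets [j..<Suc k] (Sp k)"
    consider "a + 1 < j" | "a + 1 = j" | "a = j" | "j < a" by linarith
    then show "wd [T a] * z \<in> Sp (Suc k)"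
    proof cases
      case 1
      then have "wd [T a] * z \<in> tsets [j..<Suc k] (tset a (Sp k))"
        using Suc.prems a by (intro tsets_comm S a' z) auto
      moreover have "a < k" using 1 j by simp
      ultimately show ?thesis using tsets_mono[OF tsub] base[OF j] by blast
    next
      case 2
      have "[a..<Suc k] = a # [j..<Suc k]" using 2 a by (metis Suc_eq_plus1 upt_conv_Cons)
      then have "wd [T a] * z \<in> tsets [a..<Suc k] (Sp k)" using tsetI[OF s a' z] by simp
      then show ?thesis using base[of a] a by simp
    next
      case 3
      have "[j..<Suc k] = a # [Suc a..<Suc k]" using 3 a by (metis upt_conv_Cons)
      then have "wd [T a] * z \<in> tsets [Suc a..<Suc k] (Sp k)" using tset_square[OF s a', of z "Suc a"] z by simp
      then show ?thesis using base[of "Suc a"] a by simp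
    next
      \<comment> \<open>With b = a - 1: T_a commutes up to T_b, the braid relation turns T_a T_b T_a
        into T_b T_a T_b, and the last T_b commutes with the remaining letters into
        \<open>Sp k\<close>, which admits it since b < k.\<close>
      case 4
      then obtain b where b: "a = Suc b" "j \<le> b" by (cases a) auto
      define S' where "S' = tsets [Suc a..<Suc k] (Sp k)"
      have S': "subm S'" unfolding S'_def by (rule s)
      have upt: "[j..<Suc k] = [j..<b] @ [b, a] @ [Suc a..<Suc k]"
      proof -
        have "[j..<Suc k] = [j..<b] @ [b..<Suc k]" 
          using upt_add_eq_append[of j b "Suc k - b"] b a by (simp del: upt_Suc)
        also have "[b..<Suc k] = b # a # [Suc a..<Suc k]" using b a by (simp add: upt_conv_Cons)
        finally show ?thesis by simp
      qed
      have b': "Suc b < n" using b a' by simp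
      have S1: "subm (tset b (tset a S'))" by (intro tset_subm S' a' b')
      have sub1: "tset b S' \<subseteq> S'"
      proof (rule tset_subset[OF S'])
        fix y assume "y \<in> S'"
        then have "wd [T b] * y \<in> tsets [Suc a..<Suc k] (tset b (Sp k))"
          unfolding S'_def using Suc.prems b by (intro tsets_comm S b') auto
        moreover have "b < k" using b a by simp
        ultimately show "wd [T b] * y \<in> S'" unfolding S'_def using tsets_mono[OF tsub] by blast
      qed
      have sub2: "tset a (tset b (tset a S')) \<subseteq> tset b (tset a S')"
      proof (rule tset_subset[OF S1])
        fix y assume "y \<in> tset b (tset a S')"
        then have "wd [T a] * y \<in> tset b (tset a (tset b S'))"
          using tset_braid[OF S', of b y] a' b by simp
        then show "wd [T a] * y \<in> tset b (tset a S')" using tset_mono[OF tset_mono[OF sub1]] by blast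
      qed
      have "z \<in> tsets [j..<b] (tset b (tset a S'))" using z unfolding upt by (simp add: tsets_append S'_def)
      then have "wd [T a] * z \<in> tsets [j..<b] (tset a (tset b (tset a S')))"
        using b a' by (intro tsets_comm S1) auto
      then have "wd [T a] * z \<in> tsets [j..<b] (tset b (tset a S'))" using tsets_mono[OF sub2] by blast
      then have "wd [T a] * z \<in> tsets [j..<Suc k] (Sp k)" unfolding upt by (simp add: tsets_append S'_def)
      then show ?thesis by (rule base[OF j])
    qed
  qed
  ultimately show ?case by blast
qed

lemma Emu_Sp0: "wd [E mu] \<in> Sp0"
proof -
  have "xword (lookup 0) = []" by (simp add: xword_def xmon_def)
  then show ?thesis using Sp0_mon[of 0] by simp
qed

lemma Emu_Sp: "k < n \<Longrightarrow> wd [E mu] \<in> Sp k"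
proof (induction k)
  case 0
  show ?case by (simp add: Emu_Sp0)
next
  case (Suc k)
  have "subm (tsets [j..<Suc k] (Sp k))" for j
    using Suc.prems Sp_closed[of k] by (intro tsets_subm) auto
  from Sp_Suc_base[OF this, of "Suc k"] show ?case using Suc by simp
qed

lemma galg_E_in_Sp:
  assumes "x \<in> galg G"
  shows "x * wd [E mu] \<in> Sp (n - 1)"
proof (cases "n = 0")
  \<comment> \<open>Here \<open>n - 1\<close> is not below \<open>n\<close>, so
    \<open>Sp_closed\<close> does not apply; the only letters are idempotents.\<close>
  case True
  have s: "subm Sp0" by (rule Sp0_subm)
  have "wd w * wd [E mu] \<in> Sp0" if "set w \<subseteq> G" for w
    using that
  proof (induction w)
    case (Cons g w)
    then obtain nu where "g = E nu" "nu \<in> Ib" using True by (auto simp: QH_gens_def)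
    then show ?case using Cons subm_E[OF s] by (auto simp: wd_Cons[of "E nu" w] mult.assoc)
  qed (simp add: Emu_Sp0)
  with assms have "x * wd [E mu] \<in> Sp0"
    by (induction x rule: galg_induct) (auto simp: distrib_right mult.assoc intro!: Sp0_zero Sp0_add Sp0_sc)
  moreover have "n - 1 = 0" using True by simp
  ultimately show ?thesis by (simp only: Sp.simps(1))
next
  case False
  then have n: "n - 1 < n" by simp
  note s = Sp_closed[OF n, THEN conjunct1]
  have "wd w * wd [E mu] \<in> Sp (n - 1)" if "set w \<subseteq> G" for w
    using that
  proof (induction w)
    case Nil
    then show ?case using Emu_Sp[OF n] by simp
  next
    case (Cons g w)
    then have IH: "wd w * wd [E mu] \<in> Sp (n - 1)" by simp
    consider nu where "g = E nu" "nu \<in> Ib" | p where "g = X p" "p < n" | a where "g = T a" "a < n - 1"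
      using Cons.prems by (auto simp: QH_gens_def)
    then have "wd [g] * (wd w * wd [E mu]) \<in> Sp (n - 1)"
      using IH subm_E[OF s] subm_X[OF s] Sp_closed[OF n] by cases auto
    then show ?case by (simp add: wd_Cons[of g w] mult.assoc)
  qed
  with assms show ?thesis
    by (induction x rule: galg_induct)
      (auto simp: distrib_right mult.assoc simp del: One_nat_def
        intro!: subm_zero[OF s] subm_add[OF s] subm_sc[OF s])
qed

section \<open>Faithfulness, tested on the cyclic vector that represents e(mu)\<close>

definition delta :: "(nat \<Rightarrow> nat) \<Rightarrow> 'k mpl" where
  "delta u = (if u = id then 1 else 0)"

lemma delta_Vs: "delta \<in> Vs"
  by (auto simp: Vs_def delta_def pol_intros permutes_id)

lemma Eop_delta: "Eop mu delta = delta"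
proof
  show "Eop mu delta u = delta u" for u by (cases "u = id") (simp_all add: Eop_def delta_def)
qed

lemma theta_mon_disjoint: "keys m \<inter> S = {} \<Longrightarrow> theta S (mon m) = mon m"
proof -
  assume "keys m \<inter> S = {}"
  then have "wt (\<lambda>j. if j \<in> S then 1 else 0) m = 0" by (auto simp: wt_def)
  then show ?thesis by (simp add: theta_mon esign_def)
qed

text \<open>Working from the last position downwards, x_j meets only larger variables, which
  \<open>before_odd j\<close> leaves alone. Ordered monomials thus act without any sign.\<close>

lemma actw_xword_upt:
  "j \<le> n \<Longrightarrow> actw (concat (map (\<lambda>k. xmon k (r k)) [j..<n])) delta
    = (\<lambda>u. if u = id then mon (\<Sum>k=j..<n. single k (r k)) else 0)"
proof (induction "n - j" arbitrary: j)
  case 0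
  then have "[j..<n] = []" "{j..<n} = {}" by auto
  moreover have "delta = (\<lambda>u. if u = id then mon 0 else 0)" by (rule ext) (simp only: delta_def mon_0)
  ultimately show ?case by (simp only: list.map concat.simps actw_Nil sum.empty)
next
  case (Suc l)
  then have j: "j < n" by simp
  have IH: "actw (concat (map (\<lambda>k. xmon k (r k)) [Suc j..<n])) delta
    = (\<lambda>u. if u = id then mon (\<Sum>k=Suc j..<n. single k (r k)) else 0)"
    using Suc by simp
  have "keys (\<Sum>k=Suc j..<n. single k (r k)) \<subseteq> {Suc j..<n}"
    using keys_sum[of "\<lambda>k. single k (r k)" "{Suc j..<n}"] by (fastforce split: if_splits)
  then have th: "theta (before_odd j) (mon (\<Sum>k=Suc j..<n. single k (r k)))
      = (mon (\<Sum>k=Suc j..<n. single k (r k)) :: 'k mpl)"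
    by (intro theta_mon_disjoint) (auto simp: before_odd_def)
  have upt: "[j..<n] = j # [Suc j..<n]" using j by (simp add: upt_conv_Cons)
  have "(\<Sum>k=j..<n. single k (r k)) = single j (r j) + (\<Sum>k=Suc j..<n. single k (r k))"
    using j by (simp add: sum.atLeast_Suc_lessThan)
  then show ?case unfolding upt
    by (auto simp: fun_eq_iff actw_append IH actw_xmon th mon_add xv_power)
qed

lemma actw_xword_delta:
  assumes "keys m \<subseteq> {..<n}"
  shows "actw (xword (lookup m)) delta = (\<lambda>u. if u = id then mon m else 0)"
proof -
  have eq: "(\<Sum>k=0..<n. single k (lookup m k)) = m"
    using assms by (intro poly_mapping_eqI)
      (auto simp: lookup_sum lookup_single when_def in_keys_iff not_less atLeast0LessThan)
  have "actw (xword (lookup m)) delta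
      = (\<lambda>u. if u = id then mon (\<Sum>k=0..<n. single k (lookup m k)) else 0)"
    unfolding xword_def by (rule actw_xword_upt) simp
  then show ?thesis unfolding eq .
qed

lemma actp_Xi_delta: "q \<in> pol n \<Longrightarrow> actp (Xi q) delta = (\<lambda>u. if u = id then q else 0)"
proof (induction q rule: pol_induct)
  case (mon m c)
  then show ?case
    by (auto simp: fun_eq_iff Xi_cst_mon actp_sc actp_wd actw_append Eop_delta actw_xword_delta)
qed (auto simp: fun_eq_iff Xi_zero Xi_add actp_zero actp_add)

text \<open>T_j ... T_k carries strand \<open>k + 1\<close> from its own position leftwards to
  position \<open>j\<close>. The strands it passes have smaller index, since the larger ones are
  fixed, so each crossing is a first one and nothing is lost. The support shows where the strand has
  ended.\<close>

lemma T_chain: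
  assumes v: "v \<in> Vs" "\<And>u p. v u \<noteq> 0 \<Longrightarrow> k < p \<Longrightarrow> u p = p" and k: "Suc k < n"
  shows "j \<le> Suc k \<Longrightarrow> (\<forall>u. actw (map T [j..<Suc k]) v u \<noteq> 0 \<longrightarrow> u j = Suc k \<and> (\<forall>p>Suc k. u p = p)) \<and>
    ((\<forall>u. actw (map T [j..<Suc k]) v u = 0) \<longrightarrow> (\<forall>u. v u = 0))"
proof (induction "Suc k - j" arbitrary: j)
  case 0
  then show ?case using v(2) by auto
next
  case (Suc l)
  then have j: "j \<le> k" by simp
  define V where "V = actw (map T [Suc j..<Suc k]) v"
  have "l = Suc k - Suc j" "Suc j \<le> Suc k" using Suc.hyps(2) j by auto
  note IH = Suc.hyps(1)[OF this, folded V_def]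
  have V: "V u \<noteq> 0 \<Longrightarrow> u (Suc j) = Suc k" "V u \<noteq> 0 \<Longrightarrow> p > Suc k \<Longrightarrow> u p = p" for u p
    using IH by auto
  have V0: "(\<forall>u. V u = 0) \<longrightarrow> (\<forall>u. v u = 0)" using IH by blast
  have VVs: "V \<in> Vs" unfolding V_def using k by (intro actw_Vs v) (auto simp: QH_gens_def)
  have upt: "[j..<Suc k] = j # [Suc j..<Suc k]" using j by (simp add: upt_conv_Cons)
  have eq: "actw (map T [j..<Suc k]) v = Top j V" unfolding upt V_def by simp
  show ?case unfolding eq
  proof (intro conjI allI impI)
    fix u assume "Top j V u \<noteq> 0"
    then have ne: "V (u \<circ> sref j) \<noteq> 0" by (auto simp: Top_def)
    show "u j = Suc k" using V(1)[OF ne] by simp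
    fix p assume "p > Suc k"
    then show "u p = p" using V(2)[OF ne, of p] j by (simp add: sref_other)
  next
    fix u assume 0: "\<forall>u. Top j V u = 0"
    have "V x = 0" for x
    proof (rule ccontr)
      assume ne: "V x \<noteq> 0"
      then have x: "x permutes {..<n}" using VVs by (auto simp: Vs_def)
      have "x j \<noteq> Suc k" using V(1)[OF ne] permutes_neq[OF x, of j "Suc j"] by auto
      moreover have "\<not> x j > Suc k"
      proof
        assume "x j > Suc k"
        then have "x (x j) = x j" using V(2)[OF ne] by simp
        then have "x j = j" using permutes_neq[OF x] by blast
        then show False using \<open>x j > Suc k\<close> j by simp
      qed
      \<comment> \<open>A first crossing, whose coefficient is a mere sign and hence
        invertible.\<close>
      ultimately have "x j < x (Suc j)" using V(1)[OF ne] by simp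
      then have T: "Tco x j = cst (kap x j)" by (simp add: Tco_def qf_def)
      have "Top j V (x \<circ> sref j) = 0" using 0 by blast
      then have "cst (kap x j) * theta (cross_odd x j) (V x) = 0" by (simp only: Top_apply T)
      then have "cst (kap x j) * (cst (kap x j) * theta (cross_odd x j) (V x)) = 0" by simp
      then have "theta (cross_odd x j) (V x) = 0"
        by (simp add: kap_square flip: mult.assoc cst_mult)
      then have "theta (cross_odd x j) (theta (cross_odd x j) (V x)) = 0" by simp
      then show False using ne by simp
    qed
    then show "v u = 0" using V0 by blast
  qed
qed

lemma tsets_obtain: "subm S \<Longrightarrow> \<forall>a\<in>set as. Suc a < n \<Longrightarrow> z \<in> tsets as S \<Longrightarrow> \<exists>y\<in>S. z \<approx> wd (map T as) * y"
proof (induction as arbitrary: z)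
  case Nil
  then show ?case by (auto intro: eqv_refl)
next
  case (Cons a as)
  then obtain z' where z': "z' \<in> tsets as S" "z \<approx> wd [T a] * z'" by (auto simp: tset_def)
  with Cons obtain y where y: "y \<in> S" "z' \<approx> wd (map T as) * y" by auto
  have "z \<approx> wd [T a] * (wd (map T as) * y)"
    by (rule eqv_trans[OF z'(2)]) (use Cons.prems in \<open>auto intro!: eqv_left y wdT\<close>)
  then show ?case using y by (auto simp: wd_Cons[of _ "map T as"] mult.assoc)
qed

text \<open>In a sum of terms T_j ... T_k z_j the supports for different j are disjoint, since
  strand \<open>k + 1\<close> stands at position j. A vanishing sum therefore vanishes termwise, and
  induction applies to each z_j. The claim on supports is carried along because the next stage needs
  it.\<close>

lemma Sp_faithful:
  assumes "k < n \<or> k = 0"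
  shows "y \<in> Sp k \<Longrightarrow> (\<forall>u p. actp y delta u \<noteq> 0 \<longrightarrow> k < p \<longrightarrow> u p = p) \<and>
    ((\<forall>u. actp y delta u = 0) \<longrightarrow> y \<in> J0)"
  using assms
proof (induction k arbitrary: y)
  case 0
  then obtain q where q: "q \<in> pol n" "y \<approx> Xi q" by (auto simp: Sp0_def)
  have y: "actp y delta = (\<lambda>u. if u = id then q else 0)"
    using eqv_actp[OF q(2) delta_Vs] actp_Xi_delta[OF q(1)] by (simp add: fun_eq_iff)
  have "y \<in> J0" if "\<forall>u. actp y delta u = 0"
  proof -
    have "q = 0" using that[rule_format, of id] by (simp add: y)
    then show ?thesis using q(2) by (simp add: Xi_zero eqv_0_iff)
  qed
  moreover have "u p = p" if "actp y delta u \<noteq> 0" for u p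
    using that by (simp add: y split: if_splits)
  ultimately show ?case by blast
next
  case (Suc k)
  then have k: "Suc k < n" "k < n" by auto
  have S: "subm (Sp k)" using Sp_closed k by blast
  obtain f where f: "y \<in> galg G" "\<And>j. j \<le> Suc k \<Longrightarrow> f j \<in> tsets [j..<Suc k] (Sp k)" "y \<approx> (\<Sum>j\<le>Suc k. f j)"
    using Suc.prems(1) by (rule Sp_SucE) blast
  have "\<exists>z\<in>Sp k. f j \<approx> wd (map T [j..<Suc k]) * z" if "j \<le> Suc k" for j
    using k by (intro tsets_obtain[OF S _ f(2)[OF that]]) auto
  then obtain z where z: "\<And>j. j \<le> Suc k \<Longrightarrow> z j \<in> Sp k"
    "\<And>j. j \<le> Suc k \<Longrightarrow> f j \<approx> wd (map T [j..<Suc k]) * z j" by metis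
  define V where "V j = actw (map T [j..<Suc k]) (actp (z j) delta)" for j
  have fV: "actp (f j) delta u = V j u" if "j \<le> Suc k" for j u
    using eqv_actp[OF z(2)[OF that] delta_Vs] by (simp add: V_def actp_mult actp_wd)
  have yV: "actp y delta u = (\<Sum>j\<le>Suc k. V j u)" for u
  proof -
    have "actp y delta u = (\<Sum>j\<le>Suc k. actp (f j) delta u)"
      using eqv_actp[OF f(3) delta_Vs, of u] by (simp only: actp_sum)
    also have "\<dots> = (\<Sum>j\<le>Suc k. V j u)" by (intro sum.cong refl) (simp add: fV)
    finally show ?thesis .
  qed
  have chain: "(\<forall>u. V j u \<noteq> 0 \<longrightarrow> u j = Suc k \<and> (\<forall>p>Suc k. u p = p)) \<and>
    ((\<forall>u. V j u = 0) \<longrightarrow> (\<forall>u. actp (z j) delta u = 0))" if "j \<le> Suc k" for j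
    unfolding V_def
  proof (rule T_chain[OF _ _ k(1) that])
    show "actp (z j) delta \<in> Vs" using subm_galg[OF S z(1)[OF that]] by (intro actp_Vs delta_Vs)
    show "u p = p" if "actp (z j) delta u \<noteq> 0" "k < p" for u p
      using Suc.IH[OF z(1)] k that \<open>j \<le> Suc k\<close> by blast
  qed
  have VVs: "V j u = 0" if "\<not> u permutes {..<n}" "j \<le> Suc k" for j u
  proof -
    have "V j \<in> Vs" unfolding V_def
      using k subm_galg[OF S z(1)[OF that(2)]] by (intro actw_Vs actp_Vs delta_Vs) (auto simp: QH_gens_def)
    then show ?thesis using that by (simp add: Vs_def)
  qed
  have "u p = p" if "actp y delta u \<noteq> 0" "Suc k < p" for u p
  proof -
    have "\<exists>j\<le>Suc k. V j u \<noteq> 0"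
    proof (rule ccontr)
      assume "\<not> ?thesis"
      then have "(\<Sum>j\<le>Suc k. V j u) = 0" by (intro sum.neutral) auto
      then show False using that(1) yV by metis
    qed
    then show ?thesis using chain that(2) by blast
  qed
  moreover have "y \<in> J0" if y0: "\<forall>u. actp y delta u = 0"
  proof -
    have "V j u = 0" if j: "j \<le> Suc k" for j u
    proof (rule ccontr)
      assume ne: "V j u \<noteq> 0"
      then have u: "u permutes {..<n}" using VVs j by blast
      have "V i u = 0" if "i \<le> Suc k" "i \<noteq> j" for i
        using chain[OF that(1)] chain[OF j] ne permutes_neq[OF u that(2)] by metis
      then have "(\<Sum>i\<le>Suc k. V i u) = V j u"
        using j by (subst sum.remove[of _ j]) (auto intro!: sum.neutral)
      then show False using y0 ne by (simp add: yV)
    qed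
    then have "z j \<in> J0" if "j \<le> Suc k" for j
      using Suc.IH[OF z(1)[OF that]] chain[OF that] k that by blast
    then have "f j \<approx> 0" if "j \<le> Suc k" for j
    proof -
      have "wd (map T [j..<Suc k]) * z j \<approx> wd (map T [j..<Suc k]) * 0"
        using k \<open>\<And>j. j \<le> Suc k \<Longrightarrow> z j \<in> J0\<close> that
        by (intro eqv_left galg_wd) (auto simp: eqv_0_iff QH_gens_def)
      then show ?thesis using z(2)[OF that] eqv_trans by fastforce
    qed
    then have "(\<Sum>j\<le>Suc k. f j) \<approx> (\<Sum>j\<le>Suc k. 0)" by (intro eqv_sum) auto
    then show ?thesis using f(3) eqv_trans eqv_0_iff by fastforce
  qed
  ultimately show ?case by blast
qed

theorem faithful:
  assumes "x \<in> galg G" "\<And>u. actp x delta u = 0"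
  shows "x * wd [E mu] \<in> J0"
proof -
  have "actp (x * wd [E mu]) delta u = 0" for u
    using assms(2) by (simp add: actp_mult actp_wd Eop_delta)
  moreover have "n - 1 < n \<or> n - 1 = 0" by auto
  ultimately show ?thesis using Sp_faithful galg_E_in_Sp[OF assms(1)] by blast
qed

end

section \<open>The cyclotomic ideal\<close>

definition cyc_ring :: "('i \<Rightarrow> nat) \<Rightarrow> nat \<Rightarrow> 'i list set \<Rightarrow> ('i, 'k::field) falg set" where
  "cyc_ring L n Ib = (if n = 0 then {} else {\<Sum>nu\<in>Ib. wd (xmon 0 (L (nu ! 0)) @ [E nu])})"

definition homog :: "(nat \<Rightarrow> nat) \<Rightarrow> nat \<Rightarrow> 'k::field mpl \<Rightarrow> bool" where
  "homog d k f \<longleftrightarrow> (\<forall>m\<in>keys f. wt d m = k)"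

lemma homog_mult: "homog d k f \<Longrightarrow> homog d l g \<Longrightarrow> homog d (k + l) (f * g)"
  unfolding homog_def using keys_mult[of f g] by (fastforce simp: wt_add)

lemma homog_prod: "finite A \<Longrightarrow> (\<And>a. a \<in> A \<Longrightarrow> homog d (k a) (f a)) \<Longrightarrow> homog d (sum k A) (prod f A)"
  by (induction A rule: finite_induct) (auto intro: homog_mult simp: homog_def[of d 0 1])

context column
begin

definition J :: "('i, 'k) falg set" where
  "J = ideal_gen G (qh_rels Iodd t n Ib \<union> cyc_ring L n Ib)"

definition B :: "(nat \<Rightarrow> nat) \<Rightarrow> nat \<Rightarrow> nat set" where
  "B u i = {j. j < i \<and> inv u j < inv u i}"

definition ff :: "(nat \<Rightarrow> nat) \<Rightarrow> nat \<Rightarrow> 'k mpl" where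
  "ff u i = xv i ^ L (mu ! i) * (\<Prod>j\<in>B u i. qp i j)"

text \<open>The x_i-degree of \<open>ff u i\<close>. For \<open>u = inv w\<close> it becomes the
  number \<open>NLam\<close> attached to \<open>w\<close>.\<close>

definition NN :: "(nat \<Rightarrow> nat) \<Rightarrow> nat \<Rightarrow> nat" where
  "NN u i = L (mu ! i) + (\<Sum>j\<in>B u i. D i j)"

abbreviation W :: "(nat \<Rightarrow> nat) \<Rightarrow> 'k mpl set" where
  "W u \<equiv> span_ideal n (ff u)"

lemma finite_B: "finite (B u i)"
  by (rule finite_subset[of _ "{..<i}"]) (auto simp: B_def)

lemma J0_subset_J: "y \<in> J0 \<Longrightarrow> y \<in> J"
  unfolding J0_def J_def by (erule ideal_gen_mono) simp

lemma J_add: "x \<in> J \<Longrightarrow> y \<in> J \<Longrightarrow> x + y \<in> J"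
  and J_diff: "x \<in> J \<Longrightarrow> y \<in> J \<Longrightarrow> x - y \<in> J"
  and J_sc: "x \<in> J \<Longrightarrow> sc c * x \<in> J"
  and J_left: "g \<in> galg G \<Longrightarrow> x \<in> J \<Longrightarrow> g * x \<in> J"
  and J_right: "g \<in> galg G \<Longrightarrow> x \<in> J \<Longrightarrow> x * g \<in> J"
  and J_zero: "0 \<in> J"
  unfolding J_def by (rule ideal_gen_add ideal_gen_diff ideal_gen_sc ideal_gen_mult_left
      ideal_gen_mult_right ideal_gen.zero; assumption)+

lemma qpoly_galg: "Suc a < n \<Longrightarrow> qpoly t i j a (Suc a) \<in> galg G"
  unfolding qpoly_def
  by (intro galg_sum) (auto intro!: galg_sc_mult galg_wd simp: xmon_def QH_gens_def)

lemma rels_galg: "qh_rels Iodd t n Ib \<union> cyc_ring L n Ib \<subseteq> galg G"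
proof
  fix r assume "r \<in> qh_rels Iodd t n Ib \<union> (cyc_ring L n Ib :: ('i, 'k) falg set)"
  then show "r \<in> galg G"
  proof
    assume "r \<in> qh_rels Iodd t n Ib"
    then show ?thesis
    proof cases
      case (idem lam nu)
      then show ?thesis unfolding idem(1)
        by (cases "lam = nu") (auto intro!: galg_diff galg_zero galg_wd gens)
    next
      case unit
      show ?thesis unfolding unit(1) by (intro galg_diff galg_sum galg_wd) (auto intro!: gens)
    next
      case (TE a nu)
      then have "perm_act (sref a) nu \<in> Ib" using perm_act_sref_Ib by blast
      then show ?thesis unfolding TE(1) using TE(2,3) by (intro galg_diff galg_wd) (auto intro!: gens)
    next
      case (TT a nu)
      then show ?thesis unfolding TT(1)
        by (intro galg_diff galg_mult galg_wd qpoly_galg) (auto intro!: gens)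
    next
      case (XX p q nu)
      show ?thesis unfolding XX(1) using XX(2-5)
        by (intro galg_diff galg_sc_mult galg_wd) (auto intro!: gens)
    next
      case (XE p nu)
      show ?thesis unfolding XE(1) using XE(2,3)
        by (intro galg_diff galg_sc_mult galg_wd) (auto intro!: gens)
    next
      case (TX a p nu)
      show ?thesis unfolding TX(1) using TX(2-6)
        by (intro galg_diff galg_sc_mult galg_wd) (auto intro!: gens)
    next
      case (TX1 a nu)
      show ?thesis unfolding TX1(1) using TX1(2,3)
        by (intro galg_diff galg_sc_mult galg_wd) (auto intro!: gens)
    next
      case (TX2 a nu)
      show ?thesis unfolding TX2(1) using TX2(2,3)
        by (intro galg_diff galg_sc_mult galg_wd) (auto intro!: gens)
    next
      case (TTd a b nu)
      show ?thesis unfolding TTd(1) using TTd(2-5)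
        by (intro galg_diff galg_sc_mult galg_wd) (auto intro!: gens)
    next
      case (braid a nu)
      show ?thesis unfolding braid(1) using braid(2,3)
        by (intro galg_diff galg_sc_mult galg_wd) (auto intro!: gens)
    qed
  next
    assume "r \<in> cyc_ring L n Ib"
    then show ?thesis unfolding cyc_ring_def
      by (auto split: if_splits intro!: galg_sum galg_wd gens simp: xmon_def)
  qed
qed

lemma J_galg: "y \<in> J \<Longrightarrow> y \<in> galg G"
  unfolding J_def by (erule ideal_gen_subset_galg) (rule rels_galg)

text \<open>By homogeneity a term without x_j must be the pure power of x_i, and a term with x_j has
  strictly smaller degree in x_i because all weights are positive.\<close>

lemma qp_lead:
  assumes "i < n" "j < n" "i \<noteq> j"
  shows "lead_in i (D i j) (qp i j)"
proof -
  have inj: "single i r + single j s = single i (D i j) \<longleftrightarrow> (r, s) = (D i j, 0)" for r s :: nat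
  proof
    assume eq: "single i r + single j s = single i (D i j)"
    from arg_cong[OF eq, of "\<lambda>m. lookup m i"] arg_cong[OF eq, of "\<lambda>m. lookup m j"] assms(3)
    show "(r, s) = (D i j, 0)" by (simp add: lookup_add lookup_single when_def)
  qed simp
  have "lookup (qp i j) (single i (D i j)) = (\<Sum>(r, s)\<in>{rs. t (mu ! i) (mu ! j) rs \<noteq> 0}.
      if (r, s) = (D i j, 0) then t (mu ! i) (mu ! j) (r, s) else 0)"
    unfolding qp_def lookup_sum
    by (intro sum.cong refl) (auto simp: lookup_cst_mult mon_def lookup_single when_def inj)
  also have "\<dots> = (\<Sum>rs\<in>{rs. t (mu ! i) (mu ! j) rs \<noteq> 0}.
      if rs = (D i j, 0) then t (mu ! i) (mu ! j) rs else 0)"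
    by (intro sum.cong refl) (auto split: if_splits)
  also have "\<dots> = t (mu ! i) (mu ! j) (D i j, 0)"
    using finite_t[OF assms(1,2)] by simp
  finally have 1: "lookup (qp i j) (single i (D i j)) \<noteq> 0" using tlead[OF assms] by simp
  have "lookup m i < D i j" if m: "m \<in> keys (qp i j)" "m \<noteq> single i (D i j)" for m
  proof -
    obtain r s where rs: "t (mu ! i) (mu ! j) (r, s) \<noteq> 0" "m = single i r + single j s"
      using keys_qp[OF assms(1,2) m(1)] by blast
    have eq: "d i * r + d j * s = d i * D i j" using thom[OF assms(1,2) rs(1)] .
    have "s \<noteq> 0"
    proof
      assume "s = 0"
      then have "r = D i j" using eq dpos[OF assms(1)] by simp
      with \<open>s = 0\<close> show False using m(2) rs(2) by simp
    qed
    then have "d i * r < d i * D i j" using eq dpos[OF assms(2)] by (metis less_add_same_cancel1 mult_pos_pos neq0_conv)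
    then show ?thesis using rs(2) assms(3) by (simp add: lookup_add lookup_single when_def)
  qed
  with 1 show ?thesis by (auto simp: lead_in_def)
qed

lemma B_less: "j \<in> B u i \<Longrightarrow> j < i"
  by (simp add: B_def)

lemma ff_lead: "i < n \<Longrightarrow> lead_in i (NN u i) (ff u i)"
  unfolding ff_def NN_def
  using B_less by (intro lead_in_mult lead_in_power lead_in_prod qp_lead finite_B) fastforce+

lemma qp_pol_Suc:
  assumes "i < n" "j < i"
  shows "qp i j \<in> pol (Suc i)"
  unfolding qp_def using assms by (intro pol_sum) (auto intro!: pol_intros simp: keys_plus_nat split: if_splits)

lemma ff_pol_Suc: "i < n \<Longrightarrow> ff u i \<in> pol (Suc i)"
  unfolding ff_def using B_less by (intro pol_intros qp_pol_Suc) auto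

lemma ff_tri: "i < n \<Longrightarrow> m \<in> keys (ff u i) \<Longrightarrow> keys m \<subseteq> {..i}"
  using ff_pol_Suc[of i u] by (simp add: pol_def lessThan_Suc_atMost)

lemma ff_hom:
  assumes "i < n" "m \<in> keys (ff u i)"
  shows "wt d m = d i * NN u i"
proof -
  have "homog d (d i * D i j) (qp i j)" if j: "j < n" for j
    unfolding homog_def
  proof
    fix m assume "m \<in> keys (qp i j)"
    then obtain r s where "t (mu ! i) (mu ! j) (r, s) \<noteq> 0" "m = single i r + single j s"
      using keys_qp[OF assms(1) j] by blast
    then show "wt d m = d i * D i j" using thom[OF assms(1) j] by (simp add: wt_add)
  qed
  then have "homog d (\<Sum>j\<in>B u i. d i * D i j) (\<Prod>j\<in>B u i. qp i j)"
    using B_less assms by (intro homog_prod finite_B) fastforce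
  moreover have "homog d (d i * L (mu ! i)) (xv i ^ L (mu ! i) :: 'k mpl)"
    by (simp add: homog_def keys_xv_power)
  ultimately have "homog d (d i * L (mu ! i) + (\<Sum>j\<in>B u i. d i * D i j)) (ff u i)"
    unfolding ff_def by (intro homog_mult)
  then show ?thesis using assms(2) by (simp add: homog_def NN_def distrib_left sum_distrib_left)
qed

text \<open>Every factor \<open>qp\<close> is fixed by a sign change of odd variables, so only the
  power of x_i can contribute a sign.\<close>

lemma theta_ff:
  assumes "i < n" "S \<subseteq> Collect par"
  obtains s :: 'k where "s * s = 1" "theta S (ff u i) = cst s * ff u i"
proof -
  have "theta S (\<Prod>j\<in>B u i. qp i j) = (\<Prod>j\<in>B u i. qp i j)"
    unfolding theta_prod using assms B_less by (intro prod.cong refl theta_qp) fastforce+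
  then have "theta S (ff u i) = cst (esign S (single i (L (mu ! i)))) * ff u i"
    unfolding ff_def by (simp add: theta_mult xv_power theta_mon mult.assoc)
  then show ?thesis using that esign_square by blast
qed

lemma W_theta:
  assumes "p \<in> W u" "S \<subseteq> Collect par"
  shows "theta S p \<in> W u"
  using assms(1)
proof (induction p rule: span_ideal_induct)
  case (base i m c)
  obtain s :: 'k where s: "theta S (ff u i) = cst s * ff u i" using theta_ff[OF base(1) assms(2)] by blast
  have "theta S (cst c * mon m * ff u i) = (cst c * (cst (esign S m) * mon m) * cst s) * ff u i"
    by (simp add: theta_mult theta_mon s mult.assoc)
  then show ?case using base by (simp only:) (intro span_ideal_mult span_ideal_base pol_intros)
qed (auto simp: theta_add intro: span_ideal_zero span_ideal_add)

lemma B_swap: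
  assumes x: "x permutes {..<n}" and a: "Suc a < n"
  shows "j \<in> B (x \<circ> sref a) i \<longleftrightarrow> (if {i, j} = {x a, x (Suc a)} then j < i \<and> j \<notin> B x i else j \<in> B x i)"
proof (cases "j < i")
  case True
  have inv: "inv x k = p \<longleftrightarrow> k = x p" for k p using x permutes_inverses by metis
  have ne: "inv x j \<noteq> inv x i" using permutes_neq[OF permutes_inv[OF x]] True by auto
  then have "j \<in> B (x \<circ> sref a) i \<longleftrightarrow> (if {inv x j, inv x i} = {a, Suc a} then inv x i < inv x j else inv x j < inv x i)"
    using True by (simp add: B_def inv_comp_sref[OF x a] sref_less)
  moreover have "{inv x j, inv x i} = {a, Suc a} \<longleftrightarrow> {i, j} = {x a, x (Suc a)}"
    by (auto simp: doubleton_eq_iff inv)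
  ultimately show ?thesis using True ne by (auto simp: B_def)
qed (simp add: B_def)

lemma in_B_adjacent:
  assumes x: "x permutes {..<n}"
  shows "x a \<in> B x (x (Suc a)) \<longleftrightarrow> x a < x (Suc a)" "x (Suc a) \<notin> B x (x a)"
proof -
  have "inv x (x p) = p" for p using x permutes_inverses by metis
  then show "x a \<in> B x (x (Suc a)) \<longleftrightarrow> x a < x (Suc a)" "x (Suc a) \<notin> B x (x a)" by (auto simp: B_def)
qed

lemma ff_swap_other:
  assumes "x permutes {..<n}" "Suc a < n" "i \<noteq> max (x a) (x (Suc a))"
  shows "ff (x \<circ> sref a) i = ff x i"
proof -
  have "B (x \<circ> sref a) i = B x i"
    using B_swap[OF assms(1,2), of _ i] assms(3) B_less by (fastforce simp: doubleton_eq_iff max_def split: if_splits)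
  then show ?thesis by (simp add: ff_def)
qed

text \<open>At an ascent the left strand precedes the right one in both orders. Crossing them
  removes it from \<open>B\<close>, and the generator of the right strand loses one factor
  Q.\<close>

lemma ff_swap_ascent:
  assumes x: "x permutes {..<n}" and a: "Suc a < n" and lt: "x a < x (Suc a)"
  shows "ff x (x (Suc a)) = qp (x (Suc a)) (x a) * ff (x \<circ> sref a) (x (Suc a))"
proof -
  have "j \<in> B (x \<circ> sref a) (x (Suc a)) \<longleftrightarrow> j \<in> B x (x (Suc a)) - {x a}" for j
    using B_swap[OF x a, of j "x (Suc a)"] in_B_adjacent[OF x, of a] lt by (auto simp: doubleton_eq_iff)
  then have "B (x \<circ> sref a) (x (Suc a)) = B x (x (Suc a)) - {x a}" by blast
  moreover have "x a \<in> B x (x (Suc a))" using in_B_adjacent[OF x] lt by simp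
  ultimately have "(\<Prod>j\<in>B x (x (Suc a)). qp (x (Suc a)) j)
      = qp (x (Suc a)) (x a) * (\<Prod>j\<in>B (x \<circ> sref a) (x (Suc a)). qp (x (Suc a)) j)"
    using finite_B by (simp add: prod.remove)
  then show ?thesis by (simp add: ff_def ac_simps)
qed

text \<open>The strand that moves right keeps its generator exactly: at a first crossing neither
  side changes, and at a crossing back the factor Q supplied is the one that was missing. An
  inclusion would not be enough to reach the generators themselves.\<close>

lemma ff_swap_right:
  assumes x: "x permutes {..<n}" and a: "Suc a < n"
  shows "qf (x a) (x (Suc a)) * ff x (x a) = ff (x \<circ> sref a) (x a)"
proof (cases "x a < x (Suc a)")
  case True
  then show ?thesis using ff_swap_other[OF x a, of "x a"] by (simp add: qf_def)
next
  case False
  then have "x (Suc a) < x a" using permutes_neq[OF x, of a "Suc a"] by simp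
  then have "ff (x \<circ> sref a) (x a) = qp (x a) (x (Suc a)) * ff x (x a)"
    using ff_swap_ascent[OF permutes_comp_sref[OF x a] a] by simp
  then show ?thesis using False by (simp add: qf_def)
qed

text \<open>Only the generator of the larger strand changes. At a first crossing it is a multiple of
  the new one; at a crossing back it lacks a factor Q, which the crossing contributes.\<close>

lemma W_swap:
  assumes x: "x permutes {..<n}" and a: "Suc a < n" and p: "p \<in> W x"
  shows "qf (x a) (x (Suc a)) * p \<in> W (x \<circ> sref a)"
proof -
  have lt: "x a < n" "x (Suc a) < n" using permutes_less[OF x] a by auto
  have base: "qf (x a) (x (Suc a)) * ff x i \<in> W (x \<circ> sref a)" if i: "i < n" for i
  proof (cases "i = max (x a) (x (Suc a))")
    case False
    then show ?thesis using span_ideal_mult[OF span_ideal_base[OF i] qf_pol[OF lt], of "ff (x \<circ> sref a)"]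
      by (simp add: ff_swap_other[OF x a])
  next
    case True
    show ?thesis
    proof (cases "x a < x (Suc a)")
      case True
      then have "qf (x a) (x (Suc a)) * ff x i = qp i (x a) * ff (x \<circ> sref a) i"
        using ff_swap_ascent[OF x a True] \<open>i = _\<close> by (simp add: qf_def)
      then show ?thesis using span_ideal_mult[OF span_ideal_base[OF i] qp_pol[OF i lt(1)]] by simp
    next
      case False
      then have "i = x a" using True by simp
      then show ?thesis using ff_swap_right[OF x a] span_ideal_base[OF i, of "ff (x \<circ> sref a)"] by simp
    qed
  qed
  from p show ?thesis
  proof (induction p rule: span_ideal_induct)
    case (base i m c)
    have "qf (x a) (x (Suc a)) * (cst c * mon m * ff x i) = (cst c * mon m) * (qf (x a) (x (Suc a)) * ff x i)"
      by (simp add: ac_simps)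
    then show ?case using base by (simp only:) (intro span_ideal_mult \<open>\<And>i. i < n \<Longrightarrow> _ \<in> W (x \<circ> sref a)\<close> pol_intros)
  qed (auto simp: distrib_left intro: span_ideal_zero span_ideal_add)
qed

section \<open>Upper bound: the cyclotomic ideal acts into the polynomial ideals\<close>

definition Wm :: "((nat \<Rightarrow> nat) \<Rightarrow> 'k mpl) set" where
  "Wm = {v \<in> Vs. \<forall>u. v u \<in> W u}"

lemma act_Wm:
  assumes "v \<in> Wm" "g \<in> G"
  shows "act g v \<in> Wm"
proof -
  have vV: "v \<in> Vs" and vW: "\<And>u. v u \<in> W u" using assms(1) by (auto simp: Wm_def)
  have "act g v u \<in> W u" for u
  proof -
    consider nu where "g = E nu" | p where "g = X p" "p < n" | a where "g = T a" "Suc a < n"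
      using assms(2) by (auto simp: QH_gens_def)
    then show ?thesis
    proof cases
      case 1
      then show ?thesis using vW by (simp add: Eop_def span_ideal_zero)
    next
      case 2
      show ?thesis
      proof (cases "u permutes {..<n}")
        case True
        then show ?thesis unfolding 2(1) act.simps Xop_def
          by (intro span_ideal_mult W_theta vW before_odd_par pol_xv permutes_less[OF True 2(2)])
      next
        case False
        then show ?thesis using vV 2 by (simp add: Vs_def Xop_def span_ideal_zero)
      qed
    next
      case 3
      let ?x = "u \<circ> sref a"
      show ?thesis
      proof (cases "?x permutes {..<n}")
        case True
        have "qf (?x a) (?x (Suc a)) * theta (cross_odd ?x a) (v ?x) \<in> W (?x \<circ> sref a)"
          by (intro W_swap True 3 W_theta vW cross_odd_par)
        then have "cst (kap ?x a) * (qf (?x a) (?x (Suc a)) * theta (cross_odd ?x a) (v ?x)) \<in> W u"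
          using span_ideal_mult[OF _ pol_cst] by (simp only: comp_sref_sref)
        then show ?thesis unfolding 3(1) act.simps Top_def Tco_def by (simp only: mult.assoc)
      next
        case False
        then show ?thesis using vV 3 by (simp add: Vs_def Top_def span_ideal_zero)
      qed
    qed
  qed
  then show ?thesis using act_Vs[OF vV assms(2)] by (simp add: Wm_def)
qed

lemma actw_Wm: "v \<in> Wm \<Longrightarrow> set w \<subseteq> G \<Longrightarrow> actw w v \<in> Wm"
  by (induction w) (auto intro: act_Wm)

lemma Wm_add: "v \<in> Wm \<Longrightarrow> w \<in> Wm \<Longrightarrow> (\<lambda>u. v u + w u) \<in> Wm"
  by (auto simp: Wm_def Vs_def intro: span_ideal_add pol_add)

lemma Wm_cst: "v \<in> Wm \<Longrightarrow> (\<lambda>u. cst c * v u) \<in> Wm"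
  by (auto simp: Wm_def Vs_def intro: span_ideal_mult pol_mult pol_cst)

lemma Wm_zero: "(\<lambda>u. 0) \<in> Wm"
  by (auto simp: Wm_def Vs_def intro: span_ideal_zero pol_zero)

lemma actp_Wm:
  assumes "v \<in> Wm" "p \<in> galg G"
  shows "actp p v \<in> Wm"
  using assms(2)
proof (induction p rule: galg_induct)
  case zero
  have "actp 0 v = (\<lambda>u. 0)" by (simp add: fun_eq_iff actp_zero)
  then show ?case by (simp add: Wm_zero)
next
  case (word w c)
  have "actp (sc c * wd w) v = (\<lambda>u. cst c * actw w v u)" by (simp add: fun_eq_iff actp_sc actp_wd)
  then show ?case using Wm_cst[OF actw_Wm[OF assms(1) word]] by simp
next
  case (add p q)
  have "actp (p + q) v = (\<lambda>u. actp p v u + actp q v u)" by (simp add: fun_eq_iff actp_add)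
  then show ?case using Wm_add add by simp
qed

lemma inv_at_0: "u permutes {..<n} \<Longrightarrow> inv u (u p) = p"
  using permutes_inverses by metis

lemma B_first: "u permutes {..<n} \<Longrightarrow> B u (u 0) = {}"
  by (simp add: B_def inv_at_0)

text \<open>At \<open>u\<close> only the idempotent of \<open>permute_list u mu\<close> survives.
  Its leftmost strand \<open>u 0\<close> has nothing to its left, so \<open>B u (u 0)\<close> is
  empty and the power imposed by the relation is exactly \<open>ff u (u 0)\<close>.\<close>

lemma act_cyc:
  assumes "n \<noteq> 0" "v \<in> Vs"
  shows "actp (\<Sum>nu\<in>Ib. wd (xmon 0 (L (nu ! 0)) @ [E nu])) v u \<in> W u"
proof (cases "u permutes {..<n}")
  case True
  have c: "actp (wd (xmon 0 (L (nu ! 0)) @ [E nu])) v u \<in> W u" for nu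
  proof (cases "nu = permute_list u mu")
    case nu: True
    have "nu ! 0 = mu ! u 0" using permute_list_nth'[OF True] assms(1) nu by simp
    then have "ff u (u 0) = xv (u 0) ^ L (nu ! 0)" by (simp add: ff_def B_first[OF True])
    moreover have "u 0 < n" using permutes_less[OF True] assms(1) by simp
    ultimately have *: "xv (u 0) ^ L (nu ! 0) \<in> W u" using span_ideal_base by metis
    have "v u \<in> pol n" using assms(2) by (simp add: Vs_def)
    then have "(if odd (L (nu ! 0)) then theta (before_odd (u 0)) (v u) else v u) \<in> pol n"
      by (auto intro: theta_pol)
    from span_ideal_mult[OF * this]
    have "xv (u 0) ^ L (nu ! 0) * (if odd (L (nu ! 0)) then theta (before_odd (u 0)) (v u) else v u) \<in> W u"
      by (simp only: mult.commute)
    moreover have "Eop nu v u = v u" using nu by (simp add: Eop_def)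
    ultimately show ?thesis
      by (simp only: actp_wd actw_append actw_xmon actw_Cons actw_Nil act.simps)
  next
    case False
    then have "Eop nu v u = 0" by (auto simp: Eop_def)
    then show ?thesis by (simp add: actp_wd actw_append actw_xmon span_ideal_zero)
  qed
  have "(\<Sum>nu\<in>A. actp (wd (xmon 0 (L (nu ! 0)) @ [E nu])) v u) \<in> W u" for A
    by (induction A rule: infinite_finite_induct) (auto intro: span_ideal_zero span_ideal_add c)
  then show ?thesis by (simp add: actp_sum)
next
  case False
  then have "v u = 0" using assms(2) by (simp add: Vs_def)
  then have "Eop nu v u = 0" for nu by (simp add: Eop_def)
  then show ?thesis
    by (simp add: actp_sum actp_wd actw_append actw_xmon span_ideal_zero cong: if_cong)
qed

lemma actp_sc_apply: "actp (sc c) v u = cst c * v u"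
  using actp_sc[of c 1 v u] actp_wd[of "[]" v] by simp

text \<open>In a product w r w' the right factor stays in \<open>Vs\<close>, the relation then gives
  0 or lands in \<open>Wm\<close>, and the left factor keeps it there.\<close>

lemma act_J:
  assumes "y \<in> J" "v \<in> Vs"
  shows "actp y v \<in> Wm"
  using assms(1) unfolding J_def
proof (induction rule: ideal_gen.induct)
  case zero
  have "actp 0 v = (\<lambda>u. 0)" by (simp add: fun_eq_iff actp_zero)
  then show ?case by (simp add: Wm_zero)
next
  case (step f r w w' c)
  have v': "actw w' v \<in> Vs" using step actw_Vs assms(2) by blast
  have r: "r \<in> galg G" using step rels_galg by blast
  have "actp r (actw w' v) u \<in> W u" for u
    using step(2)
  proof
    assume "r \<in> qh_rels Iodd t n Ib"
    then show ?thesis using act_rel v' by (simp add: span_ideal_zero)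
  next
    assume "r \<in> cyc_ring L n Ib"
    then show ?thesis using act_cyc v' by (auto simp: cyc_ring_def split: if_splits)
  qed
  then have "actp r (actw w' v) \<in> Wm" using actp_Vs[OF v' r] by (simp add: Wm_def)
  then have "actw w (actp r (actw w' v)) \<in> Wm" using step by (intro actw_Wm)
  then have "(\<lambda>u. actp f v u + cst c * actw w (actp r (actw w' v)) u) \<in> Wm"
    using step by (intro Wm_add Wm_cst)
  moreover have "actp (f + sc c * (wd w * r * wd w')) v
      = (\<lambda>u. actp f v u + cst c * actw w (actp r (actw w' v)) u)"
    by (simp add: fun_eq_iff actp_add actp_sc_apply actp_mult actp_wd)
  ultimately show ?case by simp
qed

section \<open>Lower bound: every element of the polynomial ideals is reached\<close>

definition conc :: "(nat \<Rightarrow> nat) \<Rightarrow> 'k mpl \<Rightarrow> (nat \<Rightarrow> nat) \<Rightarrow> 'k mpl" where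
  "conc x q = (\<lambda>u. if u = x then q else 0)"

lemma conc_same [simp]: "conc x q x = q"
  by (simp add: conc_def)

lemma conc_other: "u \<noteq> x \<Longrightarrow> conc x q u = 0"
  by (simp add: conc_def)

lemma delta_conc: "delta = conc id 1"
  by (rule ext) (simp add: conc_def delta_def)

lemma Top_conc: "Top a (conc x q) = conc (x \<circ> sref a) (Tco x a * theta (cross_odd x a) q)"
proof
  fix u
  show "Top a (conc x q) u = conc (x \<circ> sref a) (Tco x a * theta (cross_odd x a) q) u"
  proof (cases "u = x \<circ> sref a")
    case True
    then show ?thesis by (simp only: Top_apply conc_same)
  next
    case False
    then have "u \<circ> sref a \<noteq> x" by (metis comp_sref_sref)
    then show ?thesis using False by (simp add: Top_def conc_other)
  qed
qed

lemma Xop_conc: "Xop p (conc x q) = conc x (xv (x p) * theta (before_odd (x p)) q)"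
  by (rule ext) (simp add: Xop_def conc_def)

lemma xmon_conc: "actw (xmon p r) (conc x q)
  = conc x (xv (x p) ^ r * (if odd r then theta (before_odd (x p)) q else q))"
  by (rule ext) (simp add: actw_xmon conc_def)

lemma Eop_conc: "Eop nu (conc x q) = (if permute_list x mu = nu then conc x q else (\<lambda>_. 0))"
  by (rule ext) (auto simp: Eop_def conc_def)

text \<open>First crossings contribute no Q, so such a word acts by one sign and one sign change of
  odd variables.\<close>

lemma ascending_act:
  assumes "ascending_word n as"
  shows "\<exists>s S. s * s = 1 \<and> S \<subseteq> Collect par \<and>
    (\<forall>q. actw (map T as) (conc id q) = conc (inv (word_perm as)) (cst s * theta S q))"
  using assms
proof (induction as)
  case Nil
  have "inv (word_perm []) = id" by (simp add: word_perm_def)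
  then show ?case by (intro exI[of _ 1] exI[of _ "{}"]) simp
next
  case (Cons a as)
  define x where "x = inv (word_perm as)"
  have "ascending_word n as" using Cons.prems by simp
  from Cons.IH[OF this] obtain s S where IH: "s * s = 1" "S \<subseteq> Collect par"
    "\<And>q. actw (map T as) (conc id q) = conc x (cst s * theta S q)"
    unfolding x_def by blast
  have lt: "x a < x (Suc a)" and a: "\<forall>b\<in>set (a # as). Suc b < n"
    using Cons.prems ascending_word_set by (auto simp: x_def)
  have x: "inv (word_perm (a # as)) = x \<circ> sref a" unfolding x_def by (rule inv_word_perm_Cons[OF a])
  \<comment> \<open>Sign changes of variables compose by symmetric difference of the sets.\<close>
  define S' where "S' = (S - cross_odd x a) \<union> (cross_odd x a - S)"
  have e: "esign (cross_odd x a) m * esign S m = (esign S' m :: 'k)" for m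
  proof -
    have "even (wt (\<lambda>j. if j \<in> cross_odd x a then 1 else 0) m + wt (\<lambda>j. if j \<in> S then 1 else 0) m
      + wt (\<lambda>j. if j \<in> S' then 1 else 0) m)"
      unfolding wt_def sum.distrib[symmetric] by (rule dvd_sum) (auto simp: S'_def)
    then have "(-1 :: 'k) ^ (wt (\<lambda>j. if j \<in> cross_odd x a then 1 else 0) m + wt (\<lambda>j. if j \<in> S then 1 else 0) m)
        = (-1) ^ wt (\<lambda>j. if j \<in> S' then 1 else 0) m"
      by (metis (no_types, lifting) even_add neg_one_even_power neg_one_odd_power)
    then show ?thesis by (simp add: esign_def power_add)
  qed
  have th: "theta (cross_odd x a) (theta S q) = theta S' q" for q :: "'k mpl"
    by (rule poly_mapping_eqI) (simp add: lookup_theta e flip: mult.assoc)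
  have "actw (map T (a # as)) (conc id q) = conc (x \<circ> sref a) (cst (kap x a * s) * theta S' q)" for q
    using lt by (simp add: IH Top_conc Tco_def qf_def theta_mult th cst_mult mult.assoc)
  moreover have "kap x a * s * (kap x a * s) = 1"
  proof -
    have "kap x a * s * (kap x a * s) = (kap x a * kap x a) * (s * s)" by (simp only: ac_simps)
    then show ?thesis by (simp add: kap_square IH(1))
  qed
  moreover have "S' \<subseteq> Collect par" unfolding S'_def using IH(2) cross_odd_par by blast
  ultimately show ?case unfolding x by blast
qed

text \<open>Stable under all generators because \<open>J\<close> absorbs multiplication on the left;
  new members are obtained by acting on old ones.\<close>

definition RJ :: "((nat \<Rightarrow> nat) \<Rightarrow> 'k mpl) set" where
  "RJ = {v. \<exists>y\<in>J. actp y delta = v}"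

lemma RJ_add: "v \<in> RJ \<Longrightarrow> w \<in> RJ \<Longrightarrow> (\<lambda>u. v u + w u) \<in> RJ"
proof -
  assume "v \<in> RJ" "w \<in> RJ"
  then obtain y z where "y \<in> J" "actp y delta = v" "z \<in> J" "actp z delta = w" by (auto simp: RJ_def)
  then show ?thesis unfolding RJ_def
    by (intro CollectI bexI[of _ "y + z"]) (auto simp: fun_eq_iff actp_add J_add)
qed

lemma RJ_cst: "v \<in> RJ \<Longrightarrow> (\<lambda>u. cst c * v u) \<in> RJ"
proof -
  assume "v \<in> RJ"
  then obtain y where "y \<in> J" "actp y delta = v" by (auto simp: RJ_def)
  then show ?thesis unfolding RJ_def
    by (intro CollectI bexI[of _ "sc c * y"]) (auto simp: fun_eq_iff actp_sc J_sc)
qed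

lemma RJ_act: "v \<in> RJ \<Longrightarrow> g \<in> G \<Longrightarrow> act g v \<in> RJ"
proof -
  assume "v \<in> RJ" and g: "g \<in> G"
  then obtain y where "y \<in> J" "actp y delta = v" by (auto simp: RJ_def)
  then show ?thesis unfolding RJ_def using g
    by (intro CollectI bexI[of _ "wd [g] * y"]) (auto simp: actp_mult actp_wd intro!: J_left galg_wd)
qed

lemma RJ_zero: "(\<lambda>_. 0) \<in> RJ"
  unfolding RJ_def by (intro CollectI bexI[of _ 0]) (auto simp: fun_eq_iff actp_zero J_zero)

lemma RJ_conc_cst:
  assumes "conc u (cst s * q) \<in> RJ" "s * s = 1"
  shows "conc u q \<in> RJ"
proof -
  have "(\<lambda>z. cst s * conc u (cst s * q) z) = conc u q"
    using assms(2) by (auto simp: conc_def fun_eq_iff simp flip: mult.assoc cst_mult)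
  then show ?thesis using RJ_cst[OF assms(1), of s] by simp
qed

lemma cyc_E_in_J:
  assumes "n \<noteq> 0" "nu \<in> Ib"
  shows "wd (xmon 0 (L (nu ! 0)) @ [E nu]) \<in> J"
proof -
  let ?c = "\<Sum>nu\<in>Ib. wd (xmon 0 (L (nu ! 0)) @ [E nu]) :: ('i, 'k) falg"
  have xg: "wd (xmon 0 r) \<in> galg G" for r using assms(1) by (intro galg_wd) (auto simp: xmon_def QH_gens_def)
  have "?c \<in> J" unfolding J_def using assms(1) by (intro ideal_gen_base) (simp add: cyc_ring_def)
  then have 1: "?c * wd [E nu] \<in> J" by (intro J_right wdE assms)
  have "?c * wd [E nu] = (\<Sum>nu'\<in>Ib. wd (xmon 0 (L (nu' ! 0))) * wd [E nu', E nu])"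
    unfolding sum_distrib_right by (intro sum.cong refl) (simp flip: wd_append)
  also have "\<dots> \<approx> (\<Sum>nu'\<in>Ib. wd (xmon 0 (L (nu' ! 0))) * (if nu' = nu then wd [E nu] else 0))"
    by (intro eqv_sum eqv_left xg eqv_rel qh_rels.idem assms)
  also have "\<dots> = (\<Sum>nu'\<in>Ib. if nu' = nu then wd (xmon 0 (L (nu ! 0)) @ [E nu]) else 0)"
    by (intro sum.cong refl) (auto simp: wd_append)
  also have "\<dots> = wd (xmon 0 (L (nu ! 0)) @ [E nu])" using assms(2) finite_Ib by simp
  finally have "?c * wd [E nu] - wd (xmon 0 (L (nu ! 0)) @ [E nu]) \<in> J"
    by (simp add: eqv_def J0_subset_J)
  from J_diff[OF 1 this] show ?thesis by simp
qed

text \<open>At the far left the cyclotomic relation gives the generator of a strand directly.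
  Crossing the strand with its right neighbour then carries the generator along, with no surplus
  factor by \<open>ff_swap_right\<close>.\<close>

lemma ff_realised:
  assumes "u permutes {..<n}" "p < n"
  shows "conc u (ff u (u p)) \<in> RJ"
  using assms
proof (induction p arbitrary: u)
  case 0
  \<comment> \<open>The order \<open>u\<close> is reached from \<open>mu\<close> by first crossings
    only, so nothing but a sign is picked up before the relation is applied.\<close>
  obtain as where as: "ascending_word n as" "inv (word_perm as) = u"
    using ascending_word_exists[OF 0(1)] by blast
  obtain s S where s: "s * s = 1" "S \<subseteq> Collect par"
    "\<And>q. actw (map T as) (conc id q) = conc u (cst s * theta S q)"
    using ascending_act[OF as(1), unfolded as(2)] by blast
  let ?nu = "permute_list u mu"
  have nu: "?nu \<in> Ib" using 0 by (auto simp: Ib_iff)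
  let ?y = "wd (xmon 0 (L (?nu ! 0)) @ [E ?nu]) * wd (map T as)"
  have "?y \<in> J" using 0 nu ascending_word_set[OF as(1)]
    by (intro J_right cyc_E_in_J galg_wd) (auto simp: QH_gens_def)
  moreover have "?nu ! 0 = mu ! u 0" using permute_list_nth'[OF 0] .
  moreover have "actp ?y delta = conc u (cst s * ff u (u 0))"
    unfolding actp_mult actp_wd delta_conc s(3) actw_append
    by (simp add: Eop_conc xmon_conc theta_mult ff_def B_first[OF 0(1)] \<open>?nu ! 0 = mu ! u 0\<close> mult.commute)
  ultimately have "conc u (cst s * ff u (u 0)) \<in> RJ" unfolding RJ_def by blast
  then show ?case using RJ_conc_cst s(1) by blast
next
  case (Suc p)
  define x where "x = u \<circ> sref p"
  have x: "x permutes {..<n}" "x p = u (Suc p)" "x \<circ> sref p = u"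
    using Suc.prems permutes_comp_sref by (auto simp: x_def)
  have i: "u (Suc p) < n" using Suc.prems permutes_less by blast
  have "p < n" using Suc.prems by simp
  then have "conc x (ff x (x p)) \<in> RJ" by (rule Suc.IH[OF x(1)])
  then have "Top p (conc x (ff x (x p))) \<in> RJ"
    using RJ_act[of _ "T p"] Suc.prems gens(3) by simp
  moreover obtain s :: 'k where s: "s * s = 1" "theta (cross_odd x p) (ff x (x p)) = cst s * ff x (x p)"
    using theta_ff[OF _ cross_odd_par] i x(2) by metis
  have "Tco x p * theta (cross_odd x p) (ff x (x p)) = cst (kap x p * s) * (qf (x p) (x (Suc p)) * ff x (x p))"
    by (simp add: Tco_def s(2) cst_mult ac_simps)
  then have "Top p (conc x (ff x (x p))) = conc u (cst (kap x p * s) * ff u (u (Suc p)))"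
    unfolding Top_conc x(3) x(2) by (simp add: ff_swap_right[OF x(1) Suc.prems(2), unfolded x(2,3)])
  moreover have "kap x p * s * (kap x p * s) = 1"
  proof -
    have "kap x p * s * (kap x p * s) = (kap x p * kap x p) * (s * s)" by (simp only: ac_simps)
    then show ?thesis by (simp add: kap_square s(1))
  qed
  ultimately show ?case using RJ_conc_cst by metis
qed

text \<open>A dot multiplies by the variable of the strand at its position, so x_j is reached
  through position \<open>inv u j\<close>. The signs met on the way have square 1 and are removed by
  \<open>RJ_conc_cst\<close>.\<close>

lemma mon_ff_realised:
  assumes u: "u permutes {..<n}" and i: "i < n" and m: "keys m \<subseteq> {..<n}"
  shows "conc u (mon m * ff u i) \<in> RJ"
  using m
proof (induction "wt (\<lambda>_. 1) m" arbitrary: m rule: less_induct)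
  case less
  show ?case
  proof (cases "m = 0")
    case True
    have "u (inv u i) = i" "inv u i < n"
      using u i permutes_inverses(1) permutes_less[OF permutes_inv[OF u]] by metis+
    then show ?thesis using ff_realised[OF u, of "inv u i"] True by simp
  next
    case False
    then obtain j where j: "j \<in> keys m" by (metis keys_eq_empty ex_in_conv)
    then have "1 \<le> lookup m j" by (simp add: in_keys_iff)
    then obtain m' where m': "m = single j 1 + m'" using mon_split by blast
    have k: "keys m' \<subseteq> {..<n}" "j < n" using less.prems j m' by (auto simp: keys_plus_nat)
    have "wt (\<lambda>_. 1) m' < wt (\<lambda>_. 1) m" using m' by (simp add: wt_add)
    then have IH: "conc u (mon m' * ff u i) \<in> RJ" using less k by blast
    define p where "p = inv u j"
    have p: "u p = j" "p < n"
      unfolding p_def using u k(2) permutes_inverses(1) permutes_less[OF permutes_inv[OF u]] by metis+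
    have "Xop p (conc u (mon m' * ff u i)) \<in> RJ" using RJ_act[OF IH gens(2)[OF p(2)]] by simp
    moreover obtain s :: 'k where s: "s * s = 1" "theta (before_odd j) (ff u i) = cst s * ff u i"
      using theta_ff[OF i before_odd_par] by blast
    have "Xop p (conc u (mon m' * ff u i)) = conc u (cst (esign (before_odd j) m' * s) * (mon m * ff u i))"
      by (simp add: Xop_conc p theta_mult theta_mon s(2) m' mon_add cst_mult xv_def ac_simps)
    moreover have "esign (before_odd j) m' * s * (esign (before_odd j) m' * s) = 1"
    proof -
      have "esign (before_odd j) m' * s * (esign (before_odd j) m' * s)
          = (esign (before_odd j) m' * esign (before_odd j) m') * (s * s)" by (simp only: ac_simps)
      then show ?thesis by (simp add: esign_square s(1))
    qed
    ultimately show ?thesis using RJ_conc_cst by metis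
  qed
qed

lemma conc_W_realised:
  assumes "u permutes {..<n}" "p \<in> W u"
  shows "conc u p \<in> RJ"
  using assms(2)
proof (induction p rule: span_ideal_induct)
  case zero
  have "conc u 0 = (\<lambda>_. 0)" by (auto simp: conc_def)
  then show ?case using RJ_zero by simp
next
  case (base i m c)
  have "conc u (cst c * mon m * ff u i) = (\<lambda>z. cst c * conc u (mon m * ff u i) z)"
    by (auto simp: conc_def mult.assoc)
  then show ?case using RJ_cst[OF mon_ff_realised[OF assms(1) base]] by simp
next
  case (add p q)
  have "conc u (p + q) = (\<lambda>z. conc u p z + conc u q z)" by (auto simp: conc_def)
  then show ?case using RJ_add add by simp
qed

lemma Wm_realised:
  assumes "v \<in> Wm"
  shows "v \<in> RJ"
proof -
  have fin: "finite {u. u permutes {..<n}}" by (simp add: finite_permutations)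
  have "(\<lambda>z. \<Sum>u\<in>A. conc u (v u) z) \<in> RJ" if "finite A" "A \<subseteq> {u. u permutes {..<n}}" for A
    using that
  proof (induction A rule: finite_induct)
    case (insert u A)
    then show ?case using RJ_add[OF conc_W_realised[of u "v u"]] assms by (auto simp: Wm_def)
  qed (simp add: RJ_zero)
  from this[OF fin subset_refl] have "(\<lambda>z. \<Sum>u\<in>{u. u permutes {..<n}}. conc u (v u) z) \<in> RJ" .
  moreover have "(\<Sum>u\<in>{u. u permutes {..<n}}. conc u (v u) z) = v z" for z
    using fin assms by (auto simp: conc_def Wm_def Vs_def)
  ultimately show ?thesis by simp
qed

text \<open>The corner \<open>e(nu) R e(mu)\<close> is thereby identified with polynomials modulo \<open>W u\<close>,
  where \<open>nu = permute_list u mu\<close>.\<close>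

theorem in_J_iff:
  assumes "x \<in> galg G"
  shows "x * wd [E mu] \<in> J \<longleftrightarrow> (\<forall>u. actp x delta u \<in> W u)"
proof
  assume "x * wd [E mu] \<in> J"
  then have "actp (x * wd [E mu]) delta \<in> Wm" using act_J delta_Vs by blast
  then show "\<forall>u. actp x delta u \<in> W u" by (simp add: actp_mult actp_wd Eop_delta Wm_def)
next
  assume "\<forall>u. actp x delta u \<in> W u"
  then have "actp x delta \<in> Wm" using actp_Vs[OF delta_Vs assms] by (simp add: Wm_def)
  \<comment> \<open>A preimage \<open>y\<close> in the ideal acts on \<open>delta\<close> like
    \<open>x\<close>, so faithfulness puts the difference, times e(mu), into the ideal of the
    relations without the cyclotomic one.\<close>
  then obtain y where y: "y \<in> J" "actp y delta = actp x delta" using Wm_realised by (auto simp: RJ_def)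
  have "(x - y) * wd [E mu] \<in> J0"
    using y by (intro faithful galg_diff assms J_galg) (auto simp: actp_diff)
  from J_add[OF J0_subset_J[OF this] J_right[OF wdE[OF mu_Ib] y(1)]]
  have "(x - y) * wd [E mu] + y * wd [E mu] \<in> J" .
  then show "x * wd [E mu] \<in> J" by (simp add: left_diff_distrib)
qed

end

section \<open>Bases of the corners\<close>

context column
begin

definition reduced_mon :: "(nat \<Rightarrow> nat) \<Rightarrow> (nat \<Rightarrow>\<^sub>0 nat) set" where
  "reduced_mon u = {m. keys m \<subseteq> {..<n} \<and> (\<forall>i<n. lookup m i < NN u i)}"

lemma monomial_reduce_ff:
  assumes "keys m \<subseteq> {..<n}"
  shows "\<exists>r. mon m - r \<in> W u \<and>
    (\<forall>m'\<in>keys r. keys m' \<subseteq> {..<n} \<and> (\<forall>i<n. lookup m' i < NN u i) \<and> wt d m' = wt d m)"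
  by (rule monomial_reduce[OF _ _ _ _ assms]) (use ff_lead ff_tri ff_hom dpos in blast)+

lemma reduced_exists:
  assumes "q \<in> pol n"
  shows "\<exists>r. q - r \<in> W u \<and> keys r \<subseteq> reduced_mon u"
  using assms
proof (induction q rule: pol_induct)
  case zero
  show ?case by (intro exI[of _ 0]) (simp add: span_ideal_zero)
next
  case (mon m c)
  obtain r where r: "mon m - r \<in> W u"
    "\<forall>m'\<in>keys r. keys m' \<subseteq> {..<n} \<and> (\<forall>i<n. lookup m' i < NN u i) \<and> wt d m' = wt d m"
    using monomial_reduce_ff[OF mon] by blast
  have "cst c * mon m - cst c * r \<in> W u"
    using span_ideal_mult[OF r(1) pol_cst[of c]] by (simp add: right_diff_distrib)
  moreover have "keys (cst c * r) \<subseteq> keys r" by (auto simp: in_keys_iff lookup_cst_mult)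
  ultimately show ?case using r(2) by (intro exI[of _ "cst c * r"]) (auto simp: reduced_mon_def)
next
  case (add p q)
  then obtain r s where rs: "p - r \<in> W u" "keys r \<subseteq> reduced_mon u" "q - s \<in> W u" "keys s \<subseteq> reduced_mon u"
    by blast
  have "p + q - (r + s) \<in> W u" using span_ideal_add[OF rs(1,3)] by (simp add: algebra_simps)
  then show ?case using rs keys_add[of r s] by (intro exI[of _ "r + s"]) auto
qed

lemma reduced_in_W:
  assumes "r \<in> W u" "keys r \<subseteq> reduced_mon u"
  shows "r = 0"
proof -
  obtain g where g: "r = (\<Sum>i<n. g i * ff u i)" using assms(1) by (auto simp: span_ideal_def)
  show ?thesis unfolding g
    by (rule triangular_reduced_eq_0[where N = "NN u"])
      (use assms(2) g ff_lead ff_tri in \<open>auto simp: reduced_mon_def\<close>)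
qed

lemma basis_act:
  assumes "ascending_word n as"
  shows "\<exists>s. \<forall>m. keys m \<subseteq> {..<n} \<longrightarrow> s m * s m = 1 \<and>
    actp (wd (map T as @ xword (lookup m))) delta = conc (inv (word_perm as)) (cst (s m) * mon m)"
proof -
  obtain s S where s: "s * s = 1" "S \<subseteq> Collect par"
    "\<And>q. actw (map T as) (conc id q) = conc (inv (word_perm as)) (cst s * theta S q)"
    using ascending_act[OF assms] by blast
  have "s * esign S m * (s * esign S m) = 1" for m
  proof -
    have "s * esign S m * (s * esign S m) = (s * s) * (esign S m * esign S m)" by (simp only: ac_simps)
    then show ?thesis by (simp add: s esign_square)
  qed
  moreover have "actp (wd (map T as @ xword (lookup m))) delta
      = conc (inv (word_perm as)) (cst (s * esign S m) * mon m)" if "keys m \<subseteq> {..<n}" for m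
  proof -
    have "actw (xword (lookup m)) delta = conc id (mon m)"
      unfolding actw_xword_delta[OF that] conc_def ..
    then show ?thesis by (simp add: actp_wd actw_append s(3) theta_mon cst_mult mult.assoc)
  qed
  ultimately show ?thesis by (intro exI[of _ "\<lambda>m. s * esign S m"]) blast
qed

lemma to_fa_J_iff: "to_fa p \<in> to_fa ` J \<longleftrightarrow> p \<in> J"
  using inj_to_fa by (auto simp: image_iff)

text \<open>Up to signs the normal words act on \<open>delta\<close> as the reduced monomials
  concentrated at \<open>u\<close>. Independence and spanning thus become statements about
  polynomials modulo \<open>W u\<close>.\<close>

theorem quot_basis_column:
  assumes as: "ascending_word n as" and u: "u = inv (word_perm as)"
  shows "quot_basis (to_fa ` J) (corner G (to_fa ` J) (permute_list u mu) mu)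
    (exps n (\<lambda>k. int (NN u k))) (\<lambda>r. fa_word (basis_word n as r mu))"
proof -
  let ?nu = "permute_list u mu" and ?Ex = "exps n (\<lambda>k. int (NN u k))"
  let ?f = "\<lambda>r. wd (map T as @ xword r) :: ('i, 'k) falg"
  have up: "u permutes {..<n}"
    unfolding u by (intro permutes_inv word_perm_permutes ascending_word_set[OF as])
  have nu: "?nu \<in> Ib" using up by (auto simp: Ib_iff)
  obtain s where s: "\<And>m. keys m \<subseteq> {..<n} \<Longrightarrow> s m * s m = 1"
    "\<And>m. keys m \<subseteq> {..<n} \<Longrightarrow> actp (?f (lookup m)) delta = conc u (cst (s m) * mon m)"
    using basis_act[OF as] unfolding u by blast
  have fg: "?f r \<in> galg G" for r
    using ascending_word_set[OF as] set_xword X_image_G by (intro galg_wd) (fastforce simp: QH_gens_def)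
  have b: "fa_word (basis_word n as r mu) = to_fa (?f r * wd [E mu])" for r
    by (simp add: basis_word_def xword_def flip: wd_append to_fa_wd)
  \<comment> \<open>Passage from exponent functions to finitely supported exponents.
    \<open>Abs_poly_mapping\<close> is meaningful only for finite support, which \<open>exps\<close>
    guarantees by requiring 0 from n on.\<close>
  define M where "M r = (Abs_poly_mapping r :: nat \<Rightarrow>\<^sub>0 nat)" for r
  have lM: "lookup (M r) = r" if "r \<in> ?Ex" for r
  proof -
    have "{k. r k \<noteq> 0} \<subseteq> {..<n}" using that by (auto simp: exps_def) (metis not_less gr_implies_not0)
    then have "finite {k. r k \<noteq> 0}" by (rule finite_subset) simp
    then show ?thesis by (simp add: M_def)
  qed
  have kM: "keys (M r) \<subseteq> {..<n}" if "r \<in> ?Ex" for r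
    using that by (auto simp: in_keys_iff lM exps_def) (metis not_less gr_implies_not0)
  have bij: "bij_betw M ?Ex (reduced_mon u)"
  proof (rule bij_betwI[where g = lookup])
    show "M \<in> ?Ex \<rightarrow> reduced_mon u"
      using kM lM by (auto simp: reduced_mon_def) (auto simp: exps_def)
    show "lookup \<in> reduced_mon u \<rightarrow> ?Ex"
      by (auto simp: reduced_mon_def exps_def in_keys_iff)
    show "lookup (M r) = r" if "r \<in> ?Ex" for r using lM that by simp
    show "M (lookup m) = m" for m by (simp add: M_def)
  qed
  \<comment> \<open>Sums over infinite sets are 0 by convention, so coefficients can be read off
    only once the index set is known to be finite.\<close>
  have finR: "finite (reduced_mon u)"
  proof -
    have "reduced_mon u \<subseteq> {m. keys m \<subseteq> {..<n} \<and> (\<forall>i. lookup m i \<in> {..(\<Sum>i<n. NN u i)})}"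
    proof
      fix m assume m: "m \<in> reduced_mon u"
      have "lookup m i \<le> (\<Sum>i<n. NN u i)" for i
      proof (cases "i < n")
        case True
        then have "lookup m i < NN u i" using m by (simp add: reduced_mon_def)
        also have "\<dots> \<le> (\<Sum>i<n. NN u i)" using True by (intro member_le_sum) auto
        finally show ?thesis by simp
      next
        case False
        then have "lookup m i = 0" using m by (auto simp: reduced_mon_def in_keys_iff)
        then show ?thesis by simp
      qed
      then show "m \<in> {m. keys m \<subseteq> {..<n} \<and> (\<forall>i. lookup m i \<in> {..(\<Sum>i<n. NN u i)})}"
        using m by (simp add: reduced_mon_def)
    qed
    moreover have "finite {m :: nat \<Rightarrow>\<^sub>0 nat. keys m \<subseteq> {..<n} \<and> (\<forall>i. lookup m i \<in> {..N})}" for N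
    proof -
      have inj: "inj_on lookup {m :: nat \<Rightarrow>\<^sub>0 nat. keys m \<subseteq> {..<n} \<and> (\<forall>i. lookup m i \<in> {..N})}"
        by (auto simp: inj_on_def intro: poly_mapping_eqI)
      have sub: "lookup ` {m :: nat \<Rightarrow>\<^sub>0 nat. keys m \<subseteq> {..<n} \<and> (\<forall>i. lookup m i \<in> {..N})}
          \<subseteq> {f. \<forall>i. (i \<in> {..<n} \<longrightarrow> f i \<in> {..N}) \<and> (i \<notin> {..<n} \<longrightarrow> f i = 0)}"
        by (auto simp: in_keys_iff)
      have fin: "finite {f :: nat \<Rightarrow> nat. \<forall>i. (i \<in> {..<n} \<longrightarrow> f i \<in> {..N}) \<and> (i \<notin> {..<n} \<longrightarrow> f i = 0)}"
        by (rule finite_set_of_finite_funs) auto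
      show ?thesis by (rule finite_imageD[OF finite_subset[OF sub fin] inj])
    qed
    ultimately show ?thesis using finite_subset by blast
  qed
  have s2: "actp (?f r) delta = conc u (cst (s (M r)) * mon (M r))" if "r \<in> ?Ex" for r
    using s(2)[OF kM[OF that]] lM[OF that] by simp
  have act_sum: "actp (\<Sum>r\<in>?Ex. sc (c r) * ?f r) delta
      = conc u (\<Sum>m\<in>reduced_mon u. cst (c (lookup m) * s m) * mon m)" for c
  proof -
    have "actp (\<Sum>r\<in>?Ex. sc (c r) * ?f r) delta = (\<lambda>z. \<Sum>r\<in>?Ex. cst (c r) * actp (?f (lookup (M r))) delta z)"
      by (rule ext) (simp add: actp_sum actp_sc lM)
    also have "\<dots> = (\<lambda>z. \<Sum>r\<in>?Ex. cst (c (lookup (M r))) * conc u (cst (s (M r)) * mon (M r)) z)"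
      by (intro ext sum.cong refl) (simp add: lM s2)
    also have "\<dots> = (\<lambda>z. \<Sum>m\<in>reduced_mon u. cst (c (lookup m)) * conc u (cst (s m) * mon m) z)"
      by (intro ext sum.reindex_bij_betw[OF bij])
    also have "\<dots> = conc u (\<Sum>m\<in>reduced_mon u. cst (c (lookup m) * s m) * mon m)"
      by (rule ext) (simp add: conc_def cst_mult mult.assoc)
    finally show ?thesis .
  qed
  have lk: "lookup (\<Sum>m\<in>reduced_mon u. cst (c m) * mon m) m = (if m \<in> reduced_mon u then c m else 0)" for c :: "_ \<Rightarrow> 'k" and m
    using finR by (simp add: lookup_sum lookup_cst_mult mon_def lookup_single when_def
        if_distrib[of "times _"] cong: if_cong)
  have sumg: "(\<Sum>r\<in>?Ex. sc (c r) * ?f r) \<in> galg G" for c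
    by (intro galg_sum galg_sc_mult fg)
  have fas: "fa_sum (\<lambda>r. fa_smul (c r) (fa_word (basis_word n as r mu))) ?Ex
      = to_fa ((\<Sum>r\<in>?Ex. sc (c r) * ?f r) * wd [E mu])" for c
  proof -
    have "(\<Sum>r\<in>?Ex. sc (c r) * ?f r) * wd [E mu] = (\<Sum>r\<in>?Ex. sc (c r) * (?f r * wd [E mu]))"
      by (simp add: sum_distrib_right mult.assoc)
    then show ?thesis unfolding b by (simp add: to_fa_sum to_fa_sc del: mult.assoc)
  qed
  show ?thesis unfolding quot_basis_def
  proof (intro conjI ballI allI impI)
    fix r assume r: "r \<in> ?Ex"
    have "actp (?f r - wd [E ?nu] * ?f r) delta z \<in> W z" for z
    proof -
      have "actp (?f r) delta = conc u (cst (s (M r)) * mon (M r))" using s(2)[OF kM[OF r]] lM[OF r] by simp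
      then have "actp (?f r - wd [E ?nu] * ?f r) delta z = 0"
        by (simp add: actp_diff actp_mult actp_wd[of "[E ?nu]"] Eop_conc)
      then show ?thesis by (simp add: span_ideal_zero)
    qed
    then have "(?f r - wd [E ?nu] * ?f r) * wd [E mu] \<in> J"
      by (subst in_J_iff) (auto intro!: galg_diff galg_mult wdE nu fg)
    then have "to_fa (?f r * wd [E mu] - wd [E ?nu] * ?f r * wd [E mu]) \<in> to_fa ` J"
      unfolding to_fa_J_iff by (simp only: left_diff_distrib)
    then have "fa_diff (fa_word (basis_word n as r mu))
        (fa_mult (fa_mult (fa_word [E ?nu]) (to_fa (?f r))) (fa_word [E mu])) \<in> to_fa ` J"
      by (simp only: b to_fa_diff to_fa_mult to_fa_wd)
    moreover have "to_fa (?f r) \<in> fa_elems G" "(fa_word (basis_word n as r mu) :: ('i, 'k) fa) \<in> fa_elems G"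
      unfolding fa_elems_eq b by (intro imageI fg galg_mult wdE mu_Ib)+
    ultimately show "fa_word (basis_word n as r mu) \<in> corner G (to_fa ` J) ?nu mu"
      unfolding corner_def by blast
  next
    fix c r assume J: "fa_sum (\<lambda>r. fa_smul (c r) (fa_word (basis_word n as r mu))) ?Ex \<in> to_fa ` J"
      and r: "r \<in> ?Ex"
    let ?p = "\<Sum>m\<in>reduced_mon u. cst (c (lookup m) * s m) * mon m"
    have "(\<Sum>r\<in>?Ex. sc (c r) * ?f r) * wd [E mu] \<in> J" using J unfolding fas to_fa_J_iff .
    then have "actp (\<Sum>r\<in>?Ex. sc (c r) * ?f r) delta u \<in> W u" unfolding in_J_iff[OF sumg] by blast
    then have "?p \<in> W u" unfolding act_sum by simp
    moreover have "keys ?p \<subseteq> reduced_mon u" using lk[of "\<lambda>m. c (lookup m) * s m"] by (auto simp: in_keys_iff split: if_splits)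
    ultimately have "?p = 0" by (rule reduced_in_W)
    moreover have "M r \<in> reduced_mon u" using bij r by (auto simp: bij_betw_def)
    ultimately have "c r * s (M r) = 0" using lk[of "\<lambda>m. c (lookup m) * s m" "M r"] lM[OF r] by simp
    moreover have "s (M r) \<noteq> 0" using s(1)[OF kM[OF r]] by auto
    ultimately show "c r = 0" by simp
  next
    fix g assume "g \<in> corner G (to_fa ` J) ?nu mu"
    then obtain g' f where gf: "g' \<in> galg G" "g = to_fa g'" "f \<in> galg G"
      "fa_diff g (fa_mult (fa_mult (fa_word [E ?nu]) (to_fa f)) (fa_word [E mu])) \<in> to_fa ` J"
      unfolding corner_def fa_elems_eq by blast
    have "to_fa (g' - wd [E ?nu] * f * wd [E mu]) \<in> to_fa ` J"
      using gf(2,4) by (simp only: to_fa_diff to_fa_mult to_fa_wd)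
    then have 1: "g' - wd [E ?nu] * f * wd [E mu] \<in> J" unfolding to_fa_J_iff .
    define q where "q = actp f delta u"
    have fV: "actp f delta \<in> Vs" using actp_Vs[OF delta_Vs gf(3)] .
    have q: "q \<in> pol n" using fV by (simp add: q_def Vs_def)
    \<comment> \<open>The idempotent on the left selects one sequence, hence one permutation, so a
      corner element is concentrated at \<open>u\<close>.\<close>
    have Ef: "actp (wd [E ?nu] * f) delta = conc u q"
    proof
      fix z
      have "z = u" if "permute_list z mu = ?nu" "actp f delta z \<noteq> 0"
        using that fV up permute_list_inj by (auto simp: Vs_def)
      then show "actp (wd [E ?nu] * f) delta z = conc u q z"
        by (auto simp: actp_mult actp_wd Eop_def conc_def q_def)
    qed
    obtain r where r: "q - r \<in> W u" "keys r \<subseteq> reduced_mon u" using reduced_exists[OF q] by blast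
    \<comment> \<open>The signs \<open>s\<close> are their own inverses, so the same factor
      compensates them.\<close>
    define c where "c x = lookup r (M x) * s (M x)" for x
    have "(\<Sum>m\<in>reduced_mon u. cst (c (lookup m) * s m) * mon m) = r"
    proof (rule poly_mapping_eqI)
      fix m
      have "c (lookup m) * s m = lookup r m" if "m \<in> reduced_mon u"
      proof -
        have "s m * s m = 1" using that s(1) by (auto simp: reduced_mon_def)
        then show ?thesis by (simp add: c_def M_def mult.assoc)
      qed
      then show "lookup (\<Sum>m\<in>reduced_mon u. cst (c (lookup m) * s m) * mon m) m = lookup r m"
        using r(2) unfolding lk[of "\<lambda>m. c (lookup m) * s m"] by (auto simp: in_keys_iff)
    qed
    then have "actp (wd [E ?nu] * f - (\<Sum>r\<in>?Ex. sc (c r) * ?f r)) delta z = conc u (q - r) z" for z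
      unfolding actp_diff Ef act_sum by (simp add: conc_def)
    moreover have "conc u (q - r) z \<in> W z" for z using r(1) by (auto simp: conc_def span_ideal_zero)
    ultimately have "(wd [E ?nu] * f - (\<Sum>r\<in>?Ex. sc (c r) * ?f r)) * wd [E mu] \<in> J"
      using in_J_iff[OF galg_diff[OF galg_mult[OF wdE[OF nu] gf(3)] sumg[of c]]] by simp
    from J_add[OF 1 this] have "g' - (\<Sum>r\<in>?Ex. sc (c r) * ?f r) * wd [E mu] \<in> J"
      by (simp add: left_diff_distrib)
    then have "to_fa (g' - (\<Sum>r\<in>?Ex. sc (c r) * ?f r) * wd [E mu]) \<in> to_fa ` J"
      unfolding to_fa_J_iff .
    then have "fa_diff g (fa_sum (\<lambda>r. fa_smul (c r) (fa_word (basis_word n as r mu))) ?Ex) \<in> to_fa ` J"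
      unfolding fas to_fa_diff gf(2) .
    then show "\<exists>c. fa_diff g (fa_sum (\<lambda>r. fa_smul (c r) (fa_word (basis_word n as r mu))) ?Ex) \<in> to_fa ` J"
      by blast
  qed
qed

section \<open>Indecomposability\<close>

text \<open>A generator with leading degree 0 is a nonzero constant, so \<open>W id\<close> contains
  1.\<close>

lemma E_in_J_if_NN_0:
  assumes "i < n" "NN id i = 0"
  shows "wd [E mu] \<in> J"
proof -
  have l: "lead_in i 0 (ff id i)" using ff_lead[OF assms(1), of id] assms(2) by simp
  define c where "c = lookup (ff id i) 0"
  have c: "c \<noteq> 0" using l by (simp add: lead_in_def c_def)
  have "ff id i = cst c"
  proof (rule poly_mapping_eqI)
    fix m
    show "lookup (ff id i) m = lookup (cst c) m"
      using l by (cases "m = 0") (auto simp: cst_def c_def lookup_single when_def lead_in_def in_keys_iff)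
  qed
  then have "cst (inverse c) * ff id i = 1" using c by (simp flip: cst_mult)
  moreover have "cst (inverse c) * ff id i \<in> W id"
    by (intro span_ideal_mult span_ideal_base assms(1) pol_cst)
  ultimately have "1 \<in> W id" by (simp only:)
  moreover have "actp 1 delta = delta" using actp_wd[of "[]" delta] by simp
  ultimately have "\<forall>u. actp 1 delta u \<in> W u" by (simp add: delta_def span_ideal_zero)
  then show ?thesis using in_J_iff[OF galg_one] by simp
qed

text \<open>With all bounds positive, 1 is a reduced monomial; an ascending word for
  \<open>u\<close> acts as a sign times it, which is not in \<open>W u\<close>.\<close>

lemma corner_nonzero:
  assumes u: "u permutes {..<n}" and pos: "\<And>i. i < n \<Longrightarrow> NN u i > 0"
  shows "\<exists>f\<in>galg G. wd [E (permute_list u mu)] * f * wd [E mu] \<notin> J"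
proof -
  obtain as where as: "ascending_word n as" "inv (word_perm as) = u"
    using ascending_word_exists[OF u] by blast
  obtain s where s: "s 0 * s 0 = 1" "actp (wd (map T as @ xword (lookup 0))) delta = conc u (cst (s 0) * mon 0)"
    using basis_act[OF as(1)] unfolding as(2) by force
  let ?f = "wd (map T as @ xword (lookup 0)) :: ('i, 'k) falg"
  have f: "?f \<in> galg G"
    using ascending_word_set[OF as(1)] set_xword X_image_G by (intro galg_wd) (fastforce simp: QH_gens_def)
  have nu: "permute_list u mu \<in> Ib" using u by (auto simp: Ib_iff)
  have "wd [E (permute_list u mu)] * ?f * wd [E mu] \<notin> J"
  proof
    assume "wd [E (permute_list u mu)] * ?f * wd [E mu] \<in> J"
    then have "actp (wd [E (permute_list u mu)] * ?f) delta u \<in> W u"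
      using in_J_iff[OF galg_mult[OF wdE[OF nu] f]] by blast
    then have "cst (s 0) \<in> W u" by (simp add: actp_mult actp_wd[of "[E _]"] s(2) Eop_conc)
    moreover have "keys (cst (s 0) :: 'k mpl) \<subseteq> reduced_mon u" using pos by (auto simp: cst_def reduced_mon_def)
    ultimately have "cst (s 0) = (0 :: 'k mpl)" by (rule reduced_in_W)
    then have "lookup (cst (s 0)) 0 = (0 :: 'k)" by simp
    then show False using s(1) by (simp add: cst_def)
  qed
  then show ?thesis using f by blast
qed

section \<open>The weight filtration, standing in for a grading of the diagonal corner\<close>

definition wpol :: "nat \<Rightarrow> 'k mpl set" where
  "wpol k = {p \<in> pol n. \<forall>m\<in>keys p. k \<le> wt d m}"

lemma wpol_add: "p \<in> wpol k \<Longrightarrow> q \<in> wpol k \<Longrightarrow> p + q \<in> wpol k"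
  unfolding wpol_def using keys_add[of p q] by (auto intro: pol_add)

lemma wpol_mult: "p \<in> wpol k \<Longrightarrow> q \<in> wpol l \<Longrightarrow> p * q \<in> wpol (k + l)"
  unfolding wpol_def using keys_mult[of p q] by (fastforce intro: pol_mult simp: wt_add add_mono)

lemma wpol_theta: "p \<in> wpol k \<Longrightarrow> theta S p \<in> wpol k"
  by (simp add: wpol_def keys_theta theta_pol)

lemma wpol_mon: "keys m \<subseteq> {..<n} \<Longrightarrow> mon m \<in> wpol (wt d m)"
  by (auto simp: wpol_def mon_def pol_def)

lemma wpol_0: "wpol 0 = pol n"
  by (auto simp: wpol_def)

lemma wpol_cst: "p \<in> wpol k \<Longrightarrow> cst c * p \<in> wpol k"
  using wpol_mult[of "cst c" 0 p k] by (simp add: wpol_0 pol_cst)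

lemma wpol_zero: "0 \<in> wpol k"
  by (simp add: wpol_def pol_zero)

lemma wpol_mono: "p \<in> wpol k \<Longrightarrow> l \<le> k \<Longrightarrow> p \<in> wpol l"
  by (auto simp: wpol_def)

text \<open>Reduction preserves the weight, and a reduced monomial weighs at most the sum of the
  \<open>d i * NN u i\<close>. A heavier monomial therefore has remainder 0.\<close>

lemma wpol_large: "wpol (Suc (\<Sum>i<n. d i * NN u i)) \<subseteq> W u"
proof
  fix p assume p: "p \<in> wpol (Suc (\<Sum>i<n. d i * NN u i))"
  have mon: "mon m \<in> W u" if m: "m \<in> keys p" for m
  proof -
    have k: "keys m \<subseteq> {..<n}" using p m by (auto simp: wpol_def pol_def)
    obtain r where r: "mon m - r \<in> W u"
      "\<forall>m'\<in>keys r. keys m' \<subseteq> {..<n} \<and> (\<forall>i<n. lookup m' i < NN u i) \<and> wt d m' = wt d m"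
      using monomial_reduce_ff[OF k] by blast
    have "keys r = {}"
    proof (rule ccontr)
      assume "keys r \<noteq> {}"
      then obtain m' where m': "m' \<in> keys r" by blast
      have "wt d m' = (\<Sum>i<n. d i * lookup m' i)" using r(2) m' by (intro wt_eq_sum) auto
      also have "\<dots> \<le> (\<Sum>i<n. d i * NN u i)"
        using r(2) m' by (intro sum_mono mult_left_mono) (auto intro: less_imp_le)
      finally show False using r(2) m' p m by (fastforce simp: wpol_def)
    qed
    then show ?thesis using r(1) by simp
  qed
  show "p \<in> W u"
    by (rule poly_mapping_induct_keys[of p "{m. mon m \<in> W u}"])
      (use mon in \<open>auto simp: single_eq_cst_mon intro: span_ideal_zero span_ideal_add span_ideal_mult pol_cst\<close>)
qed

lemma xmon_wpol:
  assumes "v u \<in> wpol k" "p < n" and u: "\<And>p. u p = p"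
  shows "actw (xmon p r) v u \<in> wpol (k + d p * r)"
proof -
  have "(if odd r then theta (before_odd p) (v u) else v u) \<in> wpol k" using assms by (simp add: wpol_theta)
  moreover have "xv p ^ r \<in> wpol (d p * r)"
    using wpol_mon[of "single p r"] assms(2) by (simp add: xv_power split: if_splits)
  ultimately have "xv p ^ r * (if odd r then theta (before_odd p) (v u) else v u) \<in> wpol (d p * r + k)"
    by (intro wpol_mult)
  then show ?thesis unfolding actw_xmon u by (simp only: add.commute)
qed

lemma xword_wpol:
  assumes "v u \<in> wpol k" "keys m \<subseteq> {..<n}" and u: "\<And>p. u p = p"
  shows "actw (xword (lookup m)) v u \<in> wpol (k + wt d m)"
proof -
  have *: "actw (concat (map (\<lambda>k. xmon k (r k)) ks)) v u \<in> wpol (k + (\<Sum>k\<leftarrow>ks. d k * r k))"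
    if "set ks \<subseteq> {..<n}" for ks r
    using that
  proof (induction ks)
    case (Cons p ks)
    then have "actw (xmon p (r p)) (actw (concat (map (\<lambda>k. xmon k (r k)) ks)) v) u
        \<in> wpol (k + (\<Sum>k\<leftarrow>ks. d k * r k) + d p * r p)"
      by (intro xmon_wpol u) auto
    then show ?case by (simp add: actw_append ac_simps)
  qed (simp add: assms(1))
  have "(\<Sum>k\<leftarrow>[0..<n]. d k * lookup m k) = wt d m"
    using wt_eq_sum[OF assms(2), of d] by (simp add: sum_list_distinct_conv_sum_set atLeast0LessThan)
  then show ?thesis using *[of "[0..<n]" "lookup m"] by (simp add: xword_def atLeast0LessThan)
qed

text \<open>Dots only multiply by variables and change signs, so they add weight; in the identity
  order strand and position agree.\<close>

lemma Xi_wpol: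
  assumes v: "v u \<in> wpol k" and q: "q \<in> wpol l" and u: "\<And>p. u p = p"
  shows "actp (Xi q) v u \<in> wpol (k + l)"
proof -
  have *: "actp (sc (lookup q m) * wd (xword (lookup m) @ [E mu])) v u \<in> wpol (k + l)" if m: "m \<in> keys q" for m
  proof -
    have km: "keys m \<subseteq> {..<n}" "l \<le> wt d m" using q m by (auto simp: wpol_def pol_def)
    have "Eop mu v u = v u" by (simp add: Eop_def permute_list_def u map_nth)
    then have "actw (xword (lookup m)) (Eop mu v) u \<in> wpol (k + wt d m)"
      using v km by (intro xword_wpol u) auto
    then have "actw (xword (lookup m)) (Eop mu v) u \<in> wpol (k + l)" using km(2) wpol_mono by fastforce
    then show ?thesis by (simp add: actp_sc actp_wd actw_append wpol_cst)
  qed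
  have sum: "sum F A \<in> wpol (k + l)" if "\<And>a. a \<in> A \<Longrightarrow> F a \<in> wpol (k + l)" for F and A :: "(nat \<Rightarrow>\<^sub>0 nat) set"
    using that by (induction A rule: infinite_finite_induct) (auto intro: wpol_zero wpol_add)
  show ?thesis unfolding Xi_def actp_sum by (rule sum) (rule *)
qed

section \<open>Central idempotents on one diagonal corner\<close>

definition central_idem :: "('i, 'k) falg \<Rightarrow> bool" where
  "central_idem z \<longleftrightarrow> z \<in> galg G \<and> (\<forall>f\<in>galg G. z * f - f * z \<in> J) \<and> z * z - z \<in> J"

lemma J_act_W: "y \<in> J \<Longrightarrow> v \<in> Vs \<Longrightarrow> actp y v u \<in> W u"
  using act_J by (auto simp: Wm_def)

lemma W_trans: "p - q \<in> W u \<Longrightarrow> q - r \<in> W u \<Longrightarrow> p - r \<in> W u"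
  using span_ideal_add[of "p - q" n "ff u" "q - r"] by simp

text \<open>Centrality gives e(nu) z e(mu) = z e(nu) e(mu), which is 0 for different
  sequences.\<close>

lemma central_off_diagonal:
  assumes z: "central_idem z" and "u \<noteq> id"
  shows "actp z delta u \<in> W u"
proof (cases "u permutes {..<n}")
  case True
  let ?nu = "permute_list u mu"
  have nu: "?nu \<in> Ib" using True by (auto simp: Ib_iff)
  have "?nu \<noteq> mu" using permute_list_inj[OF True permutes_id] assms(2) by auto
  then have 0: "Eop ?nu delta = (\<lambda>_. 0)" by (simp add: delta_conc Eop_conc)
  have "z * wd [E ?nu] - wd [E ?nu] * z \<in> J" using z wdE[OF nu] unfolding central_idem_def by blast
  from J_act_W[OF this delta_Vs, of u] have "- actp z delta u \<in> W u"
    by (simp add: actp_diff actp_mult actp_wd 0 actp_zero_right) (simp add: Eop_def)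
  then show ?thesis using span_ideal_uminus by fastforce
next
  case False
  have "actp z delta \<in> Vs" using z by (intro actp_Vs delta_Vs) (simp add: central_idem_def)
  then show ?thesis using False by (simp add: Vs_def span_ideal_zero)
qed

lemma actp_diff_right: "actp p (\<lambda>u. v u - w u) u = actp p v u - actp p w u"
  using actp_add_right[of p v "\<lambda>u. cst (-1) * w u" u] actp_cst_right[of p "-1" w u]
  by (simp add: cst_uminus)

text \<open>Writing v for z e(mu), the chain is v = z v = z q = q z e(mu) = q v: idempotency,
  replacement of v by its representative \<open>q\<close>, centrality. The replacement is legitimate
  under z because the off-diagonal components of v are already in the ideals.\<close>

lemma central_step:
  assumes z: "central_idem z" and q: "q \<in> pol n" "actp z delta id - q \<in> W id"
  shows "actp z delta id - actp (Xi q) (actp z delta) id \<in> W id"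
proof -
  have zg: "z \<in> galg G" using z by (simp add: central_idem_def)
  define v where "v = actp z delta"
  have vV: "v \<in> Vs" unfolding v_def by (intro actp_Vs delta_Vs zg)
  have cV: "conc id q \<in> Vs" using q by (auto simp: Vs_def conc_def pol_zero permutes_id)
  have "(\<lambda>u. v u - conc id q u) \<in> Wm"
    unfolding Wm_def
  proof (intro CollectI conjI allI)
    show "(\<lambda>u. v u - conc id q u) \<in> Vs"
      using vV cV by (auto simp: Vs_def intro!: pol_diff)
    show "v u - conc id q u \<in> W u" for u
    proof (cases "u = id")
      case True
      show ?thesis unfolding True conc_same v_def by (rule q(2))
    next
      case False
      then show ?thesis using central_off_diagonal[OF z False] by (simp add: v_def conc_other)
    qed
  qed
  from actp_Wm[OF this zg] have "actp z (\<lambda>u. v u - conc id q u) id \<in> W id" unfolding Wm_def by blast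
  then have 1: "actp z v id - actp z (conc id q) id \<in> W id" by (simp only: actp_diff_right)
  have "z * z - z \<in> J" using z by (simp add: central_idem_def)
  from J_act_W[OF this delta_Vs, of id] have "actp z v id - v id \<in> W id"
    by (simp add: actp_diff actp_mult v_def)
  then have 2: "v id - actp z v id \<in> W id" using span_ideal_uminus by fastforce
  have "z * Xi q - Xi q * z \<in> J" using z Xi_galg by (simp add: central_idem_def)
  from J_act_W[OF this delta_Vs, of id] have 3: "actp z (conc id q) id - actp (Xi q) v id \<in> W id"
    by (simp add: actp_diff actp_mult v_def actp_Xi_delta[OF q(1)] flip: conc_def)
  show ?thesis using W_trans[OF W_trans[OF 2 1] 3] by (simp add: v_def)
qed

text \<open>Each use of \<open>central_step\<close> multiplies the representative once more by an
  element of weight at least 1. After finitely many rounds it is heavy enough to lie in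
  \<open>W id\<close>.\<close>

lemma nilpotent_case:
  assumes z: "central_idem z" and v: "actp z delta id \<in> wpol 1"
  shows "z * wd [E mu] \<in> J"
proof -
  have "\<exists>q\<in>wpol (Suc k). actp z delta id - q \<in> W id" for k
  proof (induction k)
    case 0
    show ?case using v span_ideal_zero by (metis One_nat_def diff_self)
  next
    case (Suc k)
    then obtain q where q: "q \<in> wpol (Suc k)" "actp z delta id - q \<in> W id" by blast
    then have "q \<in> pol n" by (simp add: wpol_def)
    from central_step[OF z this q(2)] Xi_wpol[of "actp z delta" id 1 q "Suc k", OF v q(1) id_apply]
    show ?case by (metis plus_1_eq_Suc)
  qed
  then obtain q where "q \<in> wpol (Suc (\<Sum>i<n. d i * NN id i))" "actp z delta id - q \<in> W id" by blast
  then have "actp z delta id \<in> W id" using wpol_large span_ideal_add by fastforce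
  then have "\<forall>u. actp z delta u \<in> W u" using central_off_diagonal[OF z] by metis
  then show ?thesis using in_J_iff z by (simp add: central_idem_def)
qed

lemma wpol_1:
  assumes "p \<in> pol n" "lookup p 0 = 0"
  shows "p \<in> wpol 1"
  unfolding wpol_def
proof (intro CollectI conjI ballI assms)
  fix m assume m: "m \<in> keys p"
  then have "m \<noteq> 0" using assms(2) by (auto simp: in_keys_iff)
  then obtain j where j: "j \<in> keys m" by (metis keys_eq_empty ex_in_conv)
  have "j < n" using m j assms(1) by (auto simp: pol_def)
  then have "0 < d j * lookup m j" using dpos j by (simp add: in_keys_iff)
  also have "\<dots> \<le> wt d m" unfolding wt_def using j by (intro member_le_sum) auto
  finally show "1 \<le> wt d m" by simp
qed

lemma central_idem_one_minus:
  assumes "central_idem z"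
  shows "central_idem (1 - z)"
proof -
  have zg: "z \<in> galg G" and zc: "\<And>f. f \<in> galg G \<Longrightarrow> z * f - f * z \<in> J" and zz: "z * z - z \<in> J"
    using assms by (auto simp: central_idem_def)
  have "(1 - z) * f - f * (1 - z) \<in> J" if "f \<in> galg G" for f
    using J_diff[OF J_zero zc[OF that]] by (simp add: algebra_simps)
  moreover have "(1 - z) * (1 - z) - (1 - z) \<in> J" using zz by (simp add: algebra_simps)
  ultimately show ?thesis using zg by (auto simp: central_idem_def intro: galg_diff galg_one)
qed

text \<open>Decided by the constant term c of z e(mu). For c = 0 the element is nilpotent as well as
  idempotent, and for c = 1 the same holds for 1 - z. Any other c makes the nonzero scalar c - c^2
  congruent to a polynomial without constant term, which forces e(mu) to be 0.\<close>

lemma central_idem_dichotomy: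
  assumes z: "central_idem z"
  shows "z * wd [E mu] \<in> J \<or> (1 - z) * wd [E mu] \<in> J"
proof -
  have zg: "z \<in> galg G" using z by (simp add: central_idem_def)
  define v where "v = actp z delta"
  have vV: "v \<in> Vs" unfolding v_def by (intro actp_Vs delta_Vs zg)
  define c where "c = lookup (v id) 0"
  have vp: "v id \<in> pol n" using vV by (simp add: Vs_def)
  define q where "q = v id - cst c"
  have lc: "lookup (cst b) 0 = b" for b :: 'k by (simp add: cst_def)
  have q: "q \<in> wpol 1" unfolding q_def by (intro wpol_1 pol_diff vp pol_cst) (simp add: lookup_minus c_def lc)
  consider "c = 0" | "c = 1" | "c * c \<noteq> c" by (metis mult_cancel_right1 mult_cancel_left1)
  then show ?thesis
  proof cases
    case 1
    then have "v id \<in> wpol 1" using q by (simp add: q_def)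
    then show ?thesis using nilpotent_case[OF z] by (simp add: v_def)
  next
    case 2
    have "actp (1 - z) delta id = 1 - v id" using actp_wd[of "[]" delta] by (simp add: actp_diff v_def delta_def)
    also have "\<dots> = - q" using 2 by (simp add: q_def)
    finally have "actp (1 - z) delta id \<in> wpol 1" using wpol_cst[OF q, of "-1"] by (simp add: cst_uminus)
    then show ?thesis using nilpotent_case[OF central_idem_one_minus[OF z]] by simp
  next
    case 3
    \<comment> \<open>The part of v * v without constant term, v * v being realised as the normally
      ordered v acting on v.\<close>
    define w where "w = actp (Xi (v id)) v id - cst (c * c)"
    have "v id - v id \<in> W id" by (simp add: span_ideal_zero)
    then have "v id - actp (Xi (v id)) v id \<in> W id"
      using central_step[OF z vp, folded v_def] by blast
    then have w2: "v id - cst (c * c) - w \<in> W id" by (simp add: w_def)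
    have "w \<in> wpol 1" unfolding w_def
    proof -
      have "v id = cst c * mon 0 + q" by (simp add: q_def)
      then have "Xi (v id) = sc c * wd (xword (lookup 0) @ [E mu]) + Xi q"
        by (metis Xi_add Xi_cst_mon)
      moreover have "xword (lookup 0) = []" by (simp add: xword_def xmon_def)
      ultimately have "actp (Xi (v id)) v id = cst c * v id + actp (Xi q) v id"
        by (simp add: actp_add actp_sc actp_wd Eop_def)
      then have eq: "actp (Xi (v id)) v id - cst (c * c) = cst c * q + actp (Xi q) v id"
        by (simp add: q_def algebra_simps cst_mult)
      have "v id \<in> wpol 0" using vp by (simp add: wpol_0)
      from Xi_wpol[of v id 0 q 1, OF this q id_apply] show "actp (Xi (v id)) v id - cst (c * c) \<in> wpol 1"
        unfolding eq using wpol_add[OF wpol_cst[OF q, of c]] by simp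
    qed
    note w = this w2
    \<comment> \<open>Normalises c - c^2, so that the congruence reads 1 = p with \<open>p\<close>
      of weight at least 1.\<close>
    define b where "b = inverse (c - c * c)"
    have b: "b * (c - c * c) = 1" using 3 by (simp add: b_def)
    define p where "p = cst b * (w - q)"
    have p: "p \<in> wpol 1" unfolding p_def using wpol_cst[OF wpol_add[OF w(1) wpol_cst[OF q, of "-1"]], of b]
      by (simp add: cst_uminus)
    have "cst b * (v id - cst (c * c) - w) = cst (b * (c - c * c)) - p"
    proof -
      have "v id = cst c + q" by (simp add: q_def)
      moreover have "cst (b * (c - c * c)) = cst b * (cst c - cst (c * c))"
        by (simp only: cst_mult[of b]) (simp add: cst_def single_diff)
      ultimately show ?thesis unfolding p_def
        by (simp only:) (simp add: right_diff_distrib distrib_left)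
    qed
    then have one: "1 - p \<in> W id" using span_ideal_mult[OF w(2) pol_cst[of b]] b by simp
    \<comment> \<open>Multiplying by \<open>p\<close> again and again shows 1 congruent to
      polynomials of arbitrarily high weight.\<close>
    have "\<exists>q\<in>wpol k. 1 - q \<in> W id" for k
    proof (induction k)
      case 0
      show ?case by (intro bexI[of _ 1]) (auto simp: span_ideal_zero wpol_0 pol_one)
    next
      case (Suc k)
      then obtain q where q: "q \<in> wpol k" "1 - q \<in> W id" by blast
      have "q * (1 - p) \<in> W id" using q(1) by (intro span_ideal_mult one) (simp add: wpol_def)
      from span_ideal_add[OF q(2) this] have "1 - q * p \<in> W id" by (simp add: algebra_simps)
      moreover have "q * p \<in> wpol (Suc k)" using wpol_mult[OF q(1) p] by simp
      ultimately show ?case by blast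
    qed
    then obtain q where "q \<in> wpol (Suc (\<Sum>i<n. d i * NN id i))" "1 - q \<in> W id" by blast
    then have 1: "1 \<in> W id" using wpol_large span_ideal_add by fastforce
    have "\<forall>u. actp 1 delta u \<in> W u"
      using 1 actp_wd[of "[]" delta] by (simp add: delta_def span_ideal_zero)
    then have "wd [E mu] \<in> J" using in_J_iff[OF galg_one] by simp
    then show ?thesis using J_left[OF zg] by blast
  qed
qed

end

subsection \<open>Linking the orders\<close>

text \<open>The cycle that takes the entry at \<open>l\<close> out and reinserts it at
  \<open>k\<close>, shifting the entries between by one place. Its inverse \<open>mvi\<close> is
  written out because positions of strands are read from the inverse.\<close>

definition mv :: "nat \<Rightarrow> nat \<Rightarrow> nat \<Rightarrow> nat" where
  "mv k l q = (if q < k then q else if q = k then l else if q \<le> l then q - 1 else q)"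

definition mvi :: "nat \<Rightarrow> nat \<Rightarrow> nat \<Rightarrow> nat" where
  "mvi k l i = (if i < k then i else if i < l then Suc i else if i = l then k else i)"

lemma mv_mvi: "k \<le> l \<Longrightarrow> mv k l (mvi k l i) = i" and mvi_mv: "k \<le> l \<Longrightarrow> mvi k l (mv k l q) = q"
  by (auto simp: mv_def mvi_def)

lemma inv_mv: "k \<le> l \<Longrightarrow> inv (mv k l) = mvi k l"
  by (rule inv_equality) (simp_all add: mv_mvi mvi_mv)

lemma mv_permutes:
  assumes "k \<le> l" "l < n"
  shows "mv k l permutes {..<n}"
  unfolding permutes_def
proof (intro conjI allI impI)
  show "mv k l x = x" if "x \<notin> {..<n}" for x using that assms by (auto simp: mv_def)
  show "\<exists>!x. mv k l x = y" for y
    by (rule ex1I[of _ "mvi k l y"]) (use assms mv_mvi mvi_mv in auto)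
qed

text \<open>With \<open>adj\<close> meaning a negative Cartan entry, this is positivity of all
  \<open>NN id i\<close>.\<close>

definition good_order :: "('i \<Rightarrow> nat) \<Rightarrow> ('i \<Rightarrow> 'i \<Rightarrow> bool) \<Rightarrow> 'i list \<Rightarrow> bool" where
  "good_order L adj mu \<longleftrightarrow> (\<forall>i<length mu. L (mu ! i) > 0 \<or> (\<exists>j<i. adj (mu ! i) (mu ! j)))"

text \<open>Positivity of all \<open>NN u i\<close>, under which \<open>corner_nonzero\<close>
  applies: the neighbour has to come earlier in both orders.\<close>

definition linked :: "('i \<Rightarrow> nat) \<Rightarrow> ('i \<Rightarrow> 'i \<Rightarrow> bool) \<Rightarrow> 'i list \<Rightarrow> (nat \<Rightarrow> nat) \<Rightarrow> bool" where
  "linked L adj mu u \<longleftrightarrow>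
     (\<forall>i<length mu. L (mu ! i) > 0 \<or> (\<exists>j<i. inv u j < inv u i \<and> adj (mu ! i) (mu ! j)))"

text \<open>Two good orders that agree up to position \<open>k\<close> are connected by moving the entry of \<open>nu\<close> at
  position \<open>k\<close> forward in \<open>mu\<close>: its earlier neighbours in \<open>nu\<close> lie in the common prefix, and
  all other entries keep their predecessors.\<close>

lemma good_orders_linked:
  assumes step: "\<And>mu u. mset mu = M \<Longrightarrow> u permutes {..<length mu} \<Longrightarrow> linked L adj mu u \<Longrightarrow> St mu \<Longrightarrow>
      St (permute_list u mu)"
    and nu: "mset nu = M" "distinct nu" "good_order L adj nu"
    and mu: "mset mu = M" "good_order L adj mu" "St mu"
  shows "St nu"
proof -
  define n where "n = length nu"
  have main: "k \<le> n \<Longrightarrow> mset mu = M \<Longrightarrow> good_order L adj mu \<Longrightarrow> St mu \<Longrightarrow> take k mu = take k nu \<Longrightarrow> St nu"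
    for k mu
  proof (induction "n - k" arbitrary: k mu)
    case 0
    have "length mu = n" using 0 nu(1) by (metis n_def size_mset)
    then show ?case using 0 by (simp add: n_def)
  next
    case (Suc m)
    then have k: "k < n" by simp
    have len: "length mu = n" using Suc.prems nu(1) by (metis n_def size_mset)
    have pre: "mu ! i = nu ! i" if "i < k" for i using Suc.prems(5) that by (metis nth_take)
    have "nu ! k \<in> set mu" using k Suc.prems(2) nu(1) by (metis n_def nth_mem set_mset_mset)
    then obtain l where l: "l < n" "mu ! l = nu ! k" using len by (metis in_set_conv_nth)
    have kl: "k \<le> l"
    proof (rule ccontr)
      assume "\<not> k \<le> l"
      then have "nu ! l = nu ! k" "l \<noteq> k" using pre[of l] l by auto
      then show False using nu(2) k l(1) by (auto simp: n_def nth_eq_iff_index_eq)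
    qed
    define u where "u = mv k l"
    have u: "u permutes {..<n}" "inv u = mvi k l" unfolding u_def using mv_permutes inv_mv kl l(1) by auto
    have lk: "linked L adj mu u" unfolding linked_def len
    proof (intro allI impI)
      fix i assume i: "i < n"
      show "L (mu ! i) > 0 \<or> (\<exists>j<i. inv u j < inv u i \<and> adj (mu ! i) (mu ! j))"
      proof (cases "i = l")
        case False
        then have "inv u j < inv u i" if "j < i" for j
          using that kl unfolding u(2) by (auto simp: mvi_def)
        then show ?thesis using Suc.prems(3) i len by (auto simp: good_order_def)
      next
        case True
        have "L (nu ! k) > 0 \<or> (\<exists>j<k. adj (nu ! k) (nu ! j))" using nu(3) k by (simp add: good_order_def n_def)
        moreover have "j < l \<and> inv u j < inv u l" if "j < k" for j
          using that kl unfolding u(2) by (auto simp: mvi_def)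
        ultimately show ?thesis unfolding True l(2) using pre by metis
      qed
    qed
    define mu' where "mu' = permute_list u mu"
    have nth: "mu' ! i = mu ! u i" if "i < n" for i
      using permute_list_nth[of u mu i] u len that by (simp add: mu'_def)
    have len': "length mu' = n" by (simp add: mu'_def len)
    have "good_order L adj mu'" unfolding good_order_def len'
    proof (intro allI impI)
      fix i assume i: "i < n"
      have ui: "u i < n" "inv u (u i) = i" 
        by (rule permutes_less[OF u(1) i], rule permutes_inverses(2)[OF u(1)])
      \<comment> \<open>A neighbour that is earlier in both orders serves the new order as well, so
        \<open>linked\<close> hands goodness on to \<open>mu'\<close>.\<close>
      have "L (mu ! u i) > 0 \<or> (\<exists>j<u i. inv u j < inv u (u i) \<and> adj (mu ! u i) (mu ! j))"
        using lk ui(1) unfolding linked_def len by blast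
      then consider "L (mu ! u i) > 0" | j where "j < u i" "inv u j < i" "adj (mu ! u i) (mu ! j)"
        unfolding ui(2) by auto
      then show "L (mu' ! i) > 0 \<or> (\<exists>j<i. adj (mu' ! i) (mu' ! j))"
      proof cases
        case 2
        have "inv u j < n" using 2 i by simp
        then have "mu' ! inv u j = mu ! j" using nth[of "inv u j"] u(1) by (simp add: permutes_inverses)
        then show ?thesis using 2 nth[OF i] by metis
      qed (simp add: nth[OF i])
    qed
    moreover have "St mu'" unfolding mu'_def using step[OF Suc.prems(2) _ lk Suc.prems(4)] u len by simp
    moreover have "mset mu' = M" unfolding mu'_def using u len Suc.prems(2) by simp
    moreover have "take (Suc k) mu' = take (Suc k) nu"
    proof (rule nth_equalityI)
      show "length (take (Suc k) mu') = length (take (Suc k) nu)" using len' by (simp add: n_def)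
      fix i assume "i < length (take (Suc k) mu')"
      then have i: "i < Suc k" "i < n" using len' by auto
      then have "mu' ! i = nu ! i" using nth[OF i(2)] pre[of i] l(2) by (auto simp: u_def mv_def less_Suc_eq)
      then show "take (Suc k) mu' ! i = take (Suc k) nu ! i" using i by simp
    qed
    moreover have "m = n - Suc k" "Suc k \<le> n" using Suc.hyps(2) k by auto
    ultimately show ?case using Suc.hyps(1) by blast
  qed
  show ?thesis by (rule main[of 0 mu]) (use mu in auto)
qed

section \<open>The index set\<close>

lemma lookup_zscale: "lookup (zscale c x) k = c * lookup x k"
  by (simp add: zscale_def Poly_Mapping.map.rep_eq when_def)

lemma sum_alpha_eq:
  assumes "finite F" "set xs \<subseteq> F"
  shows "(\<Sum>s<length xs. alpha (xs ! s)) = (\<Sum>i\<in>F. zscale (int (count (mset xs) i)) (alpha i))"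
proof (rule poly_mapping_eqI)
  fix k
  have "(\<Sum>s<length xs. f (xs ! s)) = (\<Sum>i\<in>F. int (count (mset xs) i) * f i)" for f :: "'a \<Rightarrow> int"
    using assms(2)
  proof (induction xs)
    case (Cons a xs)
    have "(\<Sum>s<length (a # xs). f ((a # xs) ! s)) = f a + (\<Sum>s<length xs. f (xs ! s))"
      by (simp only: length_Cons sum.lessThan_Suc_shift nth_Cons_0 nth_Cons_Suc)
    also have "\<dots> = (\<Sum>i\<in>F. (if i = a then f i else 0) + int (count (mset xs) i) * f i)"
      using Cons assms(1) by (simp add: sum.distrib)
    also have "\<dots> = (\<Sum>i\<in>F. int (count (mset (a # xs)) i) * f i)"
      by (intro sum.cong refl) (auto simp: algebra_simps)
    finally show ?case .
  qed simp
  from this[of "\<lambda>i. lookup (alpha i) k"]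
  show "lookup (\<Sum>s<length xs. alpha (xs ! s)) k
    = lookup (\<Sum>i\<in>F. zscale (int (count (mset xs) i)) (alpha i)) k"
    by (simp add: lookup_sum lookup_zscale)
qed

text \<open>Linear independence recovers from a sum of simple roots how often each root
  occurs.\<close>

lemma Ibeta_eq:
  assumes indep: "zlin_indep I alpha" and js: "set js \<subseteq> I"
  shows "Ibeta I alpha (length js) (\<Sum>k<length js. alpha (js ! k)) = {nu. mset nu = mset js}"
proof (intro equalityI subsetI CollectI)
  fix nu assume "nu \<in> Ibeta I alpha (length js) (\<Sum>k<length js. alpha (js ! k))"
  then have nu: "length nu = length js" "set nu \<subseteq> I"
    "(\<Sum>s<length nu. alpha (nu ! s)) = (\<Sum>k<length js. alpha (js ! k))" by (auto simp: Ibeta_def)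
  let ?F = "set nu \<union> set js"
  let ?c = "\<lambda>i. int (count (mset nu) i) - int (count (mset js) i)"
  have "(\<Sum>i\<in>?F. zscale (?c i) (alpha i)) = (\<Sum>i\<in>?F. zscale (int (count (mset nu) i)) (alpha i))
      - (\<Sum>i\<in>?F. zscale (int (count (mset js) i)) (alpha i))"
    by (rule poly_mapping_eqI) (simp add: lookup_sum lookup_minus lookup_zscale left_diff_distrib sum_subtractf)
  also have "\<dots> = 0"
    using nu(3) sum_alpha_eq[of ?F nu alpha] sum_alpha_eq[of ?F js alpha] by simp
  finally have "(\<Sum>i\<in>?F. zscale (?c i) (alpha i)) = 0" .
  moreover have "finite ?F" "?F \<subseteq> I" using nu(2) js by auto
  ultimately have c: "\<forall>i\<in>?F. ?c i = 0"
    using indep[unfolded zlin_indep_def, THEN spec[of _ ?F], THEN spec[of _ ?c]] by blast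
  show "mset nu = mset js"
  proof (rule multiset_eqI)
    show "count (mset nu) i = count (mset js) i" for i
    proof (cases "i \<in> ?F")
      case True
      then show ?thesis using c by force
    next
      case False
      then show ?thesis by (metis UnI1 UnI2 count_eq_zero_iff set_mset_mset)
    qed
  qed
next
  fix nu assume "nu \<in> {nu. mset nu = mset js}"
  then have m: "mset nu = mset js" by simp
  then have s: "set nu = set js" "length nu = length js" using mset_eq_setD mset_eq_length by blast+
  show "nu \<in> Ibeta I alpha (length js) (\<Sum>k<length js. alpha (js ! k))"
    using s js sum_alpha_eq[of "set js" nu alpha] sum_alpha_eq[of "set js" js alpha] m
    by (auto simp: Ibeta_def)
qed

lemma (in column) Ib_mset: "Ib = {nu. mset nu = mset mu}"
proof (intro equalityI subsetI CollectI)
  show "mset nu = mset mu" if "nu \<in> Ib" for nu using that len by (auto simp: Ib_iff)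
next
  fix nu assume "nu \<in> {nu. mset nu = mset mu}"
  then obtain p where "p permutes {..<length mu}" "permute_list p mu = nu"
    using mset_eq_permutation[of nu mu] by auto
  then show "nu \<in> Ib" using len by (auto simp: Ib_iff)
qed

text \<open>With (alpha_i|alpha_i) = 2 d_i and (alpha_i|alpha_j) = d_i a_ij, half the degree
  condition on \<open>t\<close> is the homogeneity \<open>thom\<close>. Truncation by
  \<open>nat\<close> is harmless: Cartan entries are at most 0 off the diagonal, and on it
  \<open>t\<close> vanishes.\<close>

lemma column_of_superdatum:
  assumes cartan: "cartan_superdatum I A d alpha h Iodd" and form: "sym_bilinear_form I d alpha h bf"
    and Q: "Q_ok I A Iodd bf alpha t" and mu: "set mu \<subseteq> I" "distinct mu"
  shows "column (length mu) mu Iodd t (\<lambda>i j. nat (- A (mu ! i) (mu ! j))) (\<lambda>i. nat (d (mu ! i)))"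
proof
  have I: "mu ! i \<in> I" if "i < length mu" for i using mu that by auto
  have dp: "d i > 0" if "i \<in> I" for i using cartan that by (auto simp: cartan_superdatum_def)
  have bf: "bf (alpha i) (alpha j) = of_int (d i * A i j)" if "i \<in> I" "j \<in> I" for i j
    using cartan form that by (auto simp: cartan_superdatum_def sym_bilinear_form_def)
  show "length mu = length mu" "distinct mu" using mu by auto
  fix i j r s assume i: "i < length mu"
  show "nat (d (mu ! i)) > 0" using dp[OF I[OF i]] by simp
  assume j: "j < length mu"
  have Qij: "(t (mu ! i) (mu ! j) (r, s) \<noteq> 0 \<longrightarrow> - 2 * bf (alpha (mu ! i)) (alpha (mu ! j))
        - of_nat r * bf (alpha (mu ! i)) (alpha (mu ! i)) - of_nat s * bf (alpha (mu ! j)) (alpha (mu ! j)) = 0)"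
      "t (mu ! i) (mu ! j) (r, s) = t (mu ! j) (mu ! i) (s, r)"
      "mu ! i \<noteq> mu ! j \<longrightarrow> t (mu ! i) (mu ! j) (nat (- A (mu ! i) (mu ! j)), 0) \<noteq> 0"
      "mu ! i = mu ! j \<or> (mu ! i \<in> Iodd \<and> odd r) \<longrightarrow> t (mu ! i) (mu ! j) (r, s) = 0"
    using Q I[OF i] I[OF j] unfolding Q_ok_def by blast+
  show "t (mu ! i) (mu ! j) (r, s) = t (mu ! j) (mu ! i) (s, r)" by (rule Qij(2))
  show "t (mu ! i) (mu ! j) (nat (- A (mu ! i) (mu ! j)), 0) \<noteq> 0" if "i \<noteq> j"
    using Qij(3) that mu(2) i j by (simp add: nth_eq_iff_index_eq)
  show "t (mu ! i) (mu ! j) (r, s) = 0" if "mu ! i \<in> Iodd" "odd r" using Qij(4) that by blast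
  assume tn: "t (mu ! i) (mu ! j) (r, s) \<noteq> 0"
  let ?i = "mu ! i" and ?j = "mu ! j"
  have ne: "?i \<noteq> ?j" using tn Qij(4) by blast
  have A: "A ?i ?j \<le> 0" "A ?i ?i = 2" "A ?j ?j = 2"
    using cartan I[OF i] I[OF j] ne by (auto simp: cartan_superdatum_def)
  have "(of_int (- 2 * (d ?i * A ?i ?j) - int r * (d ?i * 2) - int s * (d ?j * 2)) :: rat) = 0"
    using Qij(1) tn bf[OF I[OF i] I[OF j]] bf[OF I[OF i] I[OF i]] bf[OF I[OF j] I[OF j]] A by simp
  then have "- 2 * (d ?i * A ?i ?j) - int r * (d ?i * 2) - int s * (d ?j * 2) = 0" by (simp only: of_int_eq_0_iff)
  then have eq: "d ?i * int r + d ?j * int s = d ?i * (- A ?i ?j)" by (simp add: algebra_simps)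
  have "int (nat (d ?i) * r + nat (d ?j) * s) = int (nat (d ?i) * nat (- A ?i ?j))"
    using eq dp[OF I[OF i]] dp[OF I[OF j]] A(1) by simp
  then show "nat (d ?i) * r + nat (d ?j) * s = nat (d ?i) * nat (- A ?i ?j)" by (simp only: of_nat_eq_iff)
qed

lemma additive_diff_sum:
  fixes f :: "'a::ab_group_add \<Rightarrow> int"
  assumes "\<And>x y. f (x + y) = f x + f y"
  shows "f (x - sum g B) = f x - (\<Sum>b\<in>B. f (g b))"
proof -
  have 0: "f 0 = 0" using assms[of 0 0] by simp
  have "f (sum g B) = (\<Sum>b\<in>B. f (g b))"
    by (induction B rule: infinite_finite_induct) (auto simp: 0 assms)
  moreover have "f (x - sum g B) + f (sum g B) = f x" using assms[of "x - sum g B" "sum g B"] by simp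
  ultimately show ?thesis by simp
qed

section \<open>Combining the columns of all sequences mu\<close>

theorem theorem1p9:
  fixes I :: "'i set" and A :: "'i \<Rightarrow> 'i \<Rightarrow> int" and d :: "'i \<Rightarrow> int"
    and alpha :: "'i \<Rightarrow> ('b \<Rightarrow>\<^sub>0 int)" and h :: "'i \<Rightarrow> ('b \<Rightarrow>\<^sub>0 int) \<Rightarrow> int"
    and Iodd :: "'i set" and bf :: "('b \<Rightarrow>\<^sub>0 int) \<Rightarrow> ('b \<Rightarrow>\<^sub>0 int) \<Rightarrow> rat"
    and t :: "'i \<Rightarrow> 'i \<Rightarrow> nat \<times> nat \<Rightarrow> 'k::field"
    and Lam :: "'b \<Rightarrow>\<^sub>0 int" and js :: "'i list"
  assumes char: "(2::'k) \<noteq> 0"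
    and cartan: "cartan_superdatum I A d alpha h Iodd"
    and form: "sym_bilinear_form I d alpha h bf"
    and Q: "Q_ok I A Iodd bf alpha t"
    and Lam: "dominant I h Lam"
    and js: "set js \<subseteq> I" "distinct js"
  shows
    "(\<forall>mu \<in> Ibeta I alpha (length js) (\<Sum>k<length js. alpha (js ! k)).
      \<forall>nu \<in> Ibeta I alpha (length js) (\<Sum>k<length js. alpha (js ! k)).
       (\<exists>f \<in> fa_elems (QH_gens (length js) (Ibeta I alpha (length js) (\<Sum>k<length js. alpha (js ! k)))).
          fa_mult (fa_mult (fa_word [E nu]) f) (fa_word [E mu])
            \<notin> cyc_ideal I alpha h Iodd t Lam (length js) (\<Sum>k<length js. alpha (js ! k))) \<longrightarrow>
       (\<forall>w as. (w permutes {..<length js}) \<and> perm_act w mu = nu \<and> reduced_expr (length js) w as \<longrightarrow>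
          quot_basis (cyc_ideal I alpha h Iodd t Lam (length js) (\<Sum>k<length js. alpha (js ! k)))
            (corner (QH_gens (length js) (Ibeta I alpha (length js) (\<Sum>k<length js. alpha (js ! k))))
               (cyc_ideal I alpha h Iodd t Lam (length js) (\<Sum>k<length js. alpha (js ! k))) nu mu)
            (exps (length js) (NLam alpha h Lam w mu))
            (\<lambda>r. fa_word (basis_word (length js) as r mu)))) \<and>
     quot_indecomposable (QH_gens (length js) (Ibeta I alpha (length js) (\<Sum>k<length js. alpha (js ! k))))
       (cyc_ideal I alpha h Iodd t Lam (length js) (\<Sum>k<length js. alpha (js ! k)))"
proof -
  define n where "n = length js"
  define Ib where "Ib = {nu. mset nu = mset js}"
  define L where "L = (\<lambda>i. nat (h i Lam))"
  define adj where "adj = (\<lambda>i j. nat (- A i j) > 0)"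
  define G where "G = QH_gens n Ib"
  define J :: "('i, 'k) falg set" where "J = ideal_gen G (qh_rels Iodd t n Ib \<union> cyc_ring L n Ib)"
  have Ib: "Ibeta I alpha n (\<Sum>k<n. alpha (js ! k)) = Ib"
    unfolding n_def Ib_def using cartan js(1) by (intro Ibeta_eq) (simp_all add: cartan_superdatum_def)
  have mem: "set mu \<subseteq> I" "distinct mu" "length mu = n" if "mu \<in> Ib" for mu
    using that js mset_eq_setD mset_eq_length mset_eq_imp_distinct_iff unfolding Ib_def n_def by blast+
  have cyc: "cyc_ideal I alpha h Iodd t Lam n (\<Sum>k<n. alpha (js ! k)) = to_fa ` J"
  proof -
    have "to_fa ` cyc_ring L n Ib = (cyc_rel h Lam n Ib :: ('i, 'k) fa set)"
      by (simp add: cyc_ring_def cyc_rel_def L_def to_fa_sum to_fa_wd)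
    moreover have "to_fa ` qh_rels Iodd t n Ib = QH_rels Iodd t n Ib"
      by (rule to_fa_qh_rels) (use mem in auto)
    ultimately have "QH_rels Iodd t n Ib \<union> cyc_rel h Lam n Ib
        = to_fa ` (qh_rels Iodd t n Ib \<union> cyc_ring L n Ib)" by (simp only: image_Un)
    then show ?thesis unfolding cyc_ideal_def Ib J_def G_def by (simp only: fa_ideal_eq)
  qed
  have col: "column n mu Iodd t (\<lambda>i j. nat (- A (mu ! i) (mu ! j))) (\<lambda>i. nat (d (mu ! i)))" if "mu \<in> Ib" for mu
    using column_of_superdatum[OF cartan form Q mem(1,2)[OF that]] mem(3)[OF that] by simp
  have colIb: "column.Ib n mu = Ib" if "mu \<in> Ib" for mu
    using column.Ib_mset[OF col[OF that]] that by (simp add: Ib_def)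
  \<comment> \<open>Each \<open>mu\<close> has its own representation, but the ideal is the same in
    all of them; this allows conclusions from different columns to be combined.\<close>
  have colJ: "column.J n mu Iodd t L = J" if "mu \<in> Ib" for mu
    unfolding column.J_def[OF col[OF that]] colIb[OF that] J_def G_def ..
  have part1: "quot_basis (to_fa ` J) (corner G (to_fa ` J) nu mu)
      (exps n (NLam alpha h Lam w mu)) (\<lambda>r. fa_word (basis_word n as r mu))"
    if mu: "mu \<in> Ib" and w: "w permutes {..<n}" "perm_act w mu = nu" "reduced_expr n w as" for mu nu w as
  proof -
    interpret c: column n mu Iodd t L "\<lambda>i j. nat (- A (mu ! i) (mu ! j))" "\<lambda>i. nat (d (mu ! i))"
      by (rule col[OF mu])
    have as: "ascending_word n as" by (rule reduced_expr_ascending[OF w(3)])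
    have was: "word_perm as = w" using w(3) by (simp add: reduced_expr_def)
    \<comment> \<open>\<open>perm_act\<close> reads through the inverse while
      \<open>permute_list\<close> reads through its argument, so the column of \<open>mu\<close> is
      entered at \<open>u = inv w\<close>.\<close>
    have nu: "permute_list (inv w) mu = nu" using w(2) by (simp add: perm_act_def permute_list_def)
    have N: "NLam alpha h Lam w mu k = int (c.NN (inv w) k)" if k: "k < n" for k
    proof -
      have I: "mu ! j \<in> I" if "j < n" for j using mem[OF mu] that by auto
      have B: "c.B (inv w) k = {j. j < k \<and> w j < w k}"
        using w(1) by (simp add: c.B_def permutes_inv_inv)
      have "NLam alpha h Lam w mu k = h (mu ! k) Lam - (\<Sum>j\<in>{j. j < k \<and> w j < w k}. h (mu ! k) (alpha (mu ! j)))"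
        unfolding NLam_def using cartan I[OF k]
        by (intro additive_diff_sum) (simp add: cartan_superdatum_def)
      also have "\<dots> = h (mu ! k) Lam - (\<Sum>j\<in>{j. j < k \<and> w j < w k}. A (mu ! k) (mu ! j))"
        using cartan I k by (intro arg_cong[of _ _ "\<lambda>x. _ - x"] sum.cong refl) (auto simp: cartan_superdatum_def)
      also have "\<dots> = int (L (mu ! k)) + (\<Sum>j\<in>c.B (inv w) k. int (nat (- A (mu ! k) (mu ! j))))"
      proof -
        have "h (mu ! k) Lam \<ge> 0" using Lam I[OF k] by (simp add: dominant_def)
        moreover have "int (nat (- A (mu ! k) (mu ! j))) = - A (mu ! k) (mu ! j)" if "j < k" for j
        proof -
          have "mu ! k \<noteq> mu ! j" using that k mem[OF mu] by (simp add: nth_eq_iff_index_eq)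
          then have "A (mu ! k) (mu ! j) \<le> 0"
            using cartan I[OF k] I[of j] that k by (simp add: cartan_superdatum_def)
          then show ?thesis by simp
        qed
        ultimately show ?thesis by (simp add: B L_def sum_negf)
      qed
      also have "\<dots> = int (c.NN (inv w) k)" by (simp add: c.NN_def)
      finally show ?thesis .
    qed
    have "exps n (NLam alpha h Lam w mu) = exps n (\<lambda>k. int (c.NN (inv w) k))"
      unfolding exps_def using N by auto
    then show ?thesis
      using c.quot_basis_column[OF as refl] unfolding was nu colJ[OF mu] colIb[OF mu] G_def[symmetric]
      by (simp only:)
  qed
  have part2: "z \<in> J \<or> z - 1 \<in> J"
    if z: "z \<in> galg G" "\<And>f. f \<in> galg G \<Longrightarrow> z * f - f * z \<in> J" "z * z - z \<in> J" for z
  proof -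
    note ideal = ideal_gen_add[of _ G "qh_rels Iodd t n Ib \<union> cyc_ring L n Ib", folded J_def]
      ideal_gen_diff[of _ G "qh_rels Iodd t n Ib \<union> cyc_ring L n Ib", folded J_def]
    note left = ideal_gen_mult_left[of _ G _ "qh_rels Iodd t n Ib \<union> cyc_ring L n Ib", folded J_def]
    note right = ideal_gen_mult_right[of _ G _ "qh_rels Iodd t n Ib \<union> cyc_ring L n Ib", folded J_def]
    have E: "wd [E mu] \<in> galg G" if "mu \<in> Ib" for mu
      using that by (intro galg_wd) (auto simp: G_def QH_gens_def)
    have dich: "z * wd [E mu] \<in> J \<or> (1 - z) * wd [E mu] \<in> J" if mu: "mu \<in> Ib" for mu
    proof -
      interpret c: column n mu Iodd t L "\<lambda>i j. nat (- A (mu ! i) (mu ! j))" "\<lambda>i. nat (d (mu ! i))"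
        by (rule col[OF mu])
      have "c.central_idem z"
        unfolding c.central_idem_def colJ[OF mu] colIb[OF mu] G_def[symmetric] using z by blast
      from c.central_idem_dichotomy[OF this] show ?thesis unfolding colJ[OF mu] .
    qed
    \<comment> \<open>Orders that are not good have a zero idempotent and impose no condition on
      \<open>z\<close>.\<close>
    have dead: "wd [E mu] \<in> J" if mu: "mu \<in> Ib" and ng: "\<not> good_order L adj mu" for mu
    proof -
      interpret c: column n mu Iodd t L "\<lambda>i j. nat (- A (mu ! i) (mu ! j))" "\<lambda>i. nat (d (mu ! i))"
        by (rule col[OF mu])
      obtain i where i: "i < n" "L (mu ! i) = 0" "\<forall>j<i. \<not> adj (mu ! i) (mu ! j)"
        using ng mem(3)[OF mu] by (auto simp: good_order_def)
      have "c.NN id i = 0" using i(2,3) by (simp add: c.NN_def c.B_def adj_def not_less)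
      from c.E_in_J_if_NN_0[OF i(1) this] show ?thesis unfolding colJ[OF mu] .
    qed
    \<comment> \<open>A nonzero corner element g = e(nu) f e(mu) satisfies z g = g z. If z were 0 on
      e(nu) and 1 on e(mu), the two sides would be 0 and g.\<close>
    have step: "(1 - z) * wd [E (permute_list u mu)] \<in> J"
      if m: "mset mu = mset js" and u: "u permutes {..<length mu}" and lk: "linked L adj mu u"
        and St: "(1 - z) * wd [E mu] \<in> J" for mu u
    proof -
      have mu: "mu \<in> Ib" using m by (simp add: Ib_def)
      interpret c: column n mu Iodd t L "\<lambda>i j. nat (- A (mu ! i) (mu ! j))" "\<lambda>i. nat (d (mu ! i))"
        by (rule col[OF mu])
      let ?nu = "permute_list u mu"
      have un: "u permutes {..<n}" using u mem(3)[OF mu] by simp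
      have nu: "?nu \<in> Ib" using m u by (simp add: Ib_def)
      have "c.NN u i > 0" if i: "i < n" for i
      proof (cases "L (mu ! i) > 0")
        case True
        then show ?thesis by (simp add: c.NN_def)
      next
        case False
        then obtain j where j: "j < i" "inv u j < inv u i" "adj (mu ! i) (mu ! j)"
          using lk i mem(3)[OF mu] by (auto simp: linked_def)
        then have "j \<in> c.B u i" by (simp add: c.B_def)
        then have "nat (- A (mu ! i) (mu ! j)) \<le> (\<Sum>j\<in>c.B u i. nat (- A (mu ! i) (mu ! j)))"
          using c.finite_B by (intro member_le_sum) auto
        then show ?thesis using j(3) unfolding c.NN_def adj_def by linarith
      qed
      from c.corner_nonzero[OF un this]
      obtain f where f: "f \<in> galg G" "wd [E ?nu] * f * wd [E mu] \<notin> J"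
        unfolding colJ[OF mu] colIb[OF mu] G_def[symmetric] by blast
      show ?thesis
      proof (rule ccontr)
        assume "(1 - z) * wd [E ?nu] \<notin> J"
        then have "z * wd [E ?nu] \<in> J" using dich[OF nu] by blast
        then have 1: "z * wd [E ?nu] * (f * wd [E mu]) \<in> J"
          by (rule right[OF galg_mult[OF f(1) E[OF mu]]])
        have 2: "z * (wd [E ?nu] * f * wd [E mu]) - (wd [E ?nu] * f * wd [E mu]) * z \<in> J"
          by (intro z galg_mult f E mu nu)
        have "(1 - z) * wd [E mu] + (z * wd [E mu] - wd [E mu] * z) \<in> J"
          by (intro ideal St z E mu)
        then have "wd [E ?nu] * f * ((1 - z) * wd [E mu] + (z * wd [E mu] - wd [E mu] * z)) \<in> J"
          by (intro left galg_mult f E nu)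
        then have 3: "wd [E ?nu] * f * wd [E mu] - (wd [E ?nu] * f * wd [E mu]) * z \<in> J"
          by (simp add: algebra_simps)
        \<comment> \<open>In this combination all terms containing \<open>z\<close> cancel, so the
          nonzero corner element itself would lie in the ideal.\<close>
        have "z * wd [E ?nu] * (f * wd [E mu])
            - (z * (wd [E ?nu] * f * wd [E mu]) - (wd [E ?nu] * f * wd [E mu]) * z)
            + (wd [E ?nu] * f * wd [E mu] - (wd [E ?nu] * f * wd [E mu]) * z) \<in> J"
          by (intro ideal 1 2 3)
        then show False using f(2) by (simp add: mult.assoc)
      qed
    qed
    \<comment> \<open>The idempotents sum to 1, so membership in the ideal can be tested on each of
      them.\<close>
    have unit: "y \<in> J" if y: "y \<in> galg G" "\<And>mu. mu \<in> Ib \<Longrightarrow> y * wd [E mu] \<in> J" for y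
    proof -
      have "(\<Sum>nu\<in>Ib. wd [E nu]) - wd [] \<in> J"
        unfolding J_def by (intro ideal_gen_base UnI1 qh_rels.unit)
      then have "y * ((\<Sum>nu\<in>Ib. wd [E nu]) - 1) \<in> J" by (intro left y) simp
      moreover have "(\<Sum>nu\<in>Ib. y * wd [E nu]) \<in> J"
        unfolding J_def by (intro ideal_gen_sum) (use y in \<open>simp add: J_def\<close>)
      ultimately have "(\<Sum>nu\<in>Ib. y * wd [E nu]) - y * ((\<Sum>nu\<in>Ib. wd [E nu]) - 1) \<in> J"
        by (intro ideal)
      then show ?thesis by (simp add: right_diff_distrib sum_distrib_left)
    qed
    show ?thesis
    proof (cases "\<forall>mu\<in>Ib. z * wd [E mu] \<in> J")
      case True
      then show ?thesis using unit z(1) by blast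
    next
      case False
      then obtain mu where mu: "mu \<in> Ib" "z * wd [E mu] \<notin> J" by blast
      then have St: "(1 - z) * wd [E mu] \<in> J" using dich by blast
      \<comment> \<open>z e(mu) is not in the ideal, hence neither is e(mu), and \<open>mu\<close>
        can serve as the starting point of the chains.\<close>
      have gmu: "good_order L adj mu" using dead[OF mu(1)] left[OF z(1)] mu(2) by blast
      have all: "(1 - z) * wd [E nu] \<in> J" if nu: "nu \<in> Ib" for nu
      proof (cases "good_order L adj nu")
        case True
        have "mset nu = mset js" "mset mu = mset js" using nu mu(1) by (simp_all add: Ib_def)
        then show ?thesis
          using good_orders_linked[where M = "mset js" and St = "\<lambda>mu. (1 - z) * wd [E mu] \<in> J", OF step
              _ mem(2)[OF nu] True _ gmu St] by blast
      next
        case False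
        then show ?thesis using dead[OF nu] by (intro left galg_diff galg_one z)
      qed
      have "1 - z \<in> J" by (rule unit[OF galg_diff[OF galg_one z(1)] all])
      moreover have "0 \<in> J" unfolding J_def by (rule ideal_gen.zero)
      ultimately have "0 - (1 - z) \<in> J" using ideal(2)[of 0 "1 - z"] by blast
      then show ?thesis by simp
    qed
  qed
  have inJ: "to_fa p \<in> to_fa ` J \<longleftrightarrow> p \<in> J" for p
    using inj_to_fa by (auto simp: image_iff)
  have "quot_indecomposable G (to_fa ` J)"
    unfolding quot_indecomposable_def
  proof (intro ballI impI)
    fix z assume "z \<in> fa_elems G" and
      z: "(\<forall>f\<in>fa_elems G. fa_diff (fa_mult z f) (fa_mult f z) \<in> to_fa ` J) \<and> fa_diff (fa_mult z z) z \<in> to_fa ` J"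
    then obtain y where y: "y \<in> galg G" "z = to_fa y" by (auto simp: fa_elems_eq)
    have "to_fa (y * f - f * y) \<in> to_fa ` J" if "f \<in> galg G" for f
      using z that unfolding y(2) fa_elems_eq by (simp add: to_fa_diff to_fa_mult)
    moreover have "to_fa (y * y - y) \<in> to_fa ` J" using z unfolding y(2) by (simp add: to_fa_diff to_fa_mult)
    ultimately have "y \<in> J \<or> y - wd [] \<in> J" using part2[OF y(1)] unfolding inJ by simp
    then have "to_fa y \<in> to_fa ` J \<or> to_fa (y - wd []) \<in> to_fa ` J" unfolding inJ .
    then show "z \<in> to_fa ` J \<or> fa_diff z (fa_word []) \<in> to_fa ` J" unfolding y(2) to_fa_diff to_fa_wd .
  qed
  then show ?thesis
    unfolding n_def[symmetric] Ib cyc G_def[symmetric] using part1 by blast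
qed

end
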